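(* Let $A\subset\mathbb{R}^d$ be a locally finite set. In order that every measure $\mu\in S^*(\mathbb{R}^d)$ with support in $A$ have s-almost periodic Fourier transform $\hat\mu$, it is necessary and sufficient that $A$ be $p$-discrete. Moreover, if $(\hat\mu\star\psi)(t)$ is bounded in $t\in\mathbb{R}^d$ for all $\psi\in S(\mathbb{R}^d)$ and all measures $\mu\in S^*(\mathbb{R}^d)$ with $\operatorname{supp}\mu\subset A$, then $A$ is $p$-discrete too.
   Context: $S(\mathbb{R}^d)$ is the Schwartz space and $S^*(\mathbb{R}^d)$ is the space of temperate (tempered) distributions. The Fourier transform of a test function is $\hat\varphi(y)=\int_{\mathbb{R}^d}\varphi(x)e^{-2\pi i\langle x,y\rangle}dx$, and for $f\in S^*(\mathbb{R}^d)$ it is defined by $\hat f(\varphi)=f(\hat\varphi)$. A measure means a complex-valued (locally finite, Radon) measure on $\mathbb{R}^d$. A set $A\subset\mathbb{R}^d$ is locally finite if its intersection with every ball is finite. It is $p$-discrete (polynomially discrete) if there are positive numbers $c,h$ such that $|x-x'|\ge c\min\{1,|x|^{-h},|x'|^{-h}\}$ for all $x,x'\in A$, $x\ne x'$. For $f\in S^*(\mathbb{R}^d)$ and $\psi\in S(\mathbb{R}^d)$, $(f\star\psi)(t)=(\psi\star f)(t)=f(\psi(t-\cdot))$. A continuous function $g$ on $\mathbb{R}^d$ is almost periodic if for every $\varepsilon>0$ the set $\{\tau\in\mathbb{R}^d:\sup_{x}|g(x+\tau)-g(x)|<\varepsilon\}$ is relatively dense (i.e. for some $R<\infty$ it meets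 every ball of radius $R$). A distribution $f\in S^*(\mathbb{R}^d)$ is s-almost periodic if $t\mapsto(\psi\star f)(t)$ is almost periodic for every $\psi\in S(\mathbb{R}^d)$. *)

theory Defs
  imports "HOL-Analysis.Analysis"
begin

section \<open>Schwartz functions and temperate distributions\<close>

text \<open>Partial derivatives \<open>D\<^sup>k\<close> are indexed by lists of basis vectors instead of multi-indices; for
  smooth functions the order of the entries is irrelevant.\<close>

primrec iter_deriv ::
  "'a::euclidean_space list \<Rightarrow> ('a \<Rightarrow> complex) \<Rightarrow> 'a \<Rightarrow> complex" where
  "iter_deriv [] \<phi> = \<phi>"
| "iter_deriv (v # vs) \<phi> = (\<lambda>x. frechet_derivative (iter_deriv vs \<phi>) (at x) v)"

definition smooth :: "('a::euclidean_space \<Rightarrow> complex) \<Rightarrow> bool" where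
  "smooth \<phi> \<longleftrightarrow> (\<forall>vs. set vs \<subseteq> Basis \<longrightarrow> iter_deriv vs \<phi> differentiable_on UNIV)"

definition schwartz_weight ::
  "nat \<Rightarrow> nat \<Rightarrow> ('a::euclidean_space \<Rightarrow> complex) \<Rightarrow> 'a \<Rightarrow> real" where
  "schwartz_weight n m \<phi> x =
    max 1 (norm x ^ n) *
    Max ((\<lambda>vs. norm (iter_deriv vs \<phi> x)) ` {vs. set vs \<subseteq> Basis \<and> length vs \<le> m})"

definition schwartz_space :: "('a::euclidean_space \<Rightarrow> complex) set" where
  "schwartz_space = {\<phi>. smooth \<phi> \<and> (\<forall>n m. bdd_above (range (schwartz_weight n m \<phi>)))}"

definition schwartz_norm ::
  "nat \<Rightarrow> nat \<Rightarrow> ('a::euclidean_space \<Rightarrow> complex) \<Rightarrow> real" where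
  "schwartz_norm n m \<phi> = (SUP x. schwartz_weight n m \<phi> x)"

definition schwartz_topology :: "('a::euclidean_space \<Rightarrow> complex) topology" where
  "schwartz_topology = topology_generated_by
    {{\<psi> \<in> schwartz_space. schwartz_norm n m (\<lambda>x. \<psi> x - \<phi> x) < \<epsilon>} | \<phi> n m \<epsilon>.
      \<phi> \<in> schwartz_space \<and> \<epsilon> > 0}"

text \<open>A distribution is a functional on all functions of which only the values on
  \<^const>\<open>schwartz_space\<close> matter.\<close>

definition temperate_distribution ::
  "(('a::euclidean_space \<Rightarrow> complex) \<Rightarrow> complex) \<Rightarrow> bool" where
  "temperate_distribution f \<longleftrightarrow>
    (\<forall>\<phi>\<in>schwartz_space. \<forall>\<psi>\<in>schwartz_space. \<forall>a b.
      f (\<lambda>x. a * \<phi> x + b * \<psi> x) = a * f \<phi> + b * f \<psi>) \<and>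
    continuous_map schwartz_topology euclidean f"

definition fourier :: "('a::euclidean_space \<Rightarrow> complex) \<Rightarrow> 'a \<Rightarrow> complex" where
  "fourier \<phi> y =
    (LINT x|lborel. \<phi> x * exp (- 2 * complex_of_real pi * \<i> * complex_of_real (x \<bullet> y)))"

definition fourier_distribution ::
  "(('a::euclidean_space \<Rightarrow> complex) \<Rightarrow> complex) \<Rightarrow> ('a \<Rightarrow> complex) \<Rightarrow> complex" where
  "fourier_distribution f \<phi> = f (fourier \<phi>)"

definition dist_convolution ::
  "(('a::euclidean_space \<Rightarrow> complex) \<Rightarrow> complex) \<Rightarrow> ('a \<Rightarrow> complex) \<Rightarrow> 'a \<Rightarrow> complex" where
  "dist_convolution f \<psi> t = f (\<lambda>x. \<psi> (t - x))"


section \<open>Complex measures\<close>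

text \<open>A complex-valued locally finite measure is a countably additive function on the bounded Borel
  sets; its values on other sets are irrelevant. On each ball it is an ordinary (finite) complex Borel
  measure, so on a Euclidean space the Radon property is automatic.\<close>

definition complex_radon_measure :: "('a::euclidean_space set \<Rightarrow> complex) \<Rightarrow> bool" where
  "complex_radon_measure \<mu> \<longleftrightarrow>
    (\<forall>B :: nat \<Rightarrow> 'a set. range B \<subseteq> sets borel \<longrightarrow> disjoint_family B \<longrightarrow> bounded (\<Union>i. B i) \<longrightarrow>
      (\<lambda>i. \<mu> (B i)) sums \<mu> (\<Union>i. B i))"

definition cmeasure_support :: "('a::euclidean_space set \<Rightarrow> complex) \<Rightarrow> 'a set" where
  "cmeasure_support \<mu> =
    {x. \<forall>U. open U \<longrightarrow> x \<in> U \<longrightarrow> (\<exists>B\<in>sets borel. bounded B \<and> B \<subseteq> U \<and> \<mu> B \<noteq> 0)}"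

text \<open>Integral of a bounded Borel function with bounded support, by uniform approximation with simple
  functions vanishing outside a common bounded set. The limit does not depend on the approximation,
  since a complex measure has finite variation on bounded sets.\<close>

definition cmeasure_has_integral ::
  "('a::euclidean_space set \<Rightarrow> complex) \<Rightarrow> ('a \<Rightarrow> complex) \<Rightarrow> complex \<Rightarrow> bool" where
  "cmeasure_has_integral \<mu> \<phi> I \<longleftrightarrow>
    (\<exists>s. (\<forall>n. simple_function borel (s n)) \<and>
         bounded (\<Union>n. {x. s n x \<noteq> 0}) \<and>
         uniform_limit UNIV s \<phi> sequentially \<and>
         (\<lambda>n. \<Sum>z\<in>range (s n) - {0}. z * \<mu> (s n -` {z})) \<longlonglongrightarrow> I)"

text \<open>The measure \<open>\<mu>\<close> belongs to the space of temperate distributions, as the distribution \<open>f\<close>: the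
  functional \<open>\<phi> \<mapsto> \<integral>\<phi> d\<mu>\<close> on compactly supported smooth functions extends to \<open>f\<close>. By density
  the extension is unique on \<^const>\<open>schwartz_space\<close>. The integral of a general Schwartz function
  need not converge absolutely, so the variation of \<open>\<mu>\<close> need not be temperate.\<close>

definition temperate_measure ::
  "('a::euclidean_space set \<Rightarrow> complex) \<Rightarrow> (('a \<Rightarrow> complex) \<Rightarrow> complex) \<Rightarrow> bool" where
  "temperate_measure \<mu> f \<longleftrightarrow>
    complex_radon_measure \<mu> \<and> temperate_distribution f \<and>
    (\<forall>\<phi>. smooth \<phi> \<longrightarrow> compact (closure {x. \<phi> x \<noteq> 0}) \<longrightarrow> cmeasure_has_integral \<mu> \<phi> (f \<phi>))"


section \<open>Almost periodicity\<close>

definition relatively_dense :: "'a::euclidean_space set \<Rightarrow> bool" where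
  "relatively_dense T \<longleftrightarrow> (\<exists>R. \<forall>x. T \<inter> ball x R \<noteq> {})"

text \<open>The supremum is taken in the extended reals, where it is \<open>\<infinity>\<close> for unbounded differences.\<close>

definition almost_periodic :: "('a::euclidean_space \<Rightarrow> complex) \<Rightarrow> bool" where
  "almost_periodic g \<longleftrightarrow>
    continuous_on UNIV g \<and>
    (\<forall>\<epsilon>>0. relatively_dense {\<tau>. (SUP x. ereal (norm (g (x + \<tau>) - g x))) < ereal \<epsilon>})"

definition s_almost_periodic ::
  "(('a::euclidean_space \<Rightarrow> complex) \<Rightarrow> complex) \<Rightarrow> bool" where
  "s_almost_periodic f \<longleftrightarrow> (\<forall>\<psi>\<in>schwartz_space. almost_periodic (dist_convolution f \<psi>))"


section \<open>Discrete sets\<close>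

definition locally_finite_set :: "'a::euclidean_space set \<Rightarrow> bool" where
  "locally_finite_set A \<longleftrightarrow> (\<forall>x r. finite (A \<inter> ball x r))"

text \<open>The bound \<open>c min {1, |x|\<^sup>-\<^sup>h, |x'|\<^sup>-\<^sup>h}\<close> is written as a quotient, because \<open>0 powr (-h) = 0\<close> in the
  library, whereas \<open>|x|\<^sup>-\<^sup>h\<close> has to be read as \<open>\<infinity>\<close> for \<open>x = 0\<close>.\<close>

definition p_discrete :: "'a::euclidean_space set \<Rightarrow> bool" where
  "p_discrete A \<longleftrightarrow>
    (\<exists>c>0. \<exists>h>0. \<forall>x\<in>A. \<forall>x'\<in>A. x \<noteq> x' \<longrightarrow>
      norm (x - x') \<ge> c / Max {1, norm x powr h, norm x' powr h})"

end

theory Submission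
  imports Defs "HOL-Probability.Characteristic_Functions" "HOL-Probability.Sinc_Integral"
    "HOL-Real_Asymp.Real_Asymp"
begin

text \<open>A measure \<open>\<mu>\<close> supported in \<open>A\<close> is a sum of point masses. If \<open>A\<close> is \<open>p\<close>-discrete, testing the distribution on
  disjoint bumps around the points of \<open>A\<close> shows that the masses are summable against a negative power of
  \<open>1 + norm a\<close>. Hence the convolution of the Fourier transform with \<open>\<psi>\<close> is an absolutely convergent series
  of characters, and such a series is almost periodic by a pigeonhole argument on the phases.

  Conversely, almost periodic functions are bounded. If \<open>A\<close> is not \<open>p\<close>-discrete, it contains pairs
  \<open>X k\<close>, \<open>X' k\<close> tending to infinity at distances \<open>u k ^ 4\<close>, where \<open>u k\<close> decays as fast as desired. The sum of the
  dipoles \<open>\<phi> (X' k) - \<phi> (X k)\<close> with weights \<open>1 / u k ^ 2\<close> is still temperate, because it costs only one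
  derivative. A modulation by a character \<open>t\<close> with \<open>t (X' k - X k) = -1\<close> destroys the
  cancellation in the \<open>k\<close>-th dipole; if the inverse Fourier transform of \<open>\<psi>\<close> is nonnegative and at least of order \<open>u k\<close> at
  \<open>X k\<close>, this dipole contributes about \<open>1 / u k\<close> and dominates all the others.\<close>

section \<open>Families of smooth functions\<close>

text \<open>Being a tempered distribution puts no bound on the variation of \<open>\<mu>\<close>:
  cancellation between neighbouring masses may hide their size. Polynomial separation rules this
  out, and the dipoles exploit its absence. Their exponents are a budget. Distance
  \<open>u ^ 4\<close> and weight \<open>1 / u ^ 2\<close> leave \<open>u ^ 2\<close> on a Lipschitz
  function, which is summable, while an undone cancellation leaves \<open>1 / u ^ 2\<close> times a
  test value of order \<open>u\<close>, hence \<open>1 / u\<close>. Two demands fix how fast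
  \<open>u\<close> decays. The rule \<open>u (Suc k) * 2 ^ Suc k \<le> u k ^ 2\<close> makes the
  earlier weights \<open>1 / u j ^ 2\<close> negligible against \<open>1 / u k\<close>, and it keeps
  the later dipoles small although the modulation at stage \<open>k\<close> has the large frequency
  \<open>1 / (2 * u k ^ 4)\<close>. Decay of \<open>u k\<close> faster than any power of
  \<open>norm (X k)\<close> allows a Schwartz function to have values of order \<open>u k\<close> at
  \<open>X k\<close>. Since the construction contradicts mere boundedness, it yields necessity and
  the supplement together.\<close>

definition partial :: "'a::euclidean_space \<Rightarrow> ('a \<Rightarrow> complex) \<Rightarrow> 'a \<Rightarrow> complex" where
  "partial v \<phi> x = frechet_derivative \<phi> (at x) v"

lemma partial_eqI: "(\<phi> has_derivative D) (at x) \<Longrightarrow> partial v \<phi> x = D v"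
  unfolding partial_def by (metis frechet_derivative_at)

lemma has_derivative_partial:
  fixes \<phi> :: "'a::euclidean_space \<Rightarrow> complex"
  assumes "\<phi> differentiable (at x)"
  shows "(\<phi> has_derivative (\<lambda>h. \<Sum>i\<in>Basis. (h \<bullet> i) *\<^sub>R partial i \<phi> x)) (at x)"
proof -
  have D: "(\<phi> has_derivative frechet_derivative \<phi> (at x)) (at x)"
    using assms frechet_derivative_works by blast
  have lin: "linear (frechet_derivative \<phi> (at x))"
    using D has_derivative_linear by blast
  have "frechet_derivative \<phi> (at x) h = (\<Sum>i\<in>Basis. (h \<bullet> i) *\<^sub>R partial i \<phi> x)" for h
  proof -
    have "frechet_derivative \<phi> (at x) (\<Sum>i\<in>Basis. (h \<bullet> i) *\<^sub>R i) =
        (\<Sum>i\<in>Basis. (h \<bullet> i) *\<^sub>R frechet_derivative \<phi> (at x) i)"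
      by (simp add: linear_sum[OF lin] linear_scale[OF lin])
    then show ?thesis by (simp add: euclidean_representation partial_def)
  qed
  then have "frechet_derivative \<phi> (at x) = (\<lambda>h. \<Sum>i\<in>Basis. (h \<bullet> i) *\<^sub>R partial i \<phi> x)" by blast
  then show ?thesis using D by simp
qed

lemma iter_deriv_Cons_partial: "iter_deriv (v # vs) \<phi> = partial v (iter_deriv vs \<phi>)"
  by (auto simp: partial_def fun_eq_iff)

text \<open>\<open>iter_deriv\<close> adds derivatives on the outside; this form peels off the
  innermost one, so that inductions on the order can replace \<open>\<phi>\<close> by
  \<open>partial v \<phi>\<close>.\<close>

lemma iter_deriv_snoc: "iter_deriv (vs @ [v]) \<phi> = iter_deriv vs (partial v \<phi>)"
  by (induction vs) (simp_all add: partial_def[abs_def])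

text \<open>Uniform bounds for families of functions are handled by a bound class \<open>B\<close>, a predicate on
  families which has to hold for every family of partial derivatives.\<close>

definition smooth_upto ::
  "(('j \<Rightarrow> 'a::euclidean_space \<Rightarrow> complex) \<Rightarrow> bool) \<Rightarrow> nat \<Rightarrow> ('j \<Rightarrow> 'a \<Rightarrow> complex) \<Rightarrow> bool" where
  "smooth_upto B n \<Phi> \<longleftrightarrow> (\<forall>vs. set vs \<subseteq> Basis \<longrightarrow> length vs \<le> n \<longrightarrow>
    (\<forall>j x. iter_deriv vs (\<Phi> j) differentiable (at x)) \<and> B (\<lambda>j. iter_deriv vs (\<Phi> j)))"

definition smooth_family ::
  "(('j \<Rightarrow> 'a::euclidean_space \<Rightarrow> complex) \<Rightarrow> bool) \<Rightarrow> ('j \<Rightarrow> 'a \<Rightarrow> complex) \<Rightarrow> bool" where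
  "smooth_family B \<Phi> \<longleftrightarrow> (\<forall>n. smooth_upto B n \<Phi>)"

lemma smooth_family_iter:
  "smooth_family B \<Phi> \<longleftrightarrow> (\<forall>vs. set vs \<subseteq> Basis \<longrightarrow>
    (\<forall>j x. iter_deriv vs (\<Phi> j) differentiable (at x)) \<and> B (\<lambda>j. iter_deriv vs (\<Phi> j)))"
  unfolding smooth_family_def smooth_upto_def by blast

lemma smooth_upto_0:
  "smooth_upto B 0 \<Phi> \<longleftrightarrow> (\<forall>j x. \<Phi> j differentiable (at x)) \<and> B \<Phi>"
  unfolding smooth_upto_def by auto

lemma smooth_upto_Suc:
  "smooth_upto B (Suc n) \<Phi> \<longleftrightarrow> (\<forall>j x. \<Phi> j differentiable (at x)) \<and> B \<Phi> \<and>
    (\<forall>i\<in>Basis. smooth_upto B n (\<lambda>j. partial i (\<Phi> j)))" (is "?L \<longleftrightarrow> ?R")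
proof
  assume L: ?L
  have "smooth_upto B n (\<lambda>j. partial i (\<Phi> j))" if "i \<in> Basis" for i
    unfolding smooth_upto_def
  proof (intro allI impI)
    fix vs :: "'b list" assume "set vs \<subseteq> Basis" "length vs \<le> n"
    then show "(\<forall>j x. iter_deriv vs (partial i (\<Phi> j)) differentiable (at x)) \<and>
        B (\<lambda>j. iter_deriv vs (partial i (\<Phi> j)))"
      using L[unfolded smooth_upto_def, rule_format, of "vs @ [i]"] that by (simp add: iter_deriv_snoc)
  qed
  then show ?R using L[unfolded smooth_upto_def, rule_format, of "[]"] by auto
next
  assume R: ?R
  show ?L unfolding smooth_upto_def
  proof (intro allI impI)
    fix vs :: "'b list" assume vs: "set vs \<subseteq> Basis" "length vs \<le> Suc n"
    show "(\<forall>j x. iter_deriv vs (\<Phi> j) differentiable (at x)) \<and> B (\<lambda>j. iter_deriv vs (\<Phi> j))"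
    proof (cases vs rule: rev_cases)
      case Nil then show ?thesis using R by auto
    next
      case (snoc ws i)
      then show ?thesis using R vs by (auto simp: iter_deriv_snoc smooth_upto_def)
    qed
  qed
qed

lemma smooth_upto_SucD: "smooth_upto B (Suc n) \<Phi> \<Longrightarrow> smooth_upto B n \<Phi>"
  unfolding smooth_upto_def by auto

lemma smooth_upto_D:
  assumes "smooth_upto B n \<Phi>"
  shows "\<Phi> j differentiable (at x)" and "B \<Phi>"
  using assms[unfolded smooth_upto_def, rule_format, of "[]"] by auto

lemma smooth_family_D:
  assumes "smooth_family B \<Phi>"
  shows "\<Phi> j differentiable (at x)" and "B \<Phi>"
    and "i \<in> Basis \<Longrightarrow> smooth_family B (\<lambda>j. partial i (\<Phi> j))"
  using assms smooth_upto_D[of B 0 \<Phi>] smooth_upto_Suc[of B _ \<Phi>] unfolding smooth_family_def by blast+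

text \<open>An invariant that survives partial derivatives passes to all orders, because the
  induction on \<open>n\<close> ranges over every family satisfying \<open>P\<close>. It serves for
  explicit classes closed under differentiation: constants and coordinates, characters with
  coefficients, Fourier transforms, weighted series.\<close>

lemma smooth_family_coinduct:
  assumes "P \<Phi>"
    and "\<And>\<Phi> j x. P \<Phi> \<Longrightarrow> \<Phi> j differentiable (at x)"
    and "\<And>\<Phi>. P \<Phi> \<Longrightarrow> B \<Phi>"
    and "\<And>\<Phi> i. P \<Phi> \<Longrightarrow> i \<in> Basis \<Longrightarrow> P (\<lambda>j. partial i (\<Phi> j))"
  shows "smooth_family B \<Phi>"
proof -
  have "\<forall>\<Phi>. P \<Phi> \<longrightarrow> smooth_upto B n \<Phi>" for n
    by (induction n) (use assms in \<open>auto simp: smooth_upto_0 smooth_upto_Suc\<close>)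
  then show ?thesis using assms(1) unfolding smooth_family_def by blast
qed

lemma partial_lincomb:
  fixes \<phi> \<psi> :: "'a::euclidean_space \<Rightarrow> complex"
  assumes "\<phi> differentiable (at x)" "\<psi> differentiable (at x)"
  shows "partial i (\<lambda>x. a * \<phi> x + b * \<psi> x) x = a * partial i \<phi> x + b * partial i \<psi> x"
proof -
  have "((\<lambda>x. a * \<phi> x + b * \<psi> x) has_derivative
    (\<lambda>h. a * frechet_derivative \<phi> (at x) h + b * frechet_derivative \<psi> (at x) h)) (at x)"
    using assms by (auto intro!: derivative_eq_intros simp: frechet_derivative_works)
  from partial_eqI[OF this] show ?thesis by (simp add: partial_def)
qed

lemma partial_mult:
  fixes \<phi> \<psi> :: "'a::euclidean_space \<Rightarrow> complex"
  assumes "\<phi> differentiable (at x)" "\<psi> differentiable (at x)"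
  shows "partial i (\<lambda>x. \<phi> x * \<psi> x) x = partial i \<phi> x * \<psi> x + \<phi> x * partial i \<psi> x"
proof -
  have "((\<lambda>x. \<phi> x * \<psi> x) has_derivative
    (\<lambda>h. \<phi> x * frechet_derivative \<psi> (at x) h + frechet_derivative \<phi> (at x) h * \<psi> x)) (at x)"
    using assms by (auto intro!: derivative_eq_intros simp: frechet_derivative_works)
  from partial_eqI[OF this] show ?thesis by (simp add: partial_def)
qed

lemma smooth_upto_lincomb:
  assumes B: "\<And>\<Phi> \<Psi>. B \<Phi> \<Longrightarrow> B \<Psi> \<Longrightarrow> B (\<lambda>j x. a * \<Phi> j x + b * \<Psi> j x)"
  shows "smooth_upto B n \<Phi> \<Longrightarrow> smooth_upto B n \<Psi> \<Longrightarrow> smooth_upto B n (\<lambda>j x. a * \<Phi> j x + b * \<Psi> j x)"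
proof (induction n arbitrary: \<Phi> \<Psi>)
  case 0
  then show ?case using B by (auto simp: smooth_upto_0 intro!: derivative_intros)
next
  case (Suc n)
  note d = smooth_upto_D(1)[OF Suc.prems(1)] smooth_upto_D(1)[OF Suc.prems(2)]
  have "smooth_upto B n (\<lambda>j. partial i (\<lambda>x. a * \<Phi> j x + b * \<Psi> j x))" if "i \<in> Basis" for i
  proof -
    have "(\<lambda>j. partial i (\<lambda>x. a * \<Phi> j x + b * \<Psi> j x)) =
        (\<lambda>j x. a * partial i (\<Phi> j) x + b * partial i (\<Psi> j) x)"
      using d by (auto simp: fun_eq_iff partial_lincomb)
    then show ?thesis using Suc that by (simp add: smooth_upto_Suc)
  qed
  then show ?case using Suc.prems B d by (auto simp: smooth_upto_Suc intro!: derivative_intros)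
qed

lemma smooth_family_lincomb:
  assumes "\<And>\<Phi> \<Psi>. B \<Phi> \<Longrightarrow> B \<Psi> \<Longrightarrow> B (\<lambda>j x. a * \<Phi> j x + b * \<Psi> j x)"
  shows "smooth_family B \<Phi> \<Longrightarrow> smooth_family B \<Psi> \<Longrightarrow> smooth_family B (\<lambda>j x. a * \<Phi> j x + b * \<Psi> j x)"
  using smooth_upto_lincomb[of B] assms unfolding smooth_family_def by blast

text \<open>The product rule leaves two products in which one factor is differentiated and the other
  merely has its order lowered, so the induction hypothesis applies to both. The classes are kept
  apart because a polynomially bounded factor times a rapidly decreasing one is rapidly
  decreasing.\<close>

lemma smooth_upto_mult:
  assumes B: "\<And>\<Phi> \<Psi>. B1 \<Phi> \<Longrightarrow> B2 \<Psi> \<Longrightarrow> B3 (\<lambda>j x. \<Phi> j x * \<Psi> j x)"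
    and B3: "\<And>\<Phi> \<Psi>. B3 \<Phi> \<Longrightarrow> B3 \<Psi> \<Longrightarrow> B3 (\<lambda>j x. \<Phi> j x + \<Psi> j x)"
  shows "smooth_upto B1 n \<Phi> \<Longrightarrow> smooth_upto B2 n \<Psi> \<Longrightarrow> smooth_upto B3 n (\<lambda>j x. \<Phi> j x * \<Psi> j x)"
proof (induction n arbitrary: \<Phi> \<Psi>)
  case 0
  then show ?case using B by (auto simp: smooth_upto_0 intro!: derivative_intros)
next
  case (Suc n)
  note d = smooth_upto_D(1)[OF Suc.prems(1)] smooth_upto_D(1)[OF Suc.prems(2)]
  have "smooth_upto B3 n (\<lambda>j. partial i (\<lambda>x. \<Phi> j x * \<Psi> j x))" if i: "i \<in> Basis" for i
  proof -
    have "(\<lambda>j. partial i (\<lambda>x. \<Phi> j x * \<Psi> j x)) =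
        (\<lambda>j x. 1 * (partial i (\<Phi> j) x * \<Psi> j x) + 1 * (\<Phi> j x * partial i (\<Psi> j) x))"
      using d by (auto simp: fun_eq_iff partial_mult)
    moreover have "smooth_upto B3 n (\<lambda>j x. partial i (\<Phi> j) x * \<Psi> j x)"
        "smooth_upto B3 n (\<lambda>j x. \<Phi> j x * partial i (\<Psi> j) x)"
      using Suc.IH smooth_upto_SucD[OF Suc.prems(1)] smooth_upto_SucD[OF Suc.prems(2)] Suc.prems i
      by (simp_all add: smooth_upto_Suc)
    ultimately show ?thesis
      using smooth_upto_lincomb[of B3 1 1] B3 by simp
  qed
  then show ?case using Suc.prems B d by (auto simp: smooth_upto_Suc intro!: derivative_intros)
qed

lemma smooth_family_mult:
  assumes "\<And>\<Phi> \<Psi>. B1 \<Phi> \<Longrightarrow> B2 \<Psi> \<Longrightarrow> B3 (\<lambda>j x. \<Phi> j x * \<Psi> j x)"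
    and "\<And>\<Phi> \<Psi>. B3 \<Phi> \<Longrightarrow> B3 \<Psi> \<Longrightarrow> B3 (\<lambda>j x. \<Phi> j x + \<Psi> j x)"
  shows "smooth_family B1 \<Phi> \<Longrightarrow> smooth_family B2 \<Psi> \<Longrightarrow> smooth_family B3 (\<lambda>j x. \<Phi> j x * \<Psi> j x)"
  using smooth_upto_mult[of B1 B2 B3] assms unfolding smooth_family_def by blast

text \<open>Imposed on all derivatives, this describes a uniformly bounded set of multipliers of the
  Schwartz space, and \<open>rapid\<close> below describes a bounded subset of the Schwartz space
  itself.\<close>

definition poly_bounded :: "('j \<Rightarrow> 'a::euclidean_space \<Rightarrow> complex) \<Rightarrow> bool" where
  "poly_bounded \<Phi> \<longleftrightarrow> (\<exists>C N. \<forall>j x. norm (\<Phi> j x) \<le> C * (1 + norm x) ^ N)"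

definition rapid :: "('j \<Rightarrow> 'a::euclidean_space \<Rightarrow> complex) \<Rightarrow> bool" where
  "rapid \<Phi> \<longleftrightarrow> (\<forall>n. \<exists>C. \<forall>j x. (1 + norm x) ^ n * norm (\<Phi> j x) \<le> C)"

lemma rapidD:
  assumes "rapid \<Phi>"
  obtains C where "C > 0" "\<And>j x. (1 + norm x) ^ n * norm (\<Phi> j x) \<le> C"
proof -
  obtain C where C: "\<And>j x. (1 + norm x) ^ n * norm (\<Phi> j x) \<le> C"
    using assms unfolding rapid_def by blast
  show thesis by (rule that[of "max C 1"]) (auto simp: max_def intro: order_trans[OF C])
qed

lemma poly_boundedD:
  assumes "poly_bounded \<Phi>"
  obtains C N where "C > 0" "\<And>j x. norm (\<Phi> j x) \<le> C * (1 + norm x) ^ N"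
proof -
  obtain C N where C: "\<And>j x. norm (\<Phi> j x) \<le> C * (1 + norm x) ^ N"
    using assms unfolding poly_bounded_def by blast
  have "norm (\<Phi> j x) \<le> max C 1 * (1 + norm x) ^ N" for j x
    by (rule order_trans[OF C]) (auto intro!: mult_right_mono)
  then show thesis using that[of "max C 1" N] by auto
qed

lemma rapid_lincomb:
  assumes "rapid \<Phi>" "rapid \<Psi>"
  shows "rapid (\<lambda>j x. a * \<Phi> j x + b * \<Psi> j x)"
  unfolding rapid_def
proof
  fix n
  obtain C where C: "\<And>j x. (1 + norm x) ^ n * norm (\<Phi> j x) \<le> C" using rapidD[OF assms(1)] by metis
  obtain D where D: "\<And>j x. (1 + norm x) ^ n * norm (\<Psi> j x) \<le> D" using rapidD[OF assms(2)] by metis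
  have "(1 + norm x) ^ n * norm (a * \<Phi> j x + b * \<Psi> j x) \<le> norm a * C + norm b * D" for j x
  proof -
    have "(1 + norm x) ^ n * norm (a * \<Phi> j x + b * \<Psi> j x)
       \<le> (1 + norm x) ^ n * (norm a * norm (\<Phi> j x) + norm b * norm (\<Psi> j x))"
      by (intro mult_left_mono order_trans[OF norm_triangle_ineq]) (auto simp: norm_mult)
    also have "\<dots> = norm a * ((1 + norm x) ^ n * norm (\<Phi> j x)) + norm b * ((1 + norm x) ^ n * norm (\<Psi> j x))"
      by (simp add: algebra_simps)
    also have "\<dots> \<le> norm a * C + norm b * D"
      by (intro add_mono mult_left_mono C D) auto
    finally show ?thesis .
  qed
  then show "\<exists>C. \<forall>j x. (1 + norm x) ^ n * norm (a * \<Phi> j x + b * \<Psi> j x) \<le> C" by blast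
qed

lemma rapid_mult_poly:
  assumes "poly_bounded \<Phi>" "rapid \<Psi>"
  shows "rapid (\<lambda>j x. \<Phi> j x * \<Psi> j x)"
  unfolding rapid_def
proof
  fix n
  obtain C N where C: "C > 0" "\<And>j x. norm (\<Phi> j x) \<le> C * (1 + norm x) ^ N"
    using poly_boundedD[OF assms(1)] by metis
  obtain D where D: "\<And>j x. (1 + norm x) ^ (n + N) * norm (\<Psi> j x) \<le> D" using rapidD[OF assms(2)] by metis
  have "(1 + norm x) ^ n * norm (\<Phi> j x * \<Psi> j x) \<le> C * D" for j x
  proof -
    have "(1 + norm x) ^ n * norm (\<Phi> j x * \<Psi> j x)
       \<le> (1 + norm x) ^ n * ((C * (1 + norm x) ^ N) * norm (\<Psi> j x))"
      unfolding norm_mult by (intro mult_left_mono mult_right_mono C) auto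
    also have "\<dots> = C * ((1 + norm x) ^ (n + N) * norm (\<Psi> j x))"
      by (simp add: power_add algebra_simps)
    also have "\<dots> \<le> C * D" using C(1) D by (intro mult_left_mono) auto
    finally show ?thesis .
  qed
  then show "\<exists>C. \<forall>j x. (1 + norm x) ^ n * norm (\<Phi> j x * \<Psi> j x) \<le> C" by blast
qed

lemma poly_bounded_lincomb:
  assumes "poly_bounded \<Phi>" "poly_bounded \<Psi>"
  shows "poly_bounded (\<lambda>j x. a * \<Phi> j x + b * \<Psi> j x)"
proof -
  obtain C N where C: "C > 0" "\<And>j x. norm (\<Phi> j x) \<le> C * (1 + norm x) ^ N"
    using poly_boundedD[OF assms(1)] by metis
  obtain D M where D: "D > 0" "\<And>j x. norm (\<Psi> j x) \<le> D * (1 + norm x) ^ M"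
    using poly_boundedD[OF assms(2)] by metis
  have "norm (a * \<Phi> j x + b * \<Psi> j x) \<le> (norm a * C + norm b * D) * (1 + norm x) ^ (N + M)" for j x
  proof -
    have "norm (a * \<Phi> j x + b * \<Psi> j x) \<le> norm a * norm (\<Phi> j x) + norm b * norm (\<Psi> j x)"
      by (rule order_trans[OF norm_triangle_ineq]) (simp add: norm_mult)
    also have "\<dots> \<le> norm a * (C * (1 + norm x) ^ N) + norm b * (D * (1 + norm x) ^ M)"
      by (intro add_mono mult_left_mono C D) auto
    also have "\<dots> \<le> norm a * (C * (1 + norm x) ^ (N+M)) + norm b * (D * (1 + norm x) ^ (N+M))"
      using C D by (intro add_mono mult_left_mono power_increasing) auto
    finally show ?thesis by (simp add: algebra_simps)
  qed
  then show ?thesis unfolding poly_bounded_def by blast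
qed

lemma smooth_family_poly_mult_rapid:
  "smooth_family poly_bounded \<Phi> \<Longrightarrow> smooth_family rapid \<Psi> \<Longrightarrow>
    smooth_family rapid (\<lambda>j x. \<Phi> j x * \<Psi> j x)"
  by (rule smooth_family_mult[of poly_bounded rapid rapid])
     (use rapid_mult_poly rapid_lincomb[where a=1 and b=1] in auto)

lemma smooth_family_rapid_lincomb:
  "smooth_family rapid \<Phi> \<Longrightarrow> smooth_family rapid \<Psi> \<Longrightarrow>
    smooth_family rapid (\<lambda>j x. a * \<Phi> j x + b * \<Psi> j x)"
  by (rule smooth_family_lincomb) (use rapid_lincomb in auto)

lemma smooth_family_reindex_rapid:
  assumes "smooth_family rapid (\<lambda>_::unit. \<phi>)"
  shows "smooth_family rapid (\<lambda>_::'j. \<phi>)"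
  using assms unfolding smooth_family_iter rapid_def by blast

text \<open>The sequence \<open>F\<close> lists the successive derivatives of a function on the line.\<close>

lemma smooth_family_compose:
  fixes r :: "'a::euclidean_space \<Rightarrow> real" and F :: "nat \<Rightarrow> real \<Rightarrow> complex"
  assumes F: "\<And>k s. (F k has_vector_derivative F (Suc k) s) (at s)"
    and r: "smooth_family poly_bounded (\<lambda>_::unit. \<lambda>x. complex_of_real (r x))"
    and r': "\<And>x. r differentiable (at x)"
    and B: "\<And>k. B (\<lambda>_::unit. \<lambda>x. F k (r x))"
    and Bm: "\<And>\<Phi> \<Psi>. poly_bounded \<Phi> \<Longrightarrow> B \<Psi> \<Longrightarrow> B (\<lambda>j x. \<Phi> j x * \<Psi> j x)"
    and Ba: "\<And>\<Phi> \<Psi>. B \<Phi> \<Longrightarrow> B \<Psi> \<Longrightarrow> B (\<lambda>j x. \<Phi> j x + \<Psi> j x)"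
  shows "smooth_family B (\<lambda>_::unit. \<lambda>x. F k (r x))"
proof -
  have comp: "((\<lambda>x. F k (r x)) has_derivative
      (\<lambda>h. frechet_derivative r (at x) h *\<^sub>R F (Suc k) (r x))) (at x)" for k x
    using diff_chain_at[OF r'[of x, unfolded frechet_derivative_works] F[of k "r x", unfolded has_vector_derivative_def]]
    by (simp add: o_def)
  have pr: "partial i (\<lambda>x. complex_of_real (r x)) x = complex_of_real (frechet_derivative r (at x) i)" for i x
    by (rule partial_eqI) (use r'[of x, unfolded frechet_derivative_works] in \<open>auto intro!: derivative_eq_intros\<close>)
  \<comment> \<open>Each derivative turns \<open>F k\<close> into \<open>F (Suc k)\<close> and
    splits off a polynomially bounded factor, hence the induction treats all \<open>k\<close> at
    once.\<close>
  have "smooth_upto B n (\<lambda>_::unit. \<lambda>x. F k (r x))" for n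
  proof (induction n arbitrary: k)
    case 0
    then show ?case using B comp unfolding smooth_upto_0 differentiable_def by blast
  next
    case (Suc n)
    have "smooth_upto B n (\<lambda>_::unit. partial i (\<lambda>x. F k (r x)))" if "i \<in> Basis" for i
    proof -
      have "(\<lambda>_::unit. partial i (\<lambda>x. F k (r x))) =
          (\<lambda>_ x. partial i (\<lambda>x. complex_of_real (r x)) x * F (Suc k) (r x))"
        unfolding pr by (simp add: fun_eq_iff partial_eqI[OF comp] scaleR_conv_of_real)
      moreover have "smooth_upto poly_bounded n (\<lambda>_::unit. partial i (\<lambda>x. complex_of_real (r x)))"
        using smooth_family_D(3)[OF r that] unfolding smooth_family_def by blast
      ultimately show ?thesis
        using smooth_upto_mult[of poly_bounded B B, OF Bm Ba] Suc.IH by fastforce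
    qed
    then show ?case using B comp unfolding smooth_upto_Suc differentiable_def by blast
  qed
  then show ?thesis unfolding smooth_family_def by blast
qed

section \<open>Schwartz functions\<close>

text \<open>On an open set differentiation only sees the zero function. This localises bumps and
  cut-offs together with all their derivatives.\<close>

lemma iter_deriv_eq_0:
  fixes \<phi> :: "'a::euclidean_space \<Rightarrow> complex"
  assumes "open U" "\<And>x. x \<in> U \<Longrightarrow> \<phi> x = 0"
  shows "x \<in> U \<Longrightarrow> iter_deriv vs \<phi> x = 0"
proof (induction vs arbitrary: x)
  case (Cons v vs)
  have "(iter_deriv vs \<phi> has_derivative (\<lambda>_. 0)) (at x)"
    by (rule has_derivative_transform_within_open[where f="\<lambda>_. 0" and s=U])
       (use assms Cons in auto)
  then show ?case unfolding iter_deriv_Cons_partial by (simp add: partial_eqI)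
qed (use assms in auto)

lemma smooth_iff: "smooth \<phi> \<longleftrightarrow> smooth_family (\<lambda>_. True) (\<lambda>_::unit. \<phi>)"
  unfolding smooth_def smooth_family_iter differentiable_on_def by auto

lemma smooth_family_imp_smooth: "smooth_family B \<Phi> \<Longrightarrow> smooth (\<Phi> j)"
  unfolding smooth_iff smooth_family_iter by blast

lemma iter_deriv_differentiable:
  "smooth \<phi> \<Longrightarrow> set vs \<subseteq> Basis \<Longrightarrow> iter_deriv vs \<phi> differentiable (at x)"
  unfolding smooth_def differentiable_on_def by auto

lemma smooth_imp_differentiable: "smooth \<phi> \<Longrightarrow> \<phi> differentiable (at x)"
  using iter_deriv_differentiable[of \<phi> "[]"] by simp

lemma smooth_imp_continuous_on: "smooth \<phi> \<Longrightarrow> continuous_on S \<phi>"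
  by (meson continuous_at_imp_continuous_on differentiable_imp_continuous_within smooth_imp_differentiable)

lemma iter_deriv_lincomb:
  assumes "smooth \<phi>" "smooth \<psi>" "set vs \<subseteq> Basis"
  shows "iter_deriv vs (\<lambda>x. a * \<phi> x + b * \<psi> x) x = a * iter_deriv vs \<phi> x + b * iter_deriv vs \<psi> x"
  using assms(3)
proof (induction vs arbitrary: x)
  case (Cons v vs)
  then have "iter_deriv vs (\<lambda>x. a * \<phi> x + b * \<psi> x) = (\<lambda>x. a * iter_deriv vs \<phi> x + b * iter_deriv vs \<psi> x)"
    by (auto simp: fun_eq_iff)
  then show ?case
    unfolding iter_deriv_Cons_partial
    using Cons.prems assms by (simp add: partial_lincomb iter_deriv_differentiable)
qed auto

lemma iter_deriv_affine:
  assumes "smooth \<phi>" "set vs \<subseteq> Basis"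
  shows "iter_deriv vs (\<lambda>x. \<phi> (s *\<^sub>R x + v)) x = s ^ length vs *\<^sub>R iter_deriv vs \<phi> (s *\<^sub>R x + v)"
    and "iter_deriv vs (\<lambda>x. \<phi> (s *\<^sub>R x + v)) differentiable (at x)"
proof -
  have *: "((\<lambda>x. c *\<^sub>R iter_deriv vs \<phi> (s *\<^sub>R x + v)) has_derivative
      (\<lambda>h. c *\<^sub>R s *\<^sub>R frechet_derivative (iter_deriv vs \<phi>) (at (s *\<^sub>R x + v)) h)) (at x)"
    if "set vs \<subseteq> Basis" for vs c x
  proof -
    have D: "(iter_deriv vs \<phi> has_derivative frechet_derivative (iter_deriv vs \<phi>) (at (s *\<^sub>R x + v)))
        (at (s *\<^sub>R x + v))"
      using iter_deriv_differentiable[OF assms(1) that] frechet_derivative_works by blast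
    have A: "((\<lambda>x. s *\<^sub>R x + v) has_derivative (\<lambda>h. s *\<^sub>R h)) (at x)"
      by (auto intro!: derivative_eq_intros)
    have "((\<lambda>x. iter_deriv vs \<phi> (s *\<^sub>R x + v)) has_derivative
      (\<lambda>h. frechet_derivative (iter_deriv vs \<phi>) (at (s *\<^sub>R x + v)) (s *\<^sub>R h))) (at x)"
      using diff_chain_at[OF A D] by (simp add: o_def)
    then show ?thesis
      by (intro has_derivative_scaleR_right)
         (simp add: linear_scale[OF has_derivative_linear[OF D]])
  qed
  have eq: "iter_deriv vs (\<lambda>x. \<phi> (s *\<^sub>R x + v)) = (\<lambda>x. s ^ length vs *\<^sub>R iter_deriv vs \<phi> (s *\<^sub>R x + v))"
    using assms(2)
  proof (induction vs)
    case (Cons w vs)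
    then have "iter_deriv vs (\<lambda>x. \<phi> (s *\<^sub>R x + v)) = (\<lambda>x. s ^ length vs *\<^sub>R iter_deriv vs \<phi> (s *\<^sub>R x + v))"
      by simp
    moreover have "partial w (\<lambda>x. s ^ length vs *\<^sub>R iter_deriv vs \<phi> (s *\<^sub>R x + v)) =
        (\<lambda>x. s ^ length (w # vs) *\<^sub>R partial w (iter_deriv vs \<phi>) (s *\<^sub>R x + v))"
      using Cons.prems by (intro ext, subst partial_eqI[OF *]) (auto simp: partial_def)
    ultimately show ?case by (simp only: iter_deriv_Cons_partial)
  qed simp
  then show "iter_deriv vs (\<lambda>x. \<phi> (s *\<^sub>R x + v)) x = s ^ length vs *\<^sub>R iter_deriv vs \<phi> (s *\<^sub>R x + v)"
    by simp
  show "iter_deriv vs (\<lambda>x. \<phi> (s *\<^sub>R x + v)) differentiable (at x)"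
    unfolding eq differentiable_def using *[OF assms(2)] by blast
qed

text \<open>The total derivative is a sum of \<open>DIM('a)\<close> coordinate terms, each of size
  at most \<open>K * norm h\<close>; this is the origin of the dimension factor.\<close>

lemma mean_value_bound:
  fixes \<phi> :: "'a::euclidean_space \<Rightarrow> complex"
  assumes "convex S" "\<And>x. x \<in> S \<Longrightarrow> \<phi> differentiable (at x)"
    and K: "\<And>x i. x \<in> S \<Longrightarrow> i \<in> Basis \<Longrightarrow> norm (partial i \<phi> x) \<le> K"
    and "x \<in> S" "y \<in> S"
  shows "norm (\<phi> x - \<phi> y) \<le> real DIM('a) * K * norm (x - y)"
proof (rule differentiable_bound[where S=S and f'="\<lambda>x h. \<Sum>i\<in>Basis. (h \<bullet> i) *\<^sub>R partial i \<phi> x"])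
  fix x assume x: "x \<in> S"
  show "(\<phi> has_derivative (\<lambda>h. \<Sum>i\<in>Basis. (h \<bullet> i) *\<^sub>R partial i \<phi> x)) (at x within S)"
    using has_derivative_partial[OF assms(2)[OF x]] has_derivative_at_withinI by blast
  show "onorm (\<lambda>h. \<Sum>i\<in>Basis. (h \<bullet> i) *\<^sub>R partial i \<phi> x) \<le> real DIM('a) * K"
  proof (rule onorm_le)
    fix h :: 'a
    have "norm (\<Sum>i\<in>Basis. (h \<bullet> i) *\<^sub>R partial i \<phi> x) \<le> (\<Sum>i\<in>(Basis::'a set). norm h * K)"
      by (rule sum_norm_le) (auto intro!: mult_mono Basis_le_norm K x)
    then show "norm (\<Sum>i\<in>Basis. (h \<bullet> i) *\<^sub>R partial i \<phi> x) \<le> real DIM('a) * K * norm h"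
      by (simp only: sum_constant mult.assoc) (simp add: mult.commute[of K])
  qed
qed (use assms in auto)

text \<open>Translates between the weight in \<open>schwartz_weight\<close> and
  \<open>(1 + t) ^ n\<close>, whose exact power laws suit products of estimates.\<close>

lemma weight_bounds:
  fixes t :: real assumes "t \<ge> 0"
  shows "max 1 (t ^ n) \<le> (1 + t) ^ n" "(1 + t) ^ n \<le> 2 ^ n * max 1 (t ^ n)"
proof -
  show "max 1 (t ^ n) \<le> (1 + t) ^ n" using assms by (auto intro!: power_mono)
  show "(1 + t) ^ n \<le> 2 ^ n * max 1 (t ^ n)"
  proof (cases "t \<le> 1")
    case True
    have "(1 + t) ^ n \<le> 2 ^ n" using assms True by (intro power_mono) auto
    also have "\<dots> \<le> 2 ^ n * max 1 (t ^ n)" by simp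
    finally show ?thesis .
  next
    case False
    have "(1 + t) ^ n \<le> (2 * t) ^ n" using assms False by (intro power_mono) auto
    also have "\<dots> \<le> 2 ^ n * max 1 (t ^ n)" by (auto simp: power_mult_distrib)
    finally show ?thesis .
  qed
qed

lemma schwartz_weight_le_iff:
  fixes \<phi> :: "'a::euclidean_space \<Rightarrow> complex"
  shows "schwartz_weight n m \<phi> x \<le> K \<longleftrightarrow>
    (\<forall>vs. set vs \<subseteq> Basis \<longrightarrow> length vs \<le> m \<longrightarrow> max 1 (norm x ^ n) * norm (iter_deriv vs \<phi> x) \<le> K)"
proof -
  have fin: "finite {vs. set vs \<subseteq> (Basis::'a set) \<and> length vs \<le> m}"
    by (rule finite_lists_length_le) simp
  have ne: "{vs. set vs \<subseteq> (Basis::'a set) \<and> length vs \<le> m} \<noteq> {}"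
    by (auto intro: exI[of _ "[]"])
  have pos: "max 1 (norm x ^ n) > 0" by (simp add: less_max_iff_disj)
  have "schwartz_weight n m \<phi> x \<le> K \<longleftrightarrow>
    Max ((\<lambda>vs. norm (iter_deriv vs \<phi> x)) ` {vs. set vs \<subseteq> Basis \<and> length vs \<le> m}) \<le> K / max 1 (norm x ^ n)"
    unfolding schwartz_weight_def using pos by (simp add: pos_le_divide_eq mult.commute)
  also have "\<dots> \<longleftrightarrow> (\<forall>vs. set vs \<subseteq> Basis \<longrightarrow> length vs \<le> m \<longrightarrow> norm (iter_deriv vs \<phi> x) \<le> K / max 1 (norm x ^ n))"
    using fin ne by (subst Max_le_iff) auto
  also have "\<dots> \<longleftrightarrow> (\<forall>vs. set vs \<subseteq> Basis \<longrightarrow> length vs \<le> m \<longrightarrow> max 1 (norm x ^ n) * norm (iter_deriv vs \<phi> x) \<le> K)"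
    using pos by (simp add: pos_le_divide_eq mult.commute)
  finally show ?thesis .
qed

lemma rapid_schwartz_weight:
  fixes \<Phi> :: "'j \<Rightarrow> 'a::euclidean_space \<Rightarrow> complex"
  assumes "smooth_family rapid \<Phi>"
  obtains C where "\<And>j x. schwartz_weight n m (\<Phi> j) x \<le> C"
proof -
  let ?L = "{vs. set vs \<subseteq> (Basis::'a set) \<and> length vs \<le> m}"
  have "\<exists>C. \<forall>j x. (1 + norm x) ^ n * norm (iter_deriv vs (\<Phi> j) x) \<le> C" if "vs \<in> ?L" for vs
    using assms that unfolding smooth_family_iter rapid_def by blast
  then obtain C where C: "\<And>vs j x. vs \<in> ?L \<Longrightarrow> (1 + norm x) ^ n * norm (iter_deriv vs (\<Phi> j) x) \<le> C vs"
    by (metis (no_types, lifting))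
  have fin: "finite ?L" by (rule finite_lists_length_le) simp
  show thesis
  proof (rule that)
    fix j x
    \<comment> \<open>Only finitely many lists occur, and the sum of absolute values dominates each
      individual constant.\<close>
    show "schwartz_weight n m (\<Phi> j) x \<le> (\<Sum>vs\<in>?L. \<bar>C vs\<bar>)"
      unfolding schwartz_weight_le_iff
    proof (intro allI impI)
      fix vs :: "'a list" assume vs: "set vs \<subseteq> Basis" "length vs \<le> m"
      have "max 1 (norm x ^ n) * norm (iter_deriv vs (\<Phi> j) x) \<le> (1 + norm x) ^ n * norm (iter_deriv vs (\<Phi> j) x)"
        by (intro mult_right_mono weight_bounds) auto
      also have "\<dots> \<le> \<bar>C vs\<bar>" using C[of vs x j] vs by simp
      also have "\<dots> \<le> (\<Sum>vs\<in>?L. \<bar>C vs\<bar>)" using vs fin by (intro member_le_sum) auto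
      finally show "max 1 (norm x ^ n) * norm (iter_deriv vs (\<Phi> j) x) \<le> (\<Sum>vs\<in>?L. \<bar>C vs\<bar>)" .
    qed
  qed
qed

lemma schwartz_iff: "\<phi> \<in> schwartz_space \<longleftrightarrow> smooth_family rapid (\<lambda>_::unit. \<phi>)"
proof
  assume "\<phi> \<in> schwartz_space"
  then have s: "smooth \<phi>" and b: "\<And>n m. bdd_above (range (schwartz_weight n m \<phi>))"
    unfolding schwartz_space_def by auto
  have "rapid (\<lambda>_::unit. iter_deriv vs \<phi>)" if vs: "set vs \<subseteq> Basis" for vs
    unfolding rapid_def
  proof
    fix n
    obtain C where C: "\<And>x. schwartz_weight n (length vs) \<phi> x \<le> C"
      using b[of n "length vs"] unfolding bdd_above_def by auto
    have "(1 + norm x) ^ n * norm (iter_deriv vs \<phi> x) \<le> 2 ^ n * C" for x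
    proof -
      have "(1 + norm x) ^ n * norm (iter_deriv vs \<phi> x) \<le> 2 ^ n * max 1 (norm x ^ n) * norm (iter_deriv vs \<phi> x)"
        by (intro mult_right_mono weight_bounds) auto
      also have "\<dots> \<le> 2 ^ n * C" using C[of x] vs unfolding schwartz_weight_le_iff by simp
      finally show ?thesis .
    qed
    then show "\<exists>C. \<forall>(j::unit) x. (1 + norm x) ^ n * norm (iter_deriv vs \<phi> x) \<le> C" by blast
  qed
  then show "smooth_family rapid (\<lambda>_::unit. \<phi>)"
    using s unfolding smooth_family_iter smooth_def differentiable_on_def by auto
next
  assume L: "smooth_family rapid (\<lambda>_::unit. \<phi>)"
  have "bdd_above (range (schwartz_weight n m \<phi>))" for n m
  proof -
    obtain C where "\<And>x. schwartz_weight n m \<phi> x \<le> C"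
      by (rule rapid_schwartz_weight[OF L, of n m]) (metis (no_types))
    then show ?thesis by (intro bdd_aboveI[of _ C]) auto
  qed
  then show "\<phi> \<in> schwartz_space"
    using smooth_family_imp_smooth[OF L] unfolding schwartz_space_def by auto
qed

lemma smooth_family_rapid_imp_schwartz: "smooth_family rapid \<Phi> \<Longrightarrow> \<Phi> j \<in> schwartz_space"
  unfolding schwartz_iff smooth_family_iter rapid_def by blast

lemma schwartz_smooth_family: "\<phi> \<in> schwartz_space \<Longrightarrow> smooth_family rapid (\<lambda>_. \<phi>)"
  unfolding schwartz_iff by (rule smooth_family_reindex_rapid)

lemma schwartz_smooth: "\<phi> \<in> schwartz_space \<Longrightarrow> smooth \<phi>"
  unfolding schwartz_space_def by auto

lemma schwartz_differentiable: "\<phi> \<in> schwartz_space \<Longrightarrow> \<phi> differentiable (at x)"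
  using schwartz_smooth smooth_imp_differentiable by blast

lemma schwartz_decay:
  assumes "\<phi> \<in> schwartz_space"
  obtains C where "C > 0" "\<And>x. (1 + norm x) ^ n * norm (\<phi> x) \<le> C"
  using rapidD[OF smooth_family_D(2)[OF assms[unfolded schwartz_iff]]] by metis

lemma schwartz_partial: "\<phi> \<in> schwartz_space \<Longrightarrow> i \<in> Basis \<Longrightarrow> partial i \<phi> \<in> schwartz_space"
  unfolding schwartz_iff using smooth_family_D(3) by fastforce

lemma schwartz_lincomb:
  "\<phi> \<in> schwartz_space \<Longrightarrow> \<psi> \<in> schwartz_space \<Longrightarrow> (\<lambda>x. a * \<phi> x + b * \<psi> x) \<in> schwartz_space"
  unfolding schwartz_iff by (rule smooth_family_rapid_lincomb)

lemma schwartz_cmult: "\<phi> \<in> schwartz_space \<Longrightarrow> (\<lambda>x. a * \<phi> x) \<in> schwartz_space"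
  using schwartz_lincomb[of \<phi> \<phi> a 0] by simp

lemma schwartz_poly_mult:
  assumes "smooth_family poly_bounded (\<lambda>_::unit. p)" "\<phi> \<in> schwartz_space"
  shows "(\<lambda>x. p x * \<phi> x) \<in> schwartz_space"
  using smooth_family_poly_mult_rapid[OF assms(1) assms(2)[unfolded schwartz_iff]]
  unfolding schwartz_iff by simp

lemma schwartz_affine:
  fixes \<phi> :: "'a::euclidean_space \<Rightarrow> complex"
  assumes "\<phi> \<in> schwartz_space" "s \<noteq> 0"
  shows "(\<lambda>x. \<phi> (s *\<^sub>R x + v)) \<in> schwartz_space"
  unfolding schwartz_iff smooth_family_iter
proof (intro allI impI conjI)
  fix vs :: "'a list" and x assume vs: "set vs \<subseteq> Basis"
  show "iter_deriv vs (\<lambda>x. \<phi> (s *\<^sub>R x + v)) differentiable (at x)"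
    using iter_deriv_affine(2) schwartz_smooth[OF assms(1)] vs by blast
  show "rapid (\<lambda>_::unit. iter_deriv vs (\<lambda>x. \<phi> (s *\<^sub>R x + v)))"
    unfolding rapid_def
  proof
    fix n
    have r: "rapid (\<lambda>_::unit. iter_deriv vs \<phi>)"
      using assms(1) vs unfolding schwartz_iff smooth_family_iter by blast
    obtain C where C: "C > 0" "\<And>x. (1 + norm x) ^ n * norm (iter_deriv vs \<phi> x) \<le> C"
      using rapidD[OF r, of n] by (metis (no_types))
    \<comment> \<open>Solving \<open>s *\<^sub>R x + v\<close> for \<open>x\<close> costs
      \<open>1 / \<bar>s\<bar>\<close> and the shift costs \<open>1 + norm v\<close>; the 1 in the
      second factor accounts for the constant term of the weight.\<close>
    define K where "K = (1 + norm v) * (1 + 1 / \<bar>s\<bar>)"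
    have K: "1 + norm x \<le> K * (1 + norm (s *\<^sub>R x + v))" for x
    proof -
      have "norm (s *\<^sub>R x) \<le> norm (s *\<^sub>R x + v) + norm v"
        by (metis add_diff_cancel_right' norm_triangle_ineq4)
      then have "norm x \<le> (norm (s *\<^sub>R x + v) + norm v) / \<bar>s\<bar>"
        using assms(2) by (simp add: field_simps)
      also have "\<dots> \<le> (1 + norm v) * (1 + norm (s *\<^sub>R x + v)) / \<bar>s\<bar>"
        by (intro divide_right_mono) (auto simp: algebra_simps)
      moreover have "1 \<le> (1 + norm v) * (1 + norm (s *\<^sub>R x + v))"
        by (simp add: algebra_simps add_increasing)
      moreover have "K * (1 + norm (s *\<^sub>R x + v)) = (1 + norm v) * (1 + norm (s *\<^sub>R x + v)) +
          (1 + norm v) * (1 + norm (s *\<^sub>R x + v)) / \<bar>s\<bar>"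
        unfolding K_def by (simp add: field_simps)
      ultimately show ?thesis by linarith
    qed
    have K0: "K \<ge> 0" unfolding K_def by auto
    have "(1 + norm x) ^ n * norm (iter_deriv vs (\<lambda>x. \<phi> (s *\<^sub>R x + v)) x) \<le> K ^ n * \<bar>s\<bar> ^ length vs * C" for x
    proof -
      have "(1 + norm x) ^ n * norm (iter_deriv vs (\<lambda>x. \<phi> (s *\<^sub>R x + v)) x) \<le>
        (K * (1 + norm (s *\<^sub>R x + v))) ^ n * (\<bar>s\<bar> ^ length vs * norm (iter_deriv vs \<phi> (s *\<^sub>R x + v)))"
        unfolding iter_deriv_affine(1)[OF schwartz_smooth[OF assms(1)] vs] norm_scaleR power_abs
        by (intro mult_right_mono power_mono K) auto
      also have "\<dots> = K ^ n * \<bar>s\<bar> ^ length vs * ((1 + norm (s *\<^sub>R x + v)) ^ n * norm (iter_deriv vs \<phi> (s *\<^sub>R x + v)))"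
        by (simp add: power_mult_distrib)
      also have "\<dots> \<le> K ^ n * \<bar>s\<bar> ^ length vs * C"
        using K0 by (intro mult_left_mono C) auto
      finally show ?thesis .
    qed
    then show "\<exists>C. \<forall>(j::unit) x. (1 + norm x) ^ n * norm (iter_deriv vs (\<lambda>x. \<phi> (s *\<^sub>R x + v)) x) \<le> C" by blast
  qed
qed

lemma smooth_compact_support_schwartz:
  fixes \<phi> :: "'a::euclidean_space \<Rightarrow> complex"
  assumes s: "smooth \<phi>" and K: "\<And>x. norm x \<ge> R \<Longrightarrow> \<phi> x = 0"
  shows "\<phi> \<in> schwartz_space"
  unfolding schwartz_iff smooth_family_iter
proof (intro allI impI conjI)
  fix vs :: "'a list" and x assume vs: "set vs \<subseteq> Basis"
  show "iter_deriv vs \<phi> differentiable (at x)" using s vs iter_deriv_differentiable by blast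
  show "rapid (\<lambda>_::unit. iter_deriv vs \<phi>)"
    unfolding rapid_def
  proof
    fix n
    have z: "iter_deriv vs \<phi> x = 0" if "x \<notin> cball 0 R" for x
      using iter_deriv_eq_0[of "- cball 0 R" \<phi> x vs] K that by (auto simp: open_Compl)
    have "continuous_on (cball 0 R) (\<lambda>x. (1 + norm x) ^ n * norm (iter_deriv vs \<phi> x))"
      by (intro continuous_intros continuous_at_imp_continuous_on ballI
          differentiable_imp_continuous_within iter_deriv_differentiable s vs)
    then have "compact ((\<lambda>x. (1 + norm x) ^ n * norm (iter_deriv vs \<phi> x)) ` cball 0 R)"
      by (rule compact_continuous_image) simp
    then obtain C where C: "\<And>x. x \<in> cball 0 R \<Longrightarrow> norm ((1 + norm x) ^ n * norm (iter_deriv vs \<phi> x)) \<le> C"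
      using compact_imp_bounded bounded_iff by (metis (no_types, lifting) image_eqI)
    \<comment> \<open>Outside the ball the derivative vanishes, hence the maximum with 0; for
      negative \<open>R\<close> the ball is empty and \<open>C\<close> is arbitrary.\<close>
    have "(1 + norm x) ^ n * norm (iter_deriv vs \<phi> x) \<le> max C 0" for x
      using C[of x] z[of x] by (cases "x \<in> cball 0 R") auto
    then show "\<exists>C. \<forall>(j::unit) x. (1 + norm x) ^ n * norm (iter_deriv vs \<phi> x) \<le> C" by blast
  qed
qed

section \<open>Seminorms of the Schwartz space\<close>

lemma schwartz_weight_le_norm:
  assumes "\<phi> \<in> schwartz_space"
  shows "schwartz_weight n m \<phi> x \<le> schwartz_norm n m \<phi>"
  unfolding schwartz_norm_def using assms by (auto intro: cSUP_upper simp: schwartz_space_def)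

lemma schwartz_norm_ge:
  assumes "\<phi> \<in> schwartz_space" "set vs \<subseteq> Basis" "length vs \<le> m"
  shows "max 1 (norm x ^ n) * norm (iter_deriv vs \<phi> x) \<le> schwartz_norm n m \<phi>"
  using schwartz_weight_le_norm[OF assms(1), of n m x] assms(2,3) unfolding schwartz_weight_le_iff by blast

lemma schwartz_norm_least:
  assumes "\<And>x vs. set vs \<subseteq> Basis \<Longrightarrow> length vs \<le> m \<Longrightarrow> max 1 (norm x ^ n) * norm (iter_deriv vs \<phi> x) \<le> K"
  shows "schwartz_norm n m \<phi> \<le> K"
  unfolding schwartz_norm_def by (rule cSUP_least) (auto simp: schwartz_weight_le_iff assms)

lemma schwartz_norm_nonneg:
  assumes "\<phi> \<in> schwartz_space"
  shows "schwartz_norm n m \<phi> \<ge> 0"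
  using schwartz_norm_ge[OF assms, of "[]" m 0 n] by (auto intro: order_trans[rotated])

lemma schwartz_norm_mono:
  fixes \<phi> :: "'a::euclidean_space \<Rightarrow> complex"
  assumes "\<phi> \<in> schwartz_space" "n \<le> n'" "m \<le> m'"
  shows "schwartz_norm n m \<phi> \<le> schwartz_norm n' m' \<phi>"
proof (rule schwartz_norm_least)
  fix x :: 'a and vs :: "'a list" assume vs: "set vs \<subseteq> Basis" "length vs \<le> m"
  have "max 1 (norm x ^ n) \<le> max 1 (norm x ^ n')"
  proof (cases "norm x \<le> 1")
    case True
    then have "norm x ^ n \<le> 1" by (simp add: power_le_one)
    then show ?thesis by simp
  next
    case False
    then show ?thesis using assms(2) by (auto intro!: max.mono power_increasing)
  qed
  then have "max 1 (norm x ^ n) * norm (iter_deriv vs \<phi> x) \<le> max 1 (norm x ^ n') * norm (iter_deriv vs \<phi> x)"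
    by (rule mult_right_mono) simp
  also have "\<dots> \<le> schwartz_norm n' m' \<phi>" using vs assms by (intro schwartz_norm_ge) auto
  finally show "max 1 (norm x ^ n) * norm (iter_deriv vs \<phi> x) \<le> schwartz_norm n' m' \<phi>" .
qed

lemma schwartz_norm_lincomb:
  fixes \<phi> \<psi> :: "'a::euclidean_space \<Rightarrow> complex"
  assumes "\<phi> \<in> schwartz_space" "\<psi> \<in> schwartz_space"
  shows "schwartz_norm n m (\<lambda>x. a * \<phi> x + b * \<psi> x) \<le>
    norm a * schwartz_norm n m \<phi> + norm b * schwartz_norm n m \<psi>"
proof (rule schwartz_norm_least)
  fix x :: 'a and vs :: "'a list" assume vs: "set vs \<subseteq> Basis" "length vs \<le> m"
  let ?w = "max 1 (norm x ^ n)"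
  have "?w * norm (iter_deriv vs (\<lambda>x. a * \<phi> x + b * \<psi> x) x) =
      ?w * norm (a * iter_deriv vs \<phi> x + b * iter_deriv vs \<psi> x)"
    using iter_deriv_lincomb[OF schwartz_smooth[OF assms(1)] schwartz_smooth[OF assms(2)] vs(1)] by simp
  also have "\<dots> \<le> ?w * (norm a * norm (iter_deriv vs \<phi> x) + norm b * norm (iter_deriv vs \<psi> x))"
    by (intro mult_left_mono order_trans[OF norm_triangle_ineq]) (auto simp: norm_mult)
  also have "\<dots> = norm a * (?w * norm (iter_deriv vs \<phi> x)) + norm b * (?w * norm (iter_deriv vs \<psi> x))"
    by (simp only: distrib_left mult.left_commute)
  also have "\<dots> \<le> norm a * schwartz_norm n m \<phi> + norm b * schwartz_norm n m \<psi>"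
    using assms vs by (intro add_mono mult_left_mono schwartz_norm_ge) auto
  finally show "?w * norm (iter_deriv vs (\<lambda>x. a * \<phi> x + b * \<psi> x) x) \<le>
    norm a * schwartz_norm n m \<phi> + norm b * schwartz_norm n m \<psi>" .
qed

lemma schwartz_norm_cmult:
  assumes "\<phi> \<in> schwartz_space"
  shows "schwartz_norm n m (\<lambda>x. a * \<phi> x) \<le> norm a * schwartz_norm n m \<phi>"
  using schwartz_norm_lincomb[OF assms assms, of n m a 0] by simp

lemma zero_schwartz [simp]: "(\<lambda>_. 0) \<in> schwartz_space"
  unfolding schwartz_iff
  by (rule smooth_family_coinduct[where P="\<lambda>\<Phi>. \<Phi> = (\<lambda>_ _. 0)"])
     (simp_all add: rapid_def partial_eqI[OF has_derivative_const] exI[of _ 0], auto simp: fun_eq_iff partial_eqI[OF has_derivative_const])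

lemma rapid_schwartz_norm:
  assumes "smooth_family rapid \<Phi>"
  obtains C where "\<And>j. schwartz_norm n m (\<Phi> j) \<le> C"
proof -
  obtain C where "\<And>j x. schwartz_weight n m (\<Phi> j) x \<le> C"
    using rapid_schwartz_weight[OF assms, of n m] by metis
  then have "schwartz_norm n m (\<Phi> j) \<le> C" for j
    unfolding schwartz_norm_def by (intro cSUP_least) auto
  then show thesis using that by blast
qed

section \<open>Temperate distributions\<close>

lemma openin_schwartz_topology_subset: "openin schwartz_topology U \<Longrightarrow> U \<subseteq> schwartz_space"
proof -
  assume "openin schwartz_topology U"
  then have "U \<subseteq> topspace schwartz_topology" by (rule openin_subset)
  also have "\<dots> \<subseteq> schwartz_space" unfolding schwartz_topology_def topology_generated_by_topspace by blast
  finally show ?thesis .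
qed

lemma topspace_schwartz_topology: "topspace (schwartz_topology :: ('a::euclidean_space \<Rightarrow> complex) topology) = schwartz_space"
proof
  show "topspace schwartz_topology \<subseteq> (schwartz_space :: ('a \<Rightarrow> complex) set)"
    using openin_schwartz_topology_subset by blast
  show "(schwartz_space :: ('a \<Rightarrow> complex) set) \<subseteq> topspace schwartz_topology"
  proof
    fix \<phi> :: "'a \<Rightarrow> complex" assume S: "\<phi> \<in> schwartz_space"
    have "schwartz_norm 0 0 (\<lambda>x. \<phi> x - \<phi> x) \<le> 0"
      using schwartz_norm_cmult[OF zero_schwartz, of 0 0 0] by simp
    then have "\<phi> \<in> {\<psi> \<in> schwartz_space. schwartz_norm 0 0 (\<lambda>x. \<psi> x - \<phi> x) < 1}" using S by auto
    then show "\<phi> \<in> topspace schwartz_topology"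
      unfolding schwartz_topology_def topology_generated_by_topspace using S zero_less_one by blast
  qed
qed

text \<open>The generating sets form only a subbasis. A finite intersection is still controlled by
  one seminorm, because \<open>schwartz_norm\<close> is monotone in both orders, and a generating
  set centred elsewhere contains a smaller ball around \<open>\<phi>\<close> by the triangle
  inequality.\<close>

lemma schwartz_topology_nbhd:
  fixes U :: "('a::euclidean_space \<Rightarrow> complex) set"
  assumes "openin schwartz_topology U" "\<phi> \<in> U"
  shows "\<exists>n m. \<exists>\<epsilon>>0. \<forall>\<psi>\<in>schwartz_space. schwartz_norm n m (\<lambda>x. \<psi> x - \<phi> x) < \<epsilon> \<longrightarrow> \<psi> \<in> U"
proof -
  have S: "\<phi> \<in> schwartz_space" using assms openin_schwartz_topology_subset by blast
  have "generate_topology_on {{\<psi> \<in> schwartz_space. schwartz_norm n m (\<lambda>x. \<psi> x - \<phi> x) < \<epsilon>} | \<phi> n m \<epsilon>.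
      \<phi> \<in> schwartz_space \<and> \<epsilon> > 0} U"
    using assms(1) unfolding schwartz_topology_def by (rule openin_topology_generated_by)
  then show ?thesis using assms(2)
  proof (induction rule: generate_topology_on.induct)
    case (Int a b)
    obtain n m \<epsilon> where 1: "\<epsilon> > 0" "\<And>\<psi>. \<psi> \<in> schwartz_space \<Longrightarrow> schwartz_norm n m (\<lambda>x. \<psi> x - \<phi> x) < \<epsilon> \<Longrightarrow> \<psi> \<in> a"
      using Int by blast
    obtain n' m' \<epsilon>' where 2: "\<epsilon>' > 0" "\<And>\<psi>. \<psi> \<in> schwartz_space \<Longrightarrow> schwartz_norm n' m' (\<lambda>x. \<psi> x - \<phi> x) < \<epsilon>' \<Longrightarrow> \<psi> \<in> b"
      using Int by blast
    have "\<psi> \<in> a \<inter> b" if "\<psi> \<in> schwartz_space"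
      "schwartz_norm (max n n') (max m m') (\<lambda>x. \<psi> x - \<phi> x) < min \<epsilon> \<epsilon>'" for \<psi>
    proof -
      have d: "(\<lambda>x. \<psi> x - \<phi> x) \<in> schwartz_space"
        using schwartz_lincomb[OF that(1) S, of 1 "-1"] by simp
      show ?thesis
        using schwartz_norm_mono[OF d, of n "max n n'" m "max m m'"]
          schwartz_norm_mono[OF d, of n' "max n n'" m' "max m m'"] that 1 2 by auto
    qed
    moreover have "min \<epsilon> \<epsilon>' > 0" using 1(1) 2(1) by simp
    ultimately show ?case by blast
  next
    case (UN K)
    then obtain k where k: "k \<in> K" "\<phi> \<in> k" by blast
    then obtain n m \<epsilon> where "\<epsilon> > 0" "\<forall>\<psi>\<in>schwartz_space. schwartz_norm n m (\<lambda>x. \<psi> x - \<phi> x) < \<epsilon> \<longrightarrow> \<psi> \<in> k"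
      using UN.IH by blast
    then show ?case using k(1) by (intro exI[of _ n] exI[of _ m] exI[of _ \<epsilon>]) auto
  next
    case (Basis s)
    then obtain \<phi>' n m \<epsilon> where s: "s = {\<psi> \<in> schwartz_space. schwartz_norm n m (\<lambda>x. \<psi> x - \<phi>' x) < \<epsilon>}"
      and S': "\<phi>' \<in> schwartz_space" by blast
    have "\<psi> \<in> s" if "\<psi> \<in> schwartz_space"
      "schwartz_norm n m (\<lambda>x. \<psi> x - \<phi> x) < \<epsilon> - schwartz_norm n m (\<lambda>x. \<phi> x - \<phi>' x)" for \<psi>
    proof -
      have "schwartz_norm n m (\<lambda>x. 1 * (\<psi> x - \<phi> x) + 1 * (\<phi> x - \<phi>' x)) \<le>
        schwartz_norm n m (\<lambda>x. \<psi> x - \<phi> x) + schwartz_norm n m (\<lambda>x. \<phi> x - \<phi>' x)"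
        using schwartz_norm_lincomb[OF schwartz_lincomb[OF that(1) S, of 1 "-1"] schwartz_lincomb[OF S S', of 1 "-1"], of n m 1 1]
        by simp
      then show ?thesis using that unfolding s by simp
    qed
    moreover have "\<epsilon> - schwartz_norm n m (\<lambda>x. \<phi> x - \<phi>' x) > 0" using Basis s by simp
    ultimately show ?case by blast
  qed simp
qed

lemma temperate_distribution_lincomb:
  "temperate_distribution f \<Longrightarrow> \<phi> \<in> schwartz_space \<Longrightarrow> \<psi> \<in> schwartz_space \<Longrightarrow>
    f (\<lambda>x. a * \<phi> x + b * \<psi> x) = a * f \<phi> + b * f \<psi>"
  unfolding temperate_distribution_def by blast

lemma temperate_distribution_cmult:
  "temperate_distribution f \<Longrightarrow> \<phi> \<in> schwartz_space \<Longrightarrow> f (\<lambda>x. a * \<phi> x) = a * f \<phi>"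
  using temperate_distribution_lincomb[of f \<phi> \<phi> a 0] by simp

lemma temperate_distribution_sum:
  assumes f: "temperate_distribution f" and "finite F" "\<And>a. a \<in> F \<Longrightarrow> \<phi> a \<in> schwartz_space"
  shows "(\<lambda>x. \<Sum>a\<in>F. c a * \<phi> a x) \<in> schwartz_space \<and>
    f (\<lambda>x. \<Sum>a\<in>F. c a * \<phi> a x) = (\<Sum>a\<in>F. c a * f (\<phi> a))"
  using assms(2,3)
proof (induction F rule: finite_induct)
  case empty
  then show ?case using temperate_distribution_cmult[OF f zero_schwartz, of 0] by simp
next
  case (insert a F)
  then show ?case
    using schwartz_lincomb[of "\<phi> a" "\<lambda>x. \<Sum>a\<in>F. c a * \<phi> a x" "c a" 1]
      temperate_distribution_lincomb[OF f, of "\<phi> a" "\<lambda>x. \<Sum>a\<in>F. c a * \<phi> a x" "c a" 1] by simp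
qed

text \<open>Continuity at 0 bounds \<open>f\<close> by 1 on a seminorm ball, and rescaling does the
  rest. The summand 1 keeps the scaling factor \<open>s\<close> meaningful when the seminorm
  vanishes.\<close>

lemma temperate_distribution_bound:
  fixes f :: "('a::euclidean_space \<Rightarrow> complex) \<Rightarrow> complex"
  assumes "temperate_distribution f"
  obtains n m C where "C > 0" "\<And>\<phi>. \<phi> \<in> schwartz_space \<Longrightarrow> norm (f \<phi>) \<le> C * (1 + schwartz_norm n m \<phi>)"
proof -
  have f0: "f (\<lambda>_. 0) = 0" using temperate_distribution_cmult[OF assms zero_schwartz, of 0] by simp
  have "openin schwartz_topology {\<phi> \<in> topspace schwartz_topology. f \<phi> \<in> ball 0 1}"
    using assms openin_continuous_map_preimage[of schwartz_topology euclidean f "ball 0 1"]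
    unfolding temperate_distribution_def by simp
  then obtain n m \<epsilon> where e: "\<epsilon> > 0"
    "\<And>\<psi>. \<psi> \<in> schwartz_space \<Longrightarrow> schwartz_norm n m \<psi> < \<epsilon> \<Longrightarrow> norm (f \<psi>) < 1"
    using schwartz_topology_nbhd[of "{\<phi> \<in> topspace schwartz_topology. f \<phi> \<in> ball 0 1}" "\<lambda>_. 0"] f0
    by (auto simp: topspace_schwartz_topology)
  show thesis
  proof (rule that[of "2 / \<epsilon>" n m])
    fix \<phi> :: "'a \<Rightarrow> complex" assume S: "\<phi> \<in> schwartz_space"
    define s where "s = \<epsilon> / (2 * (1 + schwartz_norm n m \<phi>))"
    have n0: "schwartz_norm n m \<phi> \<ge> 0" by (rule schwartz_norm_nonneg[OF S])
    have s: "s > 0" unfolding s_def using e(1) n0 by simp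
    have "schwartz_norm n m (\<lambda>x. of_real s * \<phi> x) \<le> s * schwartz_norm n m \<phi>"
      using schwartz_norm_cmult[OF S, of n m "of_real s"] s by simp
    also have "\<dots> < \<epsilon>" unfolding s_def using e(1) n0 by (simp add: field_simps add_strict_increasing)
    finally have "norm (f (\<lambda>x. of_real s * \<phi> x)) < 1"
      by (intro e(2) schwartz_cmult S)
    then have "s * norm (f \<phi>) < 1"
      using temperate_distribution_cmult[OF assms S, of "of_real s"] s by (simp add: norm_mult)
    then show "norm (f \<phi>) \<le> 2 / \<epsilon> * (1 + schwartz_norm n m \<phi>)"
      unfolding s_def using e(1) n0 by (simp add: field_simps)
  qed (use e(1) in simp)
qed

text \<open>A rapid smooth family is bounded in every seminorm, and a continuous functional is
  bounded on such a set.\<close>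

lemma temperate_distribution_bounded_family:
  assumes "temperate_distribution f" "smooth_family rapid \<Phi>"
  obtains C where "\<And>j. norm (f (\<Phi> j)) \<le> C"
proof -
  obtain n m C where C: "C > 0" "\<And>\<phi>. \<phi> \<in> schwartz_space \<Longrightarrow> norm (f \<phi>) \<le> C * (1 + schwartz_norm n m \<phi>)"
    using temperate_distribution_bound[OF assms(1)] by metis
  obtain K where K: "\<And>j. schwartz_norm n m (\<Phi> j) \<le> K" using rapid_schwartz_norm[OF assms(2)] by metis
  have "norm (f (\<Phi> j)) \<le> C * (1 + K)" for j
    using C(2)[OF smooth_family_rapid_imp_schwartz[OF assms(2)], of j] C(1) K[of j]
    by (meson add_left_mono less_imp_le mult_left_mono order_trans)
  then show thesis using that by blast
qed

lemma temperate_distributionI: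
  fixes f :: "('a::euclidean_space \<Rightarrow> complex) \<Rightarrow> complex"
  assumes lin: "\<And>\<phi> \<psi> a b. \<phi> \<in> schwartz_space \<Longrightarrow> \<psi> \<in> schwartz_space \<Longrightarrow>
      f (\<lambda>x. a * \<phi> x + b * \<psi> x) = a * f \<phi> + b * f \<psi>"
    and bound: "\<And>\<phi>. \<phi> \<in> schwartz_space \<Longrightarrow> norm (f \<phi>) \<le> C * schwartz_norm n m \<phi>"
  shows "temperate_distribution f"
proof -
  have "openin schwartz_topology {\<phi> \<in> schwartz_space. f \<phi> \<in> U}" if U: "open U" for U
  proof (subst openin_subopen, intro ballI)
    fix \<phi> assume "\<phi> \<in> {\<phi> \<in> schwartz_space. f \<phi> \<in> U}"
    then have S: "\<phi> \<in> schwartz_space" and "f \<phi> \<in> U" by auto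
    then obtain e where e: "e > 0" "ball (f \<phi>) e \<subseteq> U" using U openE by blast
    \<comment> \<open>The sign of \<open>C\<close> is unknown, so the radius is built from
      \<open>1 + \<bar>C\<bar>\<close>, which is positive and at least \<open>C\<close>.\<close>
    define \<epsilon> where "\<epsilon> = e / (1 + \<bar>C\<bar>)"
    have eps: "\<epsilon> > 0" unfolding \<epsilon>_def using e by auto
    let ?T = "{\<psi> \<in> schwartz_space. schwartz_norm n m (\<lambda>x. \<psi> x - \<phi> x) < \<epsilon>}"
    have "openin schwartz_topology ?T"
      unfolding schwartz_topology_def by (rule topology_generated_by_Basis) (use S eps in blast)
    moreover have "\<phi> \<in> ?T"
      using schwartz_norm_cmult[OF zero_schwartz, of n m 0] S le_less_trans[OF _ eps] by auto
    moreover have "?T \<subseteq> {\<phi> \<in> schwartz_space. f \<phi> \<in> U}"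
    proof
      fix \<psi> assume psi: "\<psi> \<in> ?T"
      then have S': "\<psi> \<in> schwartz_space" by simp
      have d: "(\<lambda>x. \<psi> x - \<phi> x) \<in> schwartz_space"
        using schwartz_lincomb[OF S' S, of 1 "-1"] by simp
      have "f \<psi> - f \<phi> = f (\<lambda>x. \<psi> x - \<phi> x)" using lin[OF S' S, of 1 "-1"] by simp
      then have "norm (f \<psi> - f \<phi>) \<le> C * schwartz_norm n m (\<lambda>x. \<psi> x - \<phi> x)"
        using bound[OF d] by simp
      also have "\<dots> \<le> (1 + \<bar>C\<bar>) * schwartz_norm n m (\<lambda>x. \<psi> x - \<phi> x)"
        using schwartz_norm_nonneg[OF d] by (intro mult_right_mono) auto
      also have "\<dots> < (1 + \<bar>C\<bar>) * \<epsilon>"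
        using psi by (intro mult_strict_left_mono) auto
      also have "\<dots> = e" unfolding \<epsilon>_def by simp
      finally have "f \<psi> \<in> ball (f \<phi>) e" by (simp add: dist_norm norm_minus_commute)
      then show "\<psi> \<in> {\<phi> \<in> schwartz_space. f \<phi> \<in> U}" using e S' by auto
    qed
    ultimately show "\<exists>T. openin schwartz_topology T \<and> \<phi> \<in> T \<and> T \<subseteq> {\<phi> \<in> schwartz_space. f \<phi> \<in> U}" by blast
  qed
  then have "continuous_map schwartz_topology euclidean f"
    unfolding continuous_map topspace_schwartz_topology by auto
  then show ?thesis unfolding temperate_distribution_def using lin by blast
qed

lemma rapid_bounded:
  assumes "rapid \<Phi>"
  shows "\<exists>C. \<forall>j x. norm (\<Phi> j x) \<le> C"
  using assms[unfolded rapid_def, rule_format, of 0] by simp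

text \<open>The members share all their bounds, so the factors \<open>1 / 2 ^ k\<close> make every
  differentiated series converge uniformly. A partial derivative of such a series is a series of the
  same kind over \<open>partial i (\<Psi> k)\<close>, which is the invariant for
  \<open>smooth_family_coinduct\<close>.\<close>

lemma schwartz_series:
  fixes \<Psi> :: "nat \<Rightarrow> 'a::euclidean_space \<Rightarrow> complex"
  assumes "smooth_family rapid \<Psi>"
  shows "(\<lambda>x. \<Sum>k. \<Psi> k x / 2 ^ k) \<in> schwartz_space"
proof -
  have summable: "summable (\<lambda>k. c k / 2 ^ k)" if "\<And>k. norm (c k) \<le> C" for c :: "nat \<Rightarrow> complex" and C :: real
  proof (rule summable_comparison_test')
    show "summable (\<lambda>k. C * (1/2) ^ k)" by (intro summable_mult summable_geometric) auto
    show "norm (c k / 2 ^ k) \<le> C * (1/2) ^ k" if "k \<ge> 0" for k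
      using \<open>norm (c k) \<le> C\<close> by (simp add: norm_divide norm_power field_simps)
  qed
  \<comment> \<open>The bound depends on \<open>C\<close> and \<open>n\<close> only. It gives
    uniform convergence of the derivatives, and with \<open>n = 0\<close> the size of the whole
    sum.\<close>
  have tail: "norm ((\<Sum>k<n. c k / 2 ^ k) - (\<Sum>k. c k / 2 ^ k)) \<le> 2 * C / 2 ^ n"
    if C: "\<And>k. norm (c k) \<le> C" for c :: "nat \<Rightarrow> complex" and C n
  proof -
    have "(\<Sum>k. c k / 2 ^ k) - (\<Sum>k<n. c k / 2 ^ k) = (\<Sum>k. c (k + n) / 2 ^ (k + n))"
      using suminf_minus_initial_segment[OF summable[of c C], of n] C by simp
    also have "norm \<dots> \<le> (\<Sum>k. C / 2 ^ n * (1/2) ^ k)"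
    proof (rule norm_suminf_le)
      show "norm (c (k + n) / 2 ^ (k + n)) \<le> C / 2 ^ n * (1/2) ^ k" for k
        using divide_right_mono[OF C[of "k + n"], of "2 ^ (k + n)"]
        by (simp add: norm_divide norm_power norm_mult power_add power_divide mult.commute)
      show "summable (\<lambda>k. C / 2 ^ n * (1/2) ^ k)" by (intro summable_mult summable_geometric) auto
    qed
    also have "\<dots> = C / 2 ^ n * 2"
      using suminf_mult[OF summable_geometric[of "1/2::real"], of "C / 2 ^ n"] suminf_geometric[of "1/2::real"] by simp
    finally show ?thesis by (simp add: norm_minus_commute mult.commute)
  qed
  define P where "P = (\<lambda>\<Phi>::unit \<Rightarrow> 'a \<Rightarrow> complex. \<exists>\<Psi>. smooth_family rapid (\<Psi>::nat \<Rightarrow> 'a \<Rightarrow> complex) \<and> \<Phi> = (\<lambda>_ x. \<Sum>k. \<Psi> k x / 2 ^ k))"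
  let ?d = "\<lambda>(\<Psi>::nat \<Rightarrow> 'a \<Rightarrow> complex) k x h. \<Sum>i\<in>Basis. (h \<bullet> i) *\<^sub>R partial i (\<Psi> k) x"
  let ?D = "\<lambda>(\<Psi>::nat \<Rightarrow> 'a \<Rightarrow> complex) x h. \<Sum>i\<in>Basis. (h \<bullet> i) *\<^sub>R (\<Sum>k. partial i (\<Psi> k) x / 2 ^ k)"
  have der: "((\<lambda>x. \<Sum>k. \<Psi> k x / 2 ^ k) has_derivative
      (\<lambda>h. ?D \<Psi> x h)) (at x)"
    if Psi: "smooth_family rapid \<Psi>" for \<Psi> :: "nat \<Rightarrow> 'a \<Rightarrow> complex" and x
  proof -
    have "\<exists>C. \<forall>k x. norm (partial i (\<Psi> k) x) \<le> C" if "i \<in> Basis" for i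
      using rapid_bounded[OF smooth_family_D(2)[OF smooth_family_D(3)[OF Psi that]]] .
    then obtain C where C: "\<And>i k x. i \<in> Basis \<Longrightarrow> norm (partial i (\<Psi> k) x) \<le> C i"
      by (metis (no_types))
    obtain C0 where C0: "\<And>k x. norm (\<Psi> k x) \<le> C0"
      using rapid_bounded[OF smooth_family_D(2)[OF Psi]] by blast
    define K where "K = (\<Sum>i\<in>Basis. 2 * C i)"
    have C0': "C i \<ge> 0" if "i \<in> Basis" for i using C[OF that, of 0 0] norm_ge_zero order_trans by blast
    have K0: "K \<ge> 0" unfolding K_def by (intro sum_nonneg) (simp add: C0')
    have "\<exists>g. \<forall>x\<in>UNIV. (\<lambda>k. \<Psi> k x / 2 ^ k) sums g x \<and> (g has_derivative
      (\<lambda>h. ?D \<Psi> x h)) (at x within UNIV)"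
    proof (rule has_derivative_series[where f'="\<lambda>k x h. ?d \<Psi> k x h / 2 ^ k"])
      show "((\<lambda>x. \<Psi> k x / 2 ^ k) has_derivative (\<lambda>h. ?d \<Psi> k x h / 2 ^ k)) (at x within UNIV)" for k x
      proof -
        have "((\<lambda>x. \<Psi> k x * (1 / 2 ^ k)) has_derivative (\<lambda>h. ?d \<Psi> k x h * (1 / 2 ^ k))) (at x)"
          by (rule has_derivative_mult_left[OF has_derivative_partial[OF smooth_family_D(1)[OF Psi]]])
        then show ?thesis by simp
      qed
      let ?err = "\<lambda>n x h. norm ((\<Sum>k<n. ?d \<Psi> k x h / 2 ^ k) - ?D \<Psi> x h)"
      fix e :: real assume e: "e > 0"
      have "(\<lambda>n. K * (1/2) ^ n) \<longlonglongrightarrow> K * 0"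
        by (intro tendsto_mult_left LIMSEQ_power_zero) auto
      then have ev: "\<forall>\<^sub>F n in sequentially. K * (1/2) ^ n < e" using e by (auto dest: order_tendstoD)
      show "\<forall>\<^sub>F n in sequentially. \<forall>x\<in>UNIV. \<forall>h. ?err n x h \<le> e * norm h"
        using ev
      proof eventually_elim
        fix n assume n: "K * (1/2) ^ n < e"
        show "\<forall>x\<in>UNIV. \<forall>h. ?err n x h \<le> e * norm h"
        proof (intro ballI allI)
          fix x h :: 'a
          let ?r = "\<lambda>i. (\<Sum>k<n. partial i (\<Psi> k) x / 2 ^ k) - (\<Sum>k. partial i (\<Psi> k) x / 2 ^ k)"
          have "(\<Sum>k<n. ?d \<Psi> k x h / 2 ^ k) =
              (\<Sum>i\<in>Basis. (h \<bullet> i) *\<^sub>R (\<Sum>k<n. partial i (\<Psi> k) x / 2 ^ k))"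
            unfolding sum_divide_distrib scaleR_sum_right
            by (subst sum.swap) (simp add: scaleR_conv_of_real)
          then have "?err n x h =
              norm (\<Sum>i\<in>Basis. (h \<bullet> i) *\<^sub>R ?r i)"
            by (simp add: scaleR_diff_right sum_subtractf)
          also have "\<dots> \<le> (\<Sum>i\<in>Basis. norm h * (2 * C i / 2 ^ n))"
          proof (rule sum_norm_le)
            fix i :: 'a assume i: "i \<in> Basis"
            show "norm ((h \<bullet> i) *\<^sub>R ?r i)
                \<le> norm h * (2 * C i / 2 ^ n)"
              unfolding norm_scaleR by (intro mult_mono Basis_le_norm tail C i) auto
          qed
          also have "\<dots> = K * (1/2) ^ n * norm h"
            unfolding K_def by (simp add: sum_distrib_left sum_distrib_right power_divide ac_simps)
          also have "\<dots> \<le> e * norm h" using n by (intro mult_right_mono) auto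
          finally show "?err n x h \<le> e * norm h" .
        qed
      qed
    next
      show "(\<lambda>k. \<Psi> k 0 / 2 ^ k) sums (\<Sum>k. \<Psi> k 0 / 2 ^ k)" using summable[of "\<lambda>k. \<Psi> k 0" C0] C0 by blast
    qed auto
    then obtain g where g: "\<And>x. (\<lambda>k. \<Psi> k x / 2 ^ k) sums g x" and
      g': "\<And>x. (g has_derivative (\<lambda>h. ?D \<Psi> x h)) (at x)" by auto
    have "g = (\<lambda>x. \<Sum>k. \<Psi> k x / 2 ^ k)" using g sums_unique by blast
    then show ?thesis using g'[of x] by simp
  qed
  have "smooth_family rapid (\<lambda>_::unit. \<lambda>x. \<Sum>k. \<Psi> k x / 2 ^ k)"
  proof (rule smooth_family_coinduct[where P=P])
    show "P (\<lambda>_ x. \<Sum>k. \<Psi> k x / 2 ^ k)" using assms unfolding P_def by blast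
    show "\<Phi> j differentiable at x" if "P \<Phi>" for \<Phi> j x
      using that der unfolding P_def differentiable_def by blast
    show "P (\<lambda>j. partial i (\<Phi> j))" if P: "P \<Phi>" and i: "i \<in> Basis" for \<Phi> i
    proof -
      obtain \<Psi> where Psi: "smooth_family rapid \<Psi>" "\<Phi> = (\<lambda>_ x. \<Sum>k. \<Psi> k x / 2 ^ k)" using P unfolding P_def by blast
      have "(\<lambda>j. partial i (\<Phi> j)) = (\<lambda>_ x. \<Sum>k. partial i (\<Psi> k) x / 2 ^ k)"
        unfolding Psi(2) using i by (simp add: fun_eq_iff partial_eqI[OF der[OF Psi(1)]] inner_Basis if_distrib[of "\<lambda>x. x *\<^sub>R _"] cong: if_cong)
      then show ?thesis unfolding P_def using smooth_family_D(3)[OF Psi(1) i] by blast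
    qed
    show "rapid \<Phi>" if P: "P \<Phi>" for \<Phi>
      unfolding rapid_def
    proof
      fix n
      obtain \<Psi> where Psi: "smooth_family rapid \<Psi>" "\<Phi> = (\<lambda>_ x. \<Sum>k. \<Psi> k x / 2 ^ k)" using P unfolding P_def by blast
      obtain C where C: "\<And>k x. (1 + norm x) ^ n * norm (\<Psi> k x) \<le> C"
        using rapidD[OF smooth_family_D(2)[OF Psi(1)], of n] by metis
      have "(1 + norm x) ^ n * norm (\<Sum>k. \<Psi> k x / 2 ^ k) \<le> 2 * C" for x
      proof -
        have p: "(1 + norm x) ^ n > 0" by (intro zero_less_power add_pos_nonneg) auto
        have "norm (\<Psi> k x) \<le> C / (1 + norm x) ^ n" for k
          using C[of x k] p by (simp add: pos_le_divide_eq mult.commute)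
        from tail[of "\<lambda>k. \<Psi> k x" "C / (1 + norm x) ^ n" 0, OF this] show ?thesis
          using p by (simp add: pos_le_divide_eq mult.commute)
      qed
      then show "\<exists>C. \<forall>j x. (1 + norm x) ^ n * norm (\<Phi> j x) \<le> C" unfolding Psi(2) by blast
    qed
  qed
  then show ?thesis unfolding schwartz_iff .
qed

section \<open>Gaussians and bump functions\<close>

lemma partial_const [simp]: "partial i (\<lambda>_. c) = (\<lambda>_. 0)"
  by (auto simp: fun_eq_iff partial_eqI[OF has_derivative_const])

lemma poly_bounded_mult:
  assumes "poly_bounded \<Phi>" "poly_bounded \<Psi>"
  shows "poly_bounded (\<lambda>j x. \<Phi> j x * \<Psi> j x)"
proof -
  obtain C N where C: "C > 0" "\<And>j x. norm (\<Phi> j x) \<le> C * (1 + norm x) ^ N"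
    using poly_boundedD[OF assms(1)] by metis
  obtain D M where D: "D > 0" "\<And>j x. norm (\<Psi> j x) \<le> D * (1 + norm x) ^ M"
    using poly_boundedD[OF assms(2)] by metis
  have "norm (\<Phi> j x * \<Psi> j x) \<le> (C * D) * (1 + norm x) ^ (N + M)" for j x
  proof -
    have "norm (\<Phi> j x * \<Psi> j x) \<le> (C * (1 + norm x) ^ N) * (D * (1 + norm x) ^ M)"
      unfolding norm_mult using C(1) by (intro mult_mono C D) auto
    then show ?thesis by (simp add: power_add ac_simps)
  qed
  then show ?thesis unfolding poly_bounded_def by blast
qed

lemma poly_boundedI: "(\<And>j x. norm (\<Phi> j x) \<le> C * (1 + norm x) ^ N) \<Longrightarrow> poly_bounded \<Phi>"
  unfolding poly_bounded_def by blast

lemma smooth_family_poly_const: "smooth_family poly_bounded (\<lambda>_ _. c)"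
  by (rule smooth_family_coinduct[where P="\<lambda>\<Phi>. \<exists>c. \<Phi> = (\<lambda>_ _. c)"])
     (auto intro!: poly_boundedI[where N=0])

lemma smooth_family_coordinate:
  fixes v :: "'a::euclidean_space"
  shows "smooth_family poly_bounded (\<lambda>_::'j. \<lambda>x. complex_of_real (x \<bullet> v))"
proof (rule smooth_family_coinduct[where P="\<lambda>\<Phi>. (\<exists>c. \<Phi> = (\<lambda>_ _. c)) \<or> (\<exists>v. \<Phi> = (\<lambda>_ x. complex_of_real (x \<bullet> v)))"])
  have d: "((\<lambda>x. complex_of_real (x \<bullet> v)) has_derivative (\<lambda>h. complex_of_real (h \<bullet> v))) (at x)" for v x :: 'a
    by (auto intro!: derivative_eq_intros)
  fix \<Phi> :: "'j \<Rightarrow> 'a \<Rightarrow> complex"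
  assume P: "(\<exists>c. \<Phi> = (\<lambda>_ _. c)) \<or> (\<exists>v. \<Phi> = (\<lambda>_ x. complex_of_real (x \<bullet> v)))"
  show "\<Phi> j differentiable (at x)" for j x
    using P d unfolding differentiable_def by (auto intro: has_derivative_const)
  have "poly_bounded (\<lambda>_::'j. \<lambda>x. complex_of_real (x \<bullet> v))" for v :: 'a
  proof (rule poly_boundedI[where C="norm v" and N=1])
    fix x :: 'a
    have "\<bar>x \<bullet> v\<bar> \<le> norm v * norm x" using Cauchy_Schwarz_ineq2[of x v] by (simp add: mult.commute)
    then show "norm (complex_of_real (x \<bullet> v)) \<le> norm v * (1 + norm x) ^ 1"
      by (simp add: algebra_simps add_increasing)
  qed
  moreover have "poly_bounded (\<lambda>_::'j. \<lambda>_::'a. c)" for c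
    by (rule poly_boundedI[where C="norm c" and N=0]) simp
  ultimately show "poly_bounded \<Phi>" using P by auto
  show "(\<exists>c. (\<lambda>j. partial i (\<Phi> j)) = (\<lambda>_ _. c)) \<or> (\<exists>v. (\<lambda>j. partial i (\<Phi> j)) = (\<lambda>_ x. complex_of_real (x \<bullet> v)))" for i
  proof -
    have "partial i (\<lambda>x. complex_of_real (x \<bullet> v)) = (\<lambda>_. complex_of_real (i \<bullet> v))" for v
      by (rule ext) (rule partial_eqI[OF d])
    then show ?thesis using P by auto
  qed
qed auto

lemma smooth_family_poly_mult:
  "smooth_family poly_bounded \<Phi> \<Longrightarrow> smooth_family poly_bounded \<Psi> \<Longrightarrow>
    smooth_family poly_bounded (\<lambda>j x. \<Phi> j x * \<Psi> j x)"
  by (rule smooth_family_mult[of poly_bounded poly_bounded poly_bounded])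
     (use poly_bounded_mult poly_bounded_lincomb[where a=1 and b=1] in auto)

lemma smooth_family_poly_lincomb:
  "smooth_family poly_bounded \<Phi> \<Longrightarrow> smooth_family poly_bounded \<Psi> \<Longrightarrow>
    smooth_family poly_bounded (\<lambda>j x. a * \<Phi> j x + b * \<Psi> j x)"
  by (rule smooth_family_lincomb) (use poly_bounded_lincomb in auto)

lemma smooth_family_norm_square:
  "smooth_family poly_bounded (\<lambda>_::unit. \<lambda>x::'a::euclidean_space. complex_of_real (x \<bullet> x))"
proof -
  have s: "smooth_family poly_bounded (\<lambda>_::unit. \<lambda>x::'a. \<Sum>i\<in>F. complex_of_real (x \<bullet> i) * complex_of_real (x \<bullet> i))"
    if "finite F" for F
    using that
  proof induction
    case (insert i F)
    then show ?case
      using smooth_family_poly_lincomb[OF smooth_family_poly_mult[OF smooth_family_coordinate[of i] smooth_family_coordinate[of i]] insert.IH, of 1 1]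
      by simp
  qed (use smooth_family_poly_const[of 0] in simp)
  have "complex_of_real (x \<bullet> x) = (\<Sum>i\<in>Basis. complex_of_real (x \<bullet> i) * complex_of_real (x \<bullet> i))" for x :: 'a
    by (subst euclidean_inner) simp
  then show ?thesis using s[OF finite_Basis] by presburger
qed

lemma differentiable_norm_square: "(\<lambda>x::'a::euclidean_space. x \<bullet> x) differentiable (at x)"
  unfolding differentiable_def by (rule exI) (auto intro!: derivative_eq_intros)

text \<open>A single term of the exponential series is at most the whole sum.\<close>

lemma power_mult_exp_neg_bounded:
  fixes t :: real assumes "t \<ge> 0"
  shows "t ^ n * exp (- t) \<le> fact n"
proof -
  have "t ^ n / fact n \<le> exp t"
    using sum_le_suminf[OF summable_exp_generic[of t], of "{n}"] assms
    by (simp add: exp_def divide_inverse mult.commute)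
  then show ?thesis by (simp add: exp_minus field_simps)
qed

definition gauss :: "'a::euclidean_space \<Rightarrow> complex" where
  "gauss x = of_real (exp (- pi * (x \<bullet> x)))"

lemma gauss_schwartz: "gauss \<in> (schwartz_space :: ('a::euclidean_space \<Rightarrow> complex) set)"
proof -
  \<comment> \<open>The successive derivatives of \<open>s \<mapsto> exp (- pi * s)\<close>, to be
    composed with the squared norm.\<close>
  let ?F = "\<lambda>k s. complex_of_real ((- pi) ^ k * exp (- pi * s))"
  have r: "rapid (\<lambda>_::unit. \<lambda>x::'a. ?F k (x \<bullet> x))" for k
    unfolding rapid_def
  proof
    fix n
    have "(1 + norm x) ^ n * norm (?F k (x \<bullet> x)) \<le> 2 ^ n * (1 + fact n) * pi ^ k" for x :: 'a
    proof -
      have "norm x ^ n * exp (- pi * (x \<bullet> x)) \<le> 1 + fact n"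
      proof (cases "norm x \<le> 1")
        case True
        have "norm x ^ n * exp (- pi * (x \<bullet> x)) \<le> 1 * 1"
          using True by (intro mult_mono power_le_one) auto
        then show ?thesis using fact_ge_zero[of n, where 'a=real] by linarith
      next
        case False
        have "norm x ^ n * exp (- pi * (x \<bullet> x)) \<le> (norm x) ^ n * exp (- norm x)"
        proof (intro mult_left_mono)
          have "norm x * 1 \<le> norm x * norm x" using False by (intro mult_left_mono) auto
          also have "\<dots> \<le> pi * (norm x * norm x)" using pi_gt3 by (simp add: mult_le_cancel_right1)
          finally show "exp (- pi * (x \<bullet> x)) \<le> exp (- norm x)" by (simp add: power2_norm_eq_inner[symmetric] power2_eq_square)
        qed auto
        also have "\<dots> \<le> fact n" by (rule power_mult_exp_neg_bounded) simp
        finally show ?thesis by simp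
      qed
      moreover have "exp (- pi * (x \<bullet> x)) \<le> 1 + fact n"
        by (rule order_trans[of _ 1]) auto
      ultimately have *: "max 1 (norm x ^ n) * exp (- pi * (x \<bullet> x)) \<le> 1 + fact n" by (simp add: max_def)
      have "(1 + norm x) ^ n * norm (?F k (x \<bullet> x)) \<le> (2 ^ n * max 1 (norm x ^ n)) * (pi ^ k * exp (- pi * (x \<bullet> x)))"
        unfolding norm_of_real abs_mult power_abs
        by (intro mult_mono weight_bounds) auto
      also have "\<dots> = 2 ^ n * pi ^ k * (max 1 (norm x ^ n) * exp (- pi * (x \<bullet> x)))" by simp
      also have "\<dots> \<le> 2 ^ n * pi ^ k * (1 + fact n)" by (rule mult_left_mono[OF *]) simp
      finally show ?thesis by (simp add: ac_simps)
    qed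
    then show "\<exists>C. \<forall>(j::unit) x::'a. (1 + norm x) ^ n * norm (?F k (x \<bullet> x)) \<le> C" by blast
  qed
  have "smooth_family rapid (\<lambda>_::unit. \<lambda>x::'a. ?F 0 (x \<bullet> x))"
  proof (rule smooth_family_compose[where F="?F" and r="\<lambda>x. x \<bullet> x"])
    show "(?F k has_vector_derivative ?F (Suc k) s) (at s)" for k s
      unfolding of_real_mult[symmetric]
      by (rule has_vector_derivative_of_real) (auto intro!: derivative_eq_intros)
    show "rapid \<Phi> \<Longrightarrow> rapid \<Psi> \<Longrightarrow> rapid (\<lambda>j x. \<Phi> j x + \<Psi> j x)" for \<Phi> \<Psi> :: "unit \<Rightarrow> 'a \<Rightarrow> complex"
      using rapid_lincomb[of \<Phi> \<Psi> 1 1] by simp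
  qed (rule smooth_family_norm_square differentiable_norm_square r rapid_mult_poly; assumption?)+
  then show ?thesis unfolding schwartz_iff gauss_def[abs_def] by simp
qed

text \<open>The classical profile \<open>exp (- 1 / (1 - s))\<close> carries a polynomial in
  \<open>1 / (1 - s)\<close>, because this enlarged class is closed under differentiation.\<close>

definition bump_profile :: "real poly \<Rightarrow> real \<Rightarrow> real" where
  "bump_profile p s = (if s < 1 then poly p (1 / (1 - s)) * exp (- (1 / (1 - s))) else 0)"

lemma poly_mult_exp_neg_tendsto_0: "((\<lambda>u::real. poly p u * exp (- u)) \<longlongrightarrow> 0) at_top"
proof -
  have "((\<lambda>u::real. \<Sum>i\<le>degree p. coeff p i * (u ^ i / exp u)) \<longlongrightarrow> (\<Sum>i\<le>degree p. coeff p i * 0)) at_top"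
    by (intro tendsto_sum tendsto_mult_left tendsto_power_div_exp_0)
  then show ?thesis by (simp add: poly_altdef sum_distrib_right exp_minus divide_inverse mult.assoc)
qed

text \<open>With \<open>u = 1 / (1 - s)\<close> one has \<open>u' = u ^ 2\<close>, so
  \<open>p(u) * exp (- u)\<close> has the derivative \<open>u ^ 2 * (p' - p)(u) * exp (- u)\<close>;
  this explains the polynomial. The transition point \<open>s = 1\<close> is settled by the limit of
  the difference quotient.\<close>

lemma bump_profile_derivative:
  "(bump_profile p has_field_derivative bump_profile ([:0,0,1:] * (pderiv p - p)) s) (at s)"
proof -
  consider "s < 1" | "s > 1" | "s = 1" by linarith
  then show ?thesis
  proof cases
    case 1
    have "((\<lambda>s. poly p (1 / (1 - s)) * exp (- (1 / (1 - s)))) has_field_derivative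
        poly ([:0,0,1:] * (pderiv p - p)) (1 / (1 - s)) * exp (- (1 / (1 - s)))) (at s)"
    proof -
      have u: "((\<lambda>s. 1 / (1 - s)) has_field_derivative (1 / (1 - s)) * (1 / (1 - s))) (at s)"
        using 1 by (auto intro!: derivative_eq_intros)
      have "((\<lambda>u. poly p u * exp (- u)) has_field_derivative
         (poly (pderiv p - p) (1 / (1 - s)) * exp (- (1 / (1 - s))))) (at (1 / (1 - s)))"
        by (auto intro!: derivative_eq_intros simp: algebra_simps)
      from DERIV_chain2[OF this u] show ?thesis by (simp add: algebra_simps)
    qed
    then show ?thesis
      using 1 by (subst has_field_derivative_cong_ev[where g="\<lambda>s. poly p (1 / (1 - s)) * exp (- (1 / (1 - s)))" and y=s and S=UNIV, OF refl])
        (auto simp: bump_profile_def intro!: eventually_mono[OF eventually_nhds_in_open[of "{..<1}" s]])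
  next
    case 2
    have "((\<lambda>_. 0) has_field_derivative 0) (at s)" by simp
    then have "(bump_profile p has_field_derivative 0) (at s)"
      by (rule has_field_derivative_transform_within_open[of _ _ _ "{1<..}"])
         (use 2 in \<open>auto simp: bump_profile_def\<close>)
    then show ?thesis using 2 by (simp add: bump_profile_def)
  next
    case 3
    have lim: "((\<lambda>t. (bump_profile p t - bump_profile p 1) / (t - 1)) \<longlongrightarrow> 0) (at 1)"
    proof (rule filterlim_split_at)
      have "filterlim (\<lambda>t::real. 1 / (1 - t)) at_top (at_left 1)"
        by real_asymp
      \<comment> \<open>To the left of 1, dividing by \<open>t - 1\<close> is multiplication by
        \<open>- 1 / (1 - t)\<close>, hence the extra factor \<open>[:0, -1:]\<close>.\<close>
      then have "((\<lambda>t. poly ([:0, -1:] * p) (1 / (1 - t)) * exp (- (1 / (1 - t)))) \<longlongrightarrow> 0) (at_left 1)"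
        by (rule filterlim_compose[OF poly_mult_exp_neg_tendsto_0])
      moreover have "\<forall>\<^sub>F t in at_left 1. poly ([:0, -1:] * p) (1 / (1 - t)) * exp (- (1 / (1 - t))) =
          (bump_profile p t - bump_profile p 1) / (t - 1)"
        using eventually_at_left_real[of 0 1]
        by (auto elim!: eventually_mono simp: bump_profile_def field_simps)
      ultimately show "((\<lambda>t. (bump_profile p t - bump_profile p 1) / (t - 1)) \<longlongrightarrow> 0) (at_left 1)"
        by (rule Lim_transform_eventually)
      have "\<forall>\<^sub>F t in at_right 1. 0 = (bump_profile p t - bump_profile p 1) / (t - 1)"
        using eventually_at_right_real[of 1 2]
        by (auto elim!: eventually_mono simp: bump_profile_def)
      then show "((\<lambda>t. (bump_profile p t - bump_profile p 1) / (t - 1)) \<longlongrightarrow> 0) (at_right 1)"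
        by (rule Lim_transform_eventually[OF tendsto_const])
    qed
    then show ?thesis unfolding 3 has_field_derivative_iff by (simp add: bump_profile_def)
  qed
qed

lemma smooth_bump_exists:
  obtains b :: "'a::euclidean_space \<Rightarrow> complex" where
    "smooth b" "b 0 = 1" "\<And>x. norm x \<ge> 1 \<Longrightarrow> b x = 0"
proof -
  \<comment> \<open>The starting constant \<open>exp 1\<close> cancels the value
    \<open>exp (- 1)\<close> of the profile at 0 and normalises \<open>b 0 = 1\<close>.\<close>
  let ?p = "\<lambda>k. ((\<lambda>p. [:0,0,1:] * (pderiv p - p)) ^^ k) [:exp 1:]"
  let ?F = "\<lambda>k s. complex_of_real (bump_profile (?p k) s)"
  have "smooth_family (\<lambda>_. True) (\<lambda>_::unit. \<lambda>x::'a. ?F 0 (x \<bullet> x))"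
  proof (rule smooth_family_compose[where F="?F" and r="\<lambda>x. x \<bullet> x"])
    show "(?F k has_vector_derivative ?F (Suc k) s) (at s)" for k s
      by (rule has_vector_derivative_of_real) (use bump_profile_derivative[of "?p k" s] in simp)
  qed (use smooth_family_norm_square differentiable_norm_square in auto)
  then have "smooth (\<lambda>x::'a. ?F 0 (x \<bullet> x))" unfolding smooth_iff by simp
  moreover have "?F 0 (0 \<bullet> (0::'a)) = 1" by (simp add: bump_profile_def exp_minus)
  moreover have "?F 0 (x \<bullet> x) = 0" if "norm x \<ge> 1" for x :: 'a
  proof -
    have "x \<bullet> x \<ge> 1" using that by (metis one_le_power power2_norm_eq_inner)
    then show ?thesis by (simp add: bump_profile_def)
  qed
  ultimately show thesis using that by blast
qed

section \<open>The Fourier transform\<close>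

lemma schwartz_partial_bound:
  assumes "\<phi> \<in> schwartz_space" "j \<in> Basis"
  shows "(1 + norm x) ^ n * norm (partial j \<phi> x) \<le> 2 ^ n * schwartz_norm n 1 \<phi>"
proof -
  have "(1 + norm x) ^ n * norm (partial j \<phi> x) \<le> 2 ^ n * max 1 (norm x ^ n) * norm (partial j \<phi> x)"
    by (intro mult_right_mono weight_bounds) auto
  also have "\<dots> \<le> 2 ^ n * schwartz_norm n 1 \<phi>"
    using schwartz_norm_ge[OF assms(1), of "[j]" 1 x n] assms(2) by (simp add: partial_def)
  finally show ?thesis .
qed

lemma schwartz_lipschitz:
  fixes \<phi> :: "'a::euclidean_space \<Rightarrow> complex"
  assumes "\<phi> \<in> schwartz_space"
  shows "norm (\<phi> x - \<phi> y) \<le> (real DIM('a) * schwartz_norm 0 1 \<phi>) * norm (x - y)"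
  using schwartz_partial_bound[OF assms, of _ _ 0] by (intro mean_value_bound[where S=UNIV] schwartz_differentiable assms) auto

text \<open>The integral factorises over the coordinates into one-dimensional arctangent integrals,
  which gives a majorant in every dimension.\<close>

lemma integrable_prod_inverse_squares:
  "integrable lborel (\<lambda>x::'a::euclidean_space. \<Prod>b\<in>Basis. 1 / (1 + (x \<bullet> b)\<^sup>2))"
proof (rule integrableI_bounded)
  have 1: "integrable lborel (\<lambda>x::real. 1 / (1 + x\<^sup>2))"
    using integrable_inverse_1_plus_square by (simp add: set_integrable_def divide_inverse)
  have fin: "(\<integral>\<^sup>+x. ennreal (1 / (1 + x\<^sup>2)) \<partial>lborel) < \<infinity>"
    using 1 unfolding integrable_iff_bounded by (simp add: add_nonneg_nonneg)
  have "(\<integral>\<^sup>+x. ennreal (norm (\<Prod>b\<in>Basis. 1 / (1 + (x \<bullet> b)\<^sup>2))) \<partial>(lborel :: 'a measure)) =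
      (\<integral>\<^sup>+x. (\<Prod>b\<in>Basis. ennreal (1 / (1 + (x \<bullet> b)\<^sup>2))) \<partial>(lborel :: 'a measure))"
    by (simp add: prod_ennreal prod_nonneg abs_prod)
  also have "\<dots> = (\<Prod>b\<in>(Basis::'a set). (\<integral>\<^sup>+x. ennreal (1 / (1 + x\<^sup>2)) \<partial>lborel))"
    by (rule nn_integral_lborel_prod) auto
  also have "\<dots> < \<infinity>" using fin by (simp add: power_less_top_ennreal)
  finally show "(\<integral>\<^sup>+x. ennreal (norm (\<Prod>b\<in>Basis. 1 / (1 + (x \<bullet> b)\<^sup>2))) \<partial>(lborel :: 'a measure)) < \<infinity>" .
qed simp

text \<open>The exponent comes from
  \<open>1 + (x \<bullet> b)\<^sup>2 \<le> (1 + norm x)\<^sup>2\<close>, applied to each of the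
  \<open>DIM('a)\<close> coordinates.\<close>

lemma integrable_rapid_majorant:
  "integrable lborel (\<lambda>x::'a::euclidean_space. 1 / (1 + norm x) ^ (2 * DIM('a)))"
proof (rule Bochner_Integration.integrable_bound[OF integrable_prod_inverse_squares], simp, intro AE_I2)
  fix x :: 'a
  have "(\<Prod>b\<in>Basis. 1 + (x \<bullet> b)\<^sup>2) \<le> (\<Prod>b\<in>(Basis::'a set). (1 + norm x)\<^sup>2)"
  proof (intro prod_mono conjI)
    fix b :: 'a assume b: "b \<in> Basis"
    have "(x \<bullet> b)\<^sup>2 \<le> (norm x)\<^sup>2" using Basis_le_norm[OF b, of x] by (simp add: abs_le_square_iff[symmetric])
    then show "1 + (x \<bullet> b)\<^sup>2 \<le> (1 + norm x)\<^sup>2" by (simp add: power2_sum add_increasing2)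
  qed simp
  also have "\<dots> = (1 + norm x) ^ (2 * DIM('a))" by (simp add: power_mult)
  finally have "1 / (1 + norm x) ^ (2 * DIM('a)) \<le> 1 / (\<Prod>b\<in>Basis. 1 + (x \<bullet> b)\<^sup>2)"
    by (intro divide_left_mono mult_pos_pos prod_pos zero_less_power) (auto intro: add_pos_nonneg)
  then show "norm (1 / (1 + norm x) ^ (2 * DIM('a))) \<le> norm (\<Prod>b\<in>Basis. 1 / (1 + (x \<bullet> b)\<^sup>2))"
    by (simp add: prod_dividef prod_nonneg abs_prod)
qed

lemma integrable_rapid:
  fixes g :: "'a::euclidean_space \<Rightarrow> complex"
  assumes "g \<in> borel_measurable lborel" "\<And>x. (1 + norm x) ^ (2 * DIM('a)) * norm (g x) \<le> C"
  shows "integrable lborel g"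
proof (rule Bochner_Integration.integrable_bound[OF integrable_mult_right[OF integrable_rapid_majorant, of C]])
  have "norm (g x) \<le> norm (C * (1 / (1 + norm x) ^ (2 * DIM('a))))" for x
  proof -
    have "(1 + norm x) ^ (2 * DIM('a)) > 0" by (intro zero_less_power add_pos_nonneg) auto
    then have "norm (g x) \<le> C * (1 / (1 + norm x) ^ (2 * DIM('a)))"
      using assms(2)[of x] by (simp add: pos_le_divide_eq mult.commute)
    then show ?thesis by (metis abs_ge_self order_trans real_norm_def)
  qed
  then show "AE x in lborel. norm (g x) \<le> norm (C * (1 / (1 + norm x) ^ (2 * DIM('a))))" by simp
qed (use assms in auto)

lemma schwartz_measurable [measurable]: "\<phi> \<in> schwartz_space \<Longrightarrow> \<phi> \<in> borel_measurable borel"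
  by (simp add: borel_measurable_continuous_onI schwartz_smooth smooth_imp_continuous_on)

lemma schwartz_integrable: "\<phi> \<in> schwartz_space \<Longrightarrow> integrable lborel \<phi>"
  using schwartz_decay[of \<phi> "2 * DIM('a)"] integrable_rapid[of \<phi>] schwartz_measurable
  by (metis measurable_lborel2)

text \<open>Used with \<open>c = 1\<close> for translations and with \<open>c = - 1\<close> for
  reflections, both of which preserve Lebesgue measure.\<close>

lemma lborel_integral_reflect_translate:
  fixes g :: "'a::euclidean_space \<Rightarrow> complex"
  assumes [measurable]: "g \<in> borel_measurable borel" and c: "\<bar>c\<bar> = 1"
  shows "(LINT x|lborel. g (t + c *\<^sub>R x)) = (LINT x|lborel. g x)"
proof -
  have "lborel = density (distr lborel borel (\<lambda>x. t + c *\<^sub>R x)) (\<lambda>_. 1)"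
    using lborel_affine[of c t] c by auto
  also have "\<dots> = distr lborel borel (\<lambda>x. t + c *\<^sub>R x)" by (rule density_1)
  finally have "(LINT x|lborel. g x) = (LINT x|distr lborel borel (\<lambda>x. t + c *\<^sub>R x). g x)" by simp
  also have "\<dots> = (LINT x|lborel. g (t + c *\<^sub>R x))" by (rule integral_distr) auto
  finally show ?thesis by simp
qed

section \<open>Characters and their Taylor estimates\<close>

definition character :: "'a::euclidean_space \<Rightarrow> 'a \<Rightarrow> complex" where
  "character y x = exp (- 2 * complex_of_real pi * \<i> * complex_of_real (x \<bullet> y))"

lemma fourier_character: "fourier \<phi> y = (LINT x|lborel. \<phi> x * character y x)"
  unfolding fourier_def character_def ..

lemma character_iexp: "character y x = iexp (- 2 * pi * (x \<bullet> y))"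
  by (simp add: character_def ac_simps)

lemma norm_character [simp]: "norm (character y x) = 1"
  unfolding character_iexp by simp

lemma character_commute: "character y x = character x y"
  unfolding character_def by (simp add: inner_commute)

lemma character_add: "character (y + z) x = character y x * character z x"
  unfolding character_def exp_add[symmetric] by (simp add: inner_add_right algebra_simps)

lemma character_add_right: "character y (x + z) = character y x * character y z"
  by (metis character_add character_commute)

lemma character_diff_right: "character y (x - z) = character y x * character y (- z)"
  using character_add_right[of y x "- z"] by simp

lemma character_minus: "character (- y) x = character y (- x)"
  unfolding character_def by simp

lemma character_0 [simp]: "character 0 x = 1" "character y 0 = 1"
  unfolding character_def by auto

lemma norm_character_minus_1: "norm (character y x - 1) \<le> 2 * pi * \<bar>x \<bullet> y\<bar>"
  using iexp_approx1[of "- 2 * pi * (x \<bullet> y)" 0] unfolding character_iexp by (simp add: abs_mult)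

lemma norm_character_diff: "norm (character y x - character y z) \<le> 2 * pi * norm y * norm (x - z)"
proof -
  have "character y x - character y z = (character y (x - z) - 1) * character y z"
    using character_add_right[of y "x - z" z] by (simp add: algebra_simps)
  then have "norm (character y x - character y z) \<le> 2 * pi * \<bar>(x - z) \<bullet> y\<bar>"
    using norm_character_minus_1[of y "x - z"] by (simp add: norm_mult)
  also have "\<dots> \<le> 2 * pi * (norm y * norm (x - z))"
    using Cauchy_Schwarz_ineq2[of "x - z" y] by (intro mult_left_mono) (auto simp: mult.commute)
  finally show ?thesis by simp
qed

text \<open>First-order Taylor expansion of \<open>iexp\<close>. The estimate serves twice: for
  differentiating the transform, where Schwartz decay absorbs \<open>(norm x)\<^sup>2\<close>, and,
  with the two variables exchanged, for the transforms of difference quotients.\<close>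

lemma character_second_order:
  "norm (character (y + h) x - character y x - character y x * (- 2 * complex_of_real pi * \<i> * complex_of_real (x \<bullet> h)))
    \<le> 2 * pi\<^sup>2 * (norm x)\<^sup>2 * (norm h)\<^sup>2"
proof -
  have "character (y + h) x - character y x - character y x * (- 2 * complex_of_real pi * \<i> * complex_of_real (x \<bullet> h)) =
     character y x * (character h x - (\<Sum>k\<le>1. (\<i> * complex_of_real (- 2 * pi * (x \<bullet> h))) ^ k / fact k))"
    unfolding character_add by (simp add: algebra_simps)
  then have "norm (character (y + h) x - character y x - character y x * (- 2 * complex_of_real pi * \<i> * complex_of_real (x \<bullet> h)))
      = norm (character h x - (\<Sum>k\<le>1. (\<i> * complex_of_real (- 2 * pi * (x \<bullet> h))) ^ k / fact k))"
    by (simp only: norm_mult norm_character mult_1)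
  also have "\<dots> \<le> \<bar>- 2 * pi * (x \<bullet> h)\<bar> ^ Suc 1 / fact (Suc 1)"
    unfolding character_iexp[of h x] by (rule iexp_approx1)
  also have "\<dots> = 2 * pi\<^sup>2 * (x \<bullet> h)\<^sup>2"
    by (simp add: power2_eq_square abs_mult)
  also have "\<dots> \<le> 2 * pi\<^sup>2 * ((norm x)\<^sup>2 * (norm h)\<^sup>2)"
    using abs_le_square_iff[of "x \<bullet> h" "norm x * norm h"] Cauchy_Schwarz_ineq2[of x h]
    by (intro mult_left_mono) (auto simp: power_mult_distrib)
  finally show ?thesis by (simp add: mult.assoc)
qed

lemma partial_character:
  fixes x p :: "'a::euclidean_space"
  shows "partial i (\<lambda>x. c * character p x) x = c * (- 2 * complex_of_real pi * \<i> * complex_of_real (i \<bullet> p)) * character p x"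
    and "(\<lambda>x. c * character p x) differentiable (at x)"
proof -
  have "((\<lambda>x. c * character p x) has_derivative
      (\<lambda>h. c * (- 2 * complex_of_real pi * \<i> * complex_of_real (h \<bullet> p)) * character p x)) (at x)"
  proof -
    have "((\<lambda>x. - 2 * complex_of_real pi * \<i> * complex_of_real (x \<bullet> p)) has_derivative
        (\<lambda>h. - 2 * complex_of_real pi * \<i> * complex_of_real (h \<bullet> p))) (at x)"
      by (auto intro!: derivative_eq_intros)
    from has_derivative_mult_right[OF diff_chain_at[OF this DERIV_exp[unfolded has_field_derivative_def]], of c]
    show ?thesis unfolding character_def by (simp add: o_def ac_simps)
  qed
  then show "partial i (\<lambda>x. c * character p x) x = c * (- 2 * complex_of_real pi * \<i> * complex_of_real (i \<bullet> p)) * character p x"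
    "(\<lambda>x. c * character p x) differentiable (at x)"
    by (auto simp: partial_eqI differentiable_def)
qed

lemma character_measurable [measurable]: "character y \<in> borel_measurable borel"
  unfolding character_def by measurable

lemma integrable_character:
  assumes "integrable lborel g"
  shows "integrable lborel (\<lambda>x. g x * character y x)"
  by (rule Bochner_Integration.integrable_bound[OF assms]) (use assms in \<open>auto simp: norm_mult\<close>)

lemma norm_fourier_le: "norm (fourier \<phi> y) \<le> (LINT x|lborel. norm (\<phi> x))"
  using integral_norm_bound[of lborel "\<lambda>x. \<phi> x * character y x"]
  unfolding fourier_character by (simp add: norm_mult)

lemma coordinate_mult_schwartz:
  "\<phi> \<in> schwartz_space \<Longrightarrow> (\<lambda>x. c * complex_of_real (x \<bullet> v) * \<phi> x) \<in> schwartz_space"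
  using schwartz_cmult[OF schwartz_poly_mult[OF smooth_family_coordinate[of v]], of \<phi> c]
  by (simp add: mult.assoc)

text \<open>Differentiation under the integral with an explicit remainder: by
  \<open>character_second_order\<close> the error is at most the squared increment times a multiple
  of the second absolute moment \<open>K\<close>, which is finite because
  \<open>(x \<bullet> x) * \<phi> x\<close> is again Schwartz.\<close>

lemma fourier_has_derivative:
  fixes \<phi> :: "'a::euclidean_space \<Rightarrow> complex"
  assumes S: "\<phi> \<in> schwartz_space"
  shows "(fourier \<phi> has_derivative (\<lambda>h. \<Sum>i\<in>Basis. (h \<bullet> i) *\<^sub>R
    fourier (\<lambda>x. - 2 * complex_of_real pi * \<i> * complex_of_real (x \<bullet> i) * \<phi> x) y)) (at y)"
proof (rule has_derivativeI_sandwich[where e=1])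
  let ?c = "- 2 * complex_of_real pi * \<i>"
  let ?D = "\<lambda>h. \<Sum>i\<in>Basis. (h \<bullet> i) *\<^sub>R fourier (\<lambda>x. ?c * complex_of_real (x \<bullet> i) * \<phi> x) y"
  show "bounded_linear ?D"
    by (intro bounded_linear_sum bounded_linear_compose[OF bounded_linear_scaleR_left bounded_linear_inner_left])
  have S2: "(\<lambda>x. complex_of_real (x \<bullet> x) * \<phi> x) \<in> schwartz_space"
    by (rule schwartz_poly_mult[OF smooth_family_norm_square S])
  define K where "K = (LINT x|lborel. norm (complex_of_real (x \<bullet> x) * \<phi> x))"
  show "norm ((fourier \<phi> z - fourier \<phi> y) - ?D (z - y)) / norm (z - y) \<le> 2 * pi\<^sup>2 * K * norm (z - y)"
    if "z \<noteq> y" for z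
  proof -
    let ?h = "z - y"
    let ?k = "\<lambda>v x. (?c * complex_of_real (x \<bullet> v) * \<phi> x) * character y x"
    let ?E = "\<lambda>x. \<phi> x * character z x - \<phi> x * character y x - ?k ?h x"
    let ?M = "\<lambda>x. 2 * pi\<^sup>2 * (norm ?h)\<^sup>2 * norm (complex_of_real (x \<bullet> x) * \<phi> x)"
    have Dh: "?D ?h = (LINT x|lborel. ?k ?h x)"
    proof -
      have "(LINT x|lborel. ?k ?h x) =
        (LINT x|lborel. (\<Sum>i\<in>Basis. (?h \<bullet> i) *\<^sub>R (?k i x)))"
      proof (intro Bochner_Integration.integral_cong refl)
        fix x :: 'a
        have "complex_of_real (x \<bullet> ?h) = (\<Sum>i\<in>Basis. complex_of_real (?h \<bullet> i) * complex_of_real (x \<bullet> i))"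
          by (subst euclidean_inner) (simp add: mult.commute)
        then show "?k ?h x =
            (\<Sum>i\<in>Basis. (?h \<bullet> i) *\<^sub>R (?k i x))"
          by (simp add: sum_distrib_left sum_distrib_right scaleR_conv_of_real ac_simps)
      qed
      also have "\<dots> = (\<Sum>i\<in>Basis. (LINT x|lborel. (?h \<bullet> i) *\<^sub>R (?k i x)))"
        by (intro Bochner_Integration.integral_sum integrable_scaleR_right integrable_character
            schwartz_integrable coordinate_mult_schwartz S)
      finally show ?thesis unfolding fourier_character by simp
    qed
    have int: "integrable lborel (\<lambda>x. \<phi> x * character w x)" for w
      by (intro integrable_character schwartz_integrable S)
    have int': "integrable lborel (\<lambda>x. ?k ?h x)"
      by (intro integrable_character schwartz_integrable coordinate_mult_schwartz S)
    have "(fourier \<phi> z - fourier \<phi> y) - ?D ?h = (LINT x|lborel. ?E x)"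
      unfolding Dh unfolding fourier_character using int int' by simp
    also have "norm \<dots> \<le> (LINT x|lborel. ?M x)"
    proof (rule Bochner_Integration.integral_norm_bound_integral)
      show "integrable lborel (\<lambda>x. ?E x)"
        using int int' by simp
      show "integrable lborel (\<lambda>x. ?M x)"
        by (intro integrable_mult_right integrable_norm schwartz_integrable S2)
      fix x :: 'a
      have "norm (?E x) = norm (\<phi> x) * norm (character (y + ?h) x - character y x - character y x * (?c * complex_of_real (x \<bullet> ?h)))"
        unfolding norm_mult[symmetric] by (simp add: algebra_simps)
      also have "\<dots> \<le> norm (\<phi> x) * (2 * pi\<^sup>2 * (norm x)\<^sup>2 * (norm ?h)\<^sup>2)"
        by (intro mult_left_mono character_second_order) auto
      also have "\<dots> = ?M x"
        by (simp add: norm_mult power2_norm_eq_inner)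
      finally show "norm (?E x) \<le> ?M x" .
    qed
    also have "\<dots> = 2 * pi\<^sup>2 * (norm ?h)\<^sup>2 * K" unfolding K_def by simp
    finally show ?thesis using that by (simp add: divide_simps power2_eq_square ac_simps)
  qed
  show "((\<lambda>z. 2 * pi\<^sup>2 * K * norm (z - y)) \<longlongrightarrow> 0) (at y)"
    by (auto intro!: tendsto_eq_intros)
qed simp

lemma partial_fourier:
  assumes "\<phi> \<in> schwartz_space" "i \<in> Basis"
  shows "partial i (fourier \<phi>) = fourier (\<lambda>x. - 2 * complex_of_real pi * \<i> * complex_of_real (x \<bullet> i) * \<phi> x)"
  using assms(2)
  by (simp add: fun_eq_iff partial_eqI[OF fourier_has_derivative[OF assms(1)]] inner_Basis
      if_distrib[of "\<lambda>x. x *\<^sub>R _"] cong: if_cong)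

lemma fourier_translate:
  assumes "\<phi> \<in> schwartz_space"
  shows "fourier (\<lambda>x. \<phi> (x + v)) y = character y (- v) * fourier \<phi> y"
proof -
  have [measurable]: "\<phi> \<in> borel_measurable borel" using assms by measurable
  have "fourier (\<lambda>x. \<phi> (x + v)) y = (LINT x|lborel. \<phi> (v + 1 *\<^sub>R x) * character y ((v + 1 *\<^sub>R x) - v))"
    unfolding fourier_character by (simp add: add.commute)
  also have "\<dots> = (LINT x|lborel. \<phi> x * character y (x - v))"
    by (rule lborel_integral_reflect_translate[where g="\<lambda>x. \<phi> x * character y (x - v)"]) auto
  also have "\<dots> = (LINT x|lborel. character y (- v) * (\<phi> x * character y x))"
    by (simp add: ac_simps character_diff_right)
  finally show ?thesis unfolding fourier_character by simp
qed

text \<open>Convolving a transform with \<open>\<psi>\<close> thus means testing \<open>f\<close> on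
  one fixed Schwartz function times the character of \<open>t\<close>: the variable \<open>t\<close>
  enters by modulation only. Both directions of the theorem start from this.\<close>

lemma fourier_reflect:
  assumes "\<psi> \<in> schwartz_space"
  shows "fourier (\<lambda>x. \<psi> (t - x)) y = character t y * fourier \<psi> (- y)"
proof -
  have [measurable]: "\<psi> \<in> borel_measurable borel" using assms by measurable
  have "fourier (\<lambda>x. \<psi> (t - x)) y = (LINT x|lborel. \<psi> (t + (- 1) *\<^sub>R x) * character y (t - (t + (- 1) *\<^sub>R x)))"
    unfolding fourier_character by simp
  also have "\<dots> = (LINT x|lborel. \<psi> x * character y (t - x))"
    by (rule lborel_integral_reflect_translate[where g="\<lambda>x. \<psi> x * character y (t - x)"]) auto
  also have "\<dots> = (LINT x|lborel. character t y * (\<psi> x * character (- y) x))"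
    by (simp add: ac_simps character_minus character_commute[of t] character_diff_right)
  finally show ?thesis unfolding fourier_character by simp
qed

text \<open>In place of an integration by parts, the difference quotients of \<open>\<phi>\<close>
  along \<open>i\<close> are transformed. They are combinations of translates, whose transforms are
  explicit, and dominated convergence carries the limit through.\<close>

lemma fourier_partial:
  fixes \<phi> :: "'a::euclidean_space \<Rightarrow> complex"
  assumes S: "\<phi> \<in> schwartz_space" and i: "i \<in> Basis"
  shows "fourier (partial i \<phi>) y = 2 * complex_of_real pi * \<i> * complex_of_real (y \<bullet> i) * fourier \<phi> y"
proof -
  let ?c = "2 * complex_of_real pi * \<i> * complex_of_real (y \<bullet> i)"
  let ?N = "2 * DIM('a)"
  define \<epsilon> :: "nat \<Rightarrow> real" where "\<epsilon> k = 1 / real (Suc k)" for k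
  have eps: "\<epsilon> k > 0" "\<epsilon> k \<le> 1" for k unfolding \<epsilon>_def by auto
  have eps0: "\<epsilon> \<longlonglongrightarrow> 0" unfolding \<epsilon>_def using LIMSEQ_inverse_real_of_nat by (simp add: divide_inverse)
  have eps_at: "filterlim \<epsilon> (at 0) sequentially"
    using eps0 eps(1) by (auto simp: filterlim_at intro!: always_eventually) (metis less_irrefl)
  let ?q = "\<lambda>k x. (\<phi> (x + \<epsilon> k *\<^sub>R i) - \<phi> x) / complex_of_real (\<epsilon> k)"
  have meas [measurable]: "\<phi> \<in> borel_measurable borel" using S by measurable
  have lim1: "(\<lambda>k. ?q k x) \<longlonglongrightarrow> partial i \<phi> x" for x
  proof -
    have A: "((\<lambda>s. x + s *\<^sub>R i) has_derivative (\<lambda>s. s *\<^sub>R i)) (at (0::real))" by (auto intro!: derivative_eq_intros)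
    have B: "(\<phi> has_derivative frechet_derivative \<phi> (at x)) (at (x + 0 *\<^sub>R i))"
      using schwartz_differentiable[OF S, of x, unfolded frechet_derivative_works] by simp
    have lin: "linear (frechet_derivative \<phi> (at x))" using B has_derivative_linear by auto
    have "((\<lambda>s. \<phi> (x + s *\<^sub>R i)) has_vector_derivative partial i \<phi> x) (at 0)"
      unfolding has_vector_derivative_def partial_def using diff_chain_at[OF A B] by (simp add: o_def linear_scale[OF lin])
    then have N: "((\<lambda>s. norm (\<phi> (x + s *\<^sub>R i) - \<phi> x - s *\<^sub>R partial i \<phi> x) / norm s) \<longlongrightarrow> 0) (at 0)"
      unfolding has_vector_derivative_def has_derivative_iff_norm by simp
    have "((\<lambda>s. (\<phi> (x + s *\<^sub>R i) - \<phi> x) /\<^sub>R s) \<longlongrightarrow> partial i \<phi> x) (at 0)"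
    proof (rule LIM_zero_cancel, rule tendsto_norm_zero_cancel, rule Lim_transform_eventually[OF N])
      have "norm (\<phi> (x + s *\<^sub>R i) - \<phi> x - s *\<^sub>R partial i \<phi> x) / norm s =
          norm ((\<phi> (x + s *\<^sub>R i) - \<phi> x) /\<^sub>R s - partial i \<phi> x)" if "s \<noteq> 0" for s :: real
      proof -
        have "(\<phi> (x + s *\<^sub>R i) - \<phi> x) /\<^sub>R s - partial i \<phi> x = (\<phi> (x + s *\<^sub>R i) - \<phi> x - s *\<^sub>R partial i \<phi> x) /\<^sub>R s"
          using that by (simp add: scaleR_diff_right)
        then show ?thesis by (simp add: divide_inverse mult.commute)
      qed
      then show "\<forall>\<^sub>F s in at 0. norm (\<phi> (x + s *\<^sub>R i) - \<phi> x - s *\<^sub>R partial i \<phi> x) / norm s =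
          norm ((\<phi> (x + s *\<^sub>R i) - \<phi> x) /\<^sub>R s - partial i \<phi> x)"
        by (auto simp: eventually_at intro!: exI[of _ 1])
    qed
    from filterlim_compose[OF this eps_at] show ?thesis
      by (simp add: scaleR_conv_of_real divide_inverse mult.commute)
  qed
  define C where "C = 2 ^ ?N * schwartz_norm ?N 1 \<phi>"
  have C0: "C \<ge> 0" unfolding C_def using schwartz_norm_nonneg[OF S] by simp
  \<comment> \<open>Increments have length at most 1, so the segment stays in
    \<open>cball x 1\<close>, where \<open>1 + norm x \<le> 2 * (1 + norm z)\<close>. The derivative
    bound at \<open>z\<close> thus holds with the weight at \<open>x\<close>, up to
    \<open>2 ^ ?N\<close>.\<close>
  define W where "W x = real DIM('a) * (2 ^ ?N * C) * (1 / (1 + norm x) ^ ?N)" for x :: 'a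
  have qW: "norm (?q k x) \<le> W x" for k x
  proof -
    have "norm (\<phi> (x + \<epsilon> k *\<^sub>R i) - \<phi> x) \<le>
        real DIM('a) * (2 ^ ?N * C * (1 / (1 + norm x) ^ ?N)) * norm (x + \<epsilon> k *\<^sub>R i - x)"
    proof (rule mean_value_bound[where S="cball x 1"])
      fix z j :: 'a assume z: "z \<in> cball x 1" and j: "j \<in> Basis"
      have "norm x \<le> norm z + norm (x - z)" by (metis add.commute norm_triangle_sub)
      also have "\<dots> \<le> norm z + 1" using z by (simp add: dist_norm)
      also have "\<dots> \<le> 1 + 2 * norm z" using norm_ge_zero[of z] by (simp del: norm_ge_zero)
      finally have "1 + norm x \<le> 2 * (1 + norm z)" by simp
      then have "(1 + norm x) ^ ?N \<le> (2 * (1 + norm z)) ^ ?N" by (intro power_mono) auto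
      then have "(1 + norm x) ^ ?N * norm (partial j \<phi> z) \<le> (2 * (1 + norm z)) ^ ?N * norm (partial j \<phi> z)"
        by (rule mult_right_mono) simp
      also have "\<dots> = 2 ^ ?N * ((1 + norm z) ^ ?N * norm (partial j \<phi> z))"
        by (simp only: power_mult_distrib mult.assoc)
      also have "\<dots> \<le> 2 ^ ?N * C"
        unfolding C_def by (intro mult_left_mono schwartz_partial_bound S j) auto
      finally show "norm (partial j \<phi> z) \<le> 2 ^ ?N * C * (1 / (1 + norm x) ^ ?N)"
        by (subst mult_1_right[symmetric], subst times_divide_eq_right, subst pos_le_divide_eq)
           (auto simp: mult.commute add_pos_nonneg)
    qed (use schwartz_differentiable[OF S] i eps[of k] in \<open>auto simp: dist_norm\<close>)
    also have "\<dots> = W x * \<epsilon> k" unfolding W_def using i eps(1)[of k] by simp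
    finally have "norm (\<phi> (x + \<epsilon> k *\<^sub>R i) - \<phi> x) \<le> W x * \<epsilon> k" .
    then show ?thesis using eps(1)[of k] by (simp add: norm_divide pos_divide_le_eq)
  qed
  have "(\<lambda>k. fourier (?q k) y) \<longlonglongrightarrow> fourier (partial i \<phi>) y"
    unfolding fourier_character
  proof (rule integral_dominated_convergence[where w=W])
    show "integrable lborel W" unfolding W_def by (intro integrable_mult_right integrable_rapid_majorant)
    have "partial i \<phi> \<in> borel_measurable borel" by (intro schwartz_measurable schwartz_partial S i)
    then show "(\<lambda>x. partial i \<phi> x * character y x) \<in> borel_measurable lborel" by simp
    show "(\<lambda>x. ?q k x * character y x) \<in> borel_measurable lborel" for k by simp
    show "AE x in lborel. (\<lambda>k. ?q k x * character y x) \<longlonglongrightarrow> partial i \<phi> x * character y x"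
      using lim1 by (intro AE_I2 tendsto_mult_right)
    show "AE x in lborel. norm (?q k x * character y x) \<le> W x" for k
      unfolding norm_mult norm_character mult_1_right using qW by (rule AE_I2)
  qed
  moreover have "fourier (?q k) y = (character y (- (\<epsilon> k *\<^sub>R i)) - 1) / complex_of_real (\<epsilon> k) * fourier \<phi> y" for k
  proof -
    have S': "(\<lambda>x. \<phi> (x + \<epsilon> k *\<^sub>R i)) \<in> schwartz_space"
      using schwartz_affine[OF S, of 1 "\<epsilon> k *\<^sub>R i"] by simp
    have "fourier (?q k) y = (LINT x|lborel. (\<phi> (x + \<epsilon> k *\<^sub>R i) * character y x - \<phi> x * character y x) / complex_of_real (\<epsilon> k))"
      unfolding fourier_character by (simp add: algebra_simps)
    also have "\<dots> = (fourier (\<lambda>x. \<phi> (x + \<epsilon> k *\<^sub>R i)) y - fourier \<phi> y) / complex_of_real (\<epsilon> k)"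
      unfolding fourier_character
      using integrable_character[OF schwartz_integrable[OF S']] integrable_character[OF schwartz_integrable[OF S]] by simp
    finally show ?thesis unfolding fourier_translate[OF S] by (simp add: algebra_simps)
  qed
  moreover have "(\<lambda>k. (character y (- (\<epsilon> k *\<^sub>R i)) - 1) / complex_of_real (\<epsilon> k) * fourier \<phi> y) \<longlonglongrightarrow>
      ?c * fourier \<phi> y"
  proof (rule tendsto_mult_right, rule LIM_zero_cancel, rule Lim_null_comparison)
    show "\<forall>\<^sub>F k in sequentially. norm ((character y (- (\<epsilon> k *\<^sub>R i)) - 1) / complex_of_real (\<epsilon> k) -
        ?c) \<le> 2 * pi\<^sup>2 * (norm y)\<^sup>2 * \<epsilon> k"
    proof (intro always_eventually allI)
      fix k
      \<comment> \<open>Characters are symmetric in their two arguments, so the second-order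
        estimate applies at frequency 0 with increment \<open>- (\<epsilon> k *\<^sub>R i)\<close>
        and point \<open>y\<close>.\<close>
      have "(character y (- (\<epsilon> k *\<^sub>R i)) - 1) / complex_of_real (\<epsilon> k) - ?c =
        (character (0 + - (\<epsilon> k *\<^sub>R i)) y - character 0 y - character 0 y * (- 2 * complex_of_real pi * \<i> * complex_of_real (y \<bullet> (- (\<epsilon> k *\<^sub>R i))))) / complex_of_real (\<epsilon> k)"
        using eps(1)[of k] by (simp add: character_commute[of y] field_simps)
      also have "norm \<dots> \<le> 2 * pi\<^sup>2 * (norm y)\<^sup>2 * (norm (- (\<epsilon> k *\<^sub>R i)))\<^sup>2 / \<epsilon> k"
        unfolding norm_divide norm_of_real using eps(1)[of k]
        by (simp only: abs_of_pos) (intro divide_right_mono character_second_order, simp)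
      also have "\<dots> = 2 * pi\<^sup>2 * (norm y)\<^sup>2 * \<epsilon> k"
        using eps(1)[of k] i by (simp add: power2_eq_square)
      finally show "norm ((character y (- (\<epsilon> k *\<^sub>R i)) - 1) / complex_of_real (\<epsilon> k) -
        ?c) \<le> 2 * pi\<^sup>2 * (norm y)\<^sup>2 * \<epsilon> k" .
    qed
    show "(\<lambda>k. 2 * pi\<^sup>2 * (norm y)\<^sup>2 * \<epsilon> k) \<longlonglongrightarrow> 0" using tendsto_mult_left[OF eps0] by simp
  qed
  ultimately show ?thesis using LIMSEQ_unique by auto
qed

text \<open>Decay is gained one power at a time: \<open>norm y\<close> is at most the sum of the
  absolute coordinates, and a coordinate times the transform is, up to \<open>2 * pi\<close>, the
  transform of a partial derivative. The decay claim ranges over all Schwartz functions because its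
  induction step passes to \<open>partial i \<phi>\<close>. Smoothness follows since the class of
  transforms is closed under partial derivatives.\<close>

lemma fourier_schwartz:
  fixes \<phi> :: "'a::euclidean_space \<Rightarrow> complex"
  assumes "\<phi> \<in> schwartz_space"
  shows "fourier \<phi> \<in> schwartz_space"
proof -
  have dec: "\<exists>C. \<forall>y. (1 + norm y) ^ n * norm (fourier \<phi> y) \<le> C" if "\<phi> \<in> schwartz_space"
    for n and \<phi> :: "'a \<Rightarrow> complex"
    using that
  proof (induction n arbitrary: \<phi>)
    case 0
    then show ?case using norm_fourier_le by auto
  next
    case (Suc n)
    obtain C0 where C0: "\<And>y. (1 + norm y) ^ n * norm (fourier \<phi> y) \<le> C0" using Suc by blast
    have "\<exists>C. \<forall>y. (1 + norm y) ^ n * norm (fourier (partial i \<phi>) y) \<le> C" if "i \<in> Basis" for i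
      using Suc that schwartz_partial by blast
    then obtain C where C: "\<And>i y. i \<in> Basis \<Longrightarrow> (1 + norm y) ^ n * norm (fourier (partial i \<phi>) y) \<le> C i"
      by (metis (no_types))
    have "(1 + norm y) ^ Suc n * norm (fourier \<phi> y) \<le> C0 + (\<Sum>i\<in>Basis. C i)" for y
    proof -
      have "(1 + norm y) ^ Suc n * norm (fourier \<phi> y) =
        (1 + norm y) ^ n * norm (fourier \<phi> y) + norm y * ((1 + norm y) ^ n * norm (fourier \<phi> y))"
        by (simp add: algebra_simps)
      also have "\<dots> \<le> C0 + (\<Sum>i\<in>Basis. \<bar>y \<bullet> i\<bar>) * ((1 + norm y) ^ n * norm (fourier \<phi> y))"
        by (intro add_mono C0 mult_right_mono norm_le_l1) auto
      also have "\<dots> \<le> C0 + (\<Sum>i\<in>Basis. C i)"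
        unfolding sum_distrib_right
      proof (intro add_left_mono sum_mono)
        fix i :: 'a assume i: "i \<in> Basis"
        have "\<bar>y \<bullet> i\<bar> * norm (fourier \<phi> y) \<le> 2 * pi * (\<bar>y \<bullet> i\<bar> * norm (fourier \<phi> y))"
          using pi_gt3 mult_right_mono[of 1 "2 * pi" "\<bar>y \<bullet> i\<bar> * norm (fourier \<phi> y)"] by simp
        also have "\<dots> = norm (fourier (partial i \<phi>) y)"
          unfolding fourier_partial[OF Suc.prems i] by (simp add: norm_mult)
        finally have "(1 + norm y) ^ n * (\<bar>y \<bullet> i\<bar> * norm (fourier \<phi> y)) \<le> (1 + norm y) ^ n * norm (fourier (partial i \<phi>) y)"
          by (intro mult_left_mono) auto
        then have "\<bar>y \<bullet> i\<bar> * ((1 + norm y) ^ n * norm (fourier \<phi> y)) \<le> (1 + norm y) ^ n * norm (fourier (partial i \<phi>) y)"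
          by (simp only: mult.left_commute)
        then show "\<bar>y \<bullet> i\<bar> * ((1 + norm y) ^ n * norm (fourier \<phi> y)) \<le> C i" using C[OF i, of y] by linarith
      qed
      finally show ?thesis .
    qed
    then show ?case by blast
  qed
  have "smooth_family rapid (\<lambda>_::unit. fourier \<phi>)"
  proof (rule smooth_family_coinduct[where P="\<lambda>\<Phi>. \<exists>\<phi>\<in>schwartz_space. \<Phi> = (\<lambda>_. fourier \<phi>)"])
    show "\<Phi> j differentiable (at x)" if "\<exists>\<phi>\<in>schwartz_space. \<Phi> = (\<lambda>_. fourier \<phi>)" for \<Phi> and j :: unit and x :: 'a
      using that fourier_has_derivative unfolding differentiable_def by blast
    show "rapid \<Phi>" if "\<exists>\<phi>\<in>schwartz_space. \<Phi> = (\<lambda>_. fourier \<phi>)" for \<Phi> :: "unit \<Rightarrow> 'a \<Rightarrow> complex"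
      using that dec unfolding rapid_def by blast
    show "\<exists>\<phi>\<in>schwartz_space. (\<lambda>j. partial i (\<Phi> j)) = (\<lambda>_. fourier \<phi>)"
      if "\<exists>\<phi>\<in>schwartz_space. \<Phi> = (\<lambda>_. fourier \<phi>)" and i: "i \<in> Basis" for \<Phi> :: "unit \<Rightarrow> 'a \<Rightarrow> complex" and i
      using that(1) partial_fourier[OF _ i] coordinate_mult_schwartz by fastforce
  qed (use assms in auto)
  then show ?thesis unfolding schwartz_iff .
qed

text \<open>The transform is determined by the equation \<open>partial i g y = - 2 * pi * (y \<bullet> i) * g y\<close>, which the Gaussian and its
  Fourier transform share.\<close>

lemma fourier_gauss:
  obtains c where "c > 0" "\<And>y::'a::euclidean_space. fourier gauss y = of_real (c * exp (- pi * (y \<bullet> y)))"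
proof -
  let ?g = "gauss :: 'a \<Rightarrow> complex"
  have pg: "partial i ?g = (\<lambda>x. - 2 * complex_of_real pi * complex_of_real (x \<bullet> i) * ?g x)" for i
  proof
    fix x :: 'a
    have "(?g has_derivative (\<lambda>h. of_real (exp (- pi * (x \<bullet> x)) * (- pi * (2 * (x \<bullet> h)))))) (at x)"
      unfolding gauss_def[abs_def] by (auto intro!: derivative_eq_intros simp: inner_commute)
    from partial_eqI[OF this] show "partial i ?g x = - 2 * complex_of_real pi * complex_of_real (x \<bullet> i) * ?g x"
      by (simp add: gauss_def)
  qed
  have d: "partial i (fourier ?g) y = - 2 * complex_of_real pi * complex_of_real (y \<bullet> i) * fourier ?g y" if i: "i \<in> Basis" for i y
  proof -
    have "partial i (fourier ?g) y = fourier (\<lambda>x. \<i> * partial i ?g x) y"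
      unfolding partial_fourier[OF gauss_schwartz i] pg by (simp add: ac_simps)
    also have "\<dots> = \<i> * fourier (partial i ?g) y" unfolding fourier_character by (simp add: mult.assoc)
    also have "\<dots> = - 2 * complex_of_real pi * complex_of_real (y \<bullet> i) * fourier ?g y"
      unfolding fourier_partial[OF gauss_schwartz i] by (simp add: algebra_simps)
    finally show ?thesis .
  qed
  \<comment> \<open>The quotient of the transform by the Gaussian; the shared differential equation
    makes its derivative vanish.\<close>
  define G where "G y = fourier ?g y * of_real (exp (pi * (y \<bullet> y)))" for y
  have "(G has_derivative (\<lambda>h. 0)) (at y within UNIV)" for y
  proof -
    have 1: "(fourier ?g has_derivative (\<lambda>h. - 2 * complex_of_real pi * complex_of_real (h \<bullet> y) * fourier ?g y)) (at y)"
    proof -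
      have "(\<Sum>i\<in>Basis. (h \<bullet> i) *\<^sub>R partial i (fourier ?g) y) = - 2 * complex_of_real pi * complex_of_real (h \<bullet> y) * fourier ?g y" for h
      proof -
        have "complex_of_real (h \<bullet> y) = (\<Sum>i\<in>Basis. complex_of_real (h \<bullet> i) * complex_of_real (y \<bullet> i))"
          by (subst euclidean_inner) simp
        then show ?thesis
          by (simp add: d sum_distrib_left sum_distrib_right scaleR_conv_of_real ac_simps sum_negf)
      qed
      then show ?thesis
        using has_derivative_partial[OF schwartz_differentiable[OF fourier_schwartz[OF gauss_schwartz]], of y] by simp
    qed
    have 2: "((\<lambda>y. complex_of_real (exp (pi * (y \<bullet> y)))) has_derivative (\<lambda>h. of_real (exp (pi * (y \<bullet> y)) * (pi * (2 * (h \<bullet> y)))))) (at y)"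
      by (auto intro!: derivative_eq_intros simp: inner_commute)
    show ?thesis unfolding G_def[abs_def] using has_derivative_mult[OF 1 2] by (simp add: algebra_simps)
  qed
  then have G: "G y = G 0" for y
    by (intro has_derivative_zero_unique[of UNIV G]) auto
  define c where "c = (LINT x::'a|lborel. exp (- pi * (x \<bullet> x)))"
  have int: "integrable lborel (\<lambda>x::'a. exp (- pi * (x \<bullet> x)))"
    using schwartz_integrable[OF gauss_schwartz, where 'a='a] unfolding gauss_def[abs_def] complex_of_real_integrable_eq .
  \<comment> \<open>The integrand is strictly positive, so a vanishing integral would make the whole
    space a null set.\<close>
  have "c \<noteq> 0"
  proof
    assume "c = 0"
    then have "AE x::'a in lborel. exp (- pi * (x \<bullet> x)) = 0"
      unfolding c_def by (subst (asm) integral_nonneg_eq_0_iff_AE[OF int]) auto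
    then have "AE x::'a in lborel. False" by simp
    then show False by (simp add: AE_iff_null null_sets_def)
  qed
  moreover have "c \<ge> 0" unfolding c_def by (intro Bochner_Integration.integral_nonneg) auto
  moreover have "G 0 = of_real c"
    unfolding G_def fourier_character c_def gauss_def by simp
  then have "fourier ?g y = of_real (c * exp (- pi * (y \<bullet> y)))" for y
    using G[of y] unfolding G_def[of y] by (simp add: exp_minus field_simps)
  ultimately show thesis using that[of c] by simp
qed

section \<open>Point masses of temperate measures\<close>

lemma complex_radon_measureD:
  fixes B :: "nat \<Rightarrow> 'a::euclidean_space set"
  assumes "complex_radon_measure \<mu>" "\<And>i. B i \<in> sets borel" "disjoint_family B" "bounded (\<Union>i. B i)"
  shows "(\<lambda>i. \<mu> (B i)) sums \<mu> (\<Union>i. B i)"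
  using assms unfolding complex_radon_measure_def by (metis image_subsetI)

lemma complex_radon_measure_empty:
  assumes "complex_radon_measure \<mu>"
  shows "\<mu> {} = 0"
proof -
  have "(\<lambda>i::nat. \<mu> {}) sums \<mu> {}"
    using complex_radon_measureD[OF assms, of "\<lambda>_. {}"] by (simp add: disjoint_family_on_def)
  then have "(\<lambda>i::nat. \<mu> {}) \<longlonglongrightarrow> 0" using sums_summable summable_LIMSEQ_zero by blast
  then show ?thesis by (simp add: LIMSEQ_const_iff)
qed

lemma complex_radon_measure_Un:
  assumes mu: "complex_radon_measure \<mu>" and "A \<in> sets borel" "B \<in> sets borel" "A \<inter> B = {}" "bounded A" "bounded B"
  shows "\<mu> (A \<union> B) = \<mu> A + \<mu> B"
proof -
  have d: "disjoint_family (binaryset A B)"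
    using assms(4) by (simp add: disjoint_family_on_def binaryset_def Int_commute)
  have b: "binaryset A B i \<in> sets borel" for i using assms(2,3) by (simp add: binaryset_def)
  have "(\<lambda>i. \<mu> (binaryset A B i)) sums \<mu> (A \<union> B)"
    using complex_radon_measureD[OF mu b d] assms(5,6) by (simp add: UN_binaryset_eq)
  moreover have "(\<lambda>i. \<mu> (binaryset A B i)) sums (\<mu> A + \<mu> B)"
    unfolding sums_def by (rule LIMSEQ_binaryset) (rule complex_radon_measure_empty[OF mu])
  ultimately show ?thesis by (rule sums_unique2)
qed

text \<open>Off the support every point has an open null neighbourhood, but countable additivity
  handles only countably many of them. The Lindelof property supplies a countable subcover, and
  \<open>disjointed\<close> makes its pieces disjoint.\<close>

lemma complex_radon_measure_null:
  fixes \<mu> :: "'a::euclidean_space set \<Rightarrow> complex"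
  assumes mu: "complex_radon_measure \<mu>" and B: "B \<in> sets borel" "bounded B" "B \<inter> cmeasure_support \<mu> = {}"
  shows "\<mu> B = 0"
proof -
  define \<U> where "\<U> = {U. open U \<and> (\<forall>B'\<in>sets borel. bounded B' \<longrightarrow> B' \<subseteq> U \<longrightarrow> \<mu> B' = 0)}"
  obtain \<V> where V: "\<V> \<subseteq> \<U>" "countable \<V>" "\<Union>\<V> = \<Union>\<U>"
    using Lindelof[of \<U>] unfolding \<U>_def by blast
  have "B \<subseteq> \<Union>\<U>"
  proof
    fix x assume "x \<in> B"
    then have "x \<notin> cmeasure_support \<mu>" using B(3) by blast
    then show "x \<in> \<Union>\<U>" unfolding cmeasure_support_def \<U>_def by blast
  qed
  then have BV: "B \<subseteq> \<Union>\<V>" using V(3) by simp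
  show ?thesis
  proof (cases "\<V> = {}")
    case True
    then show ?thesis using BV complex_radon_measure_empty[OF mu] by auto
  next
    case False
    define U where "U = from_nat_into \<V>"
    have U: "U n \<in> \<U>" for n unfolding U_def using from_nat_into[OF False] V(1) by blast
    have range: "range U = \<V>" unfolding U_def by (rule range_from_nat_into[OF False V(2)])
    have Ub: "U n \<in> sets borel" for n using U unfolding \<U>_def by auto
    have db: "disjointed U n \<in> sets borel" for n
      using sets.range_disjointed_sets[of U borel] Ub by auto
    have s: "(\<lambda>n. \<mu> (B \<inter> disjointed U n)) sums \<mu> (\<Union>n. B \<inter> disjointed U n)"
    proof (rule complex_radon_measureD[OF mu])
      show "B \<inter> disjointed U n \<in> sets borel" for n using B(1) db by auto
      show "disjoint_family (\<lambda>n. B \<inter> disjointed U n)"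
        using disjoint_family_disjointed[of U] unfolding disjoint_family_on_def by blast
      show "bounded (\<Union>n. B \<inter> disjointed U n)" using B(2) by (rule bounded_subset) auto
    qed
    have "(\<Union>n. B \<inter> disjointed U n) = B"
      using BV range UN_disjointed_eq[of U] by blast
    moreover have "\<mu> (B \<inter> disjointed U n) = 0" for n
    proof -
      have "B \<inter> disjointed U n \<subseteq> U n" using disjointed_subset[of U n] by blast
      moreover have "bounded (B \<inter> disjointed U n)" using B(2) by (rule bounded_subset) auto
      moreover have "B \<inter> disjointed U n \<in> sets borel" using B(1) db by auto
      ultimately show ?thesis using U[of n] unfolding \<U>_def by blast
    qed
    ultimately show ?thesis using s by (simp add: sums_unique2[OF _ sums_zero])
  qed
qed

lemma locally_finite_bounded: "locally_finite_set A \<Longrightarrow> bounded B \<Longrightarrow> finite (A \<inter> B)"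
  unfolding locally_finite_set_def by (metis Int_mono bounded_subset_ballD finite_subset order_refl)

text \<open>A bounded set meets \<open>A\<close> in finitely many points; what remains of it misses
  the support and is null.\<close>

lemma complex_radon_measure_atoms:
  assumes mu: "complex_radon_measure \<mu>" and supp: "cmeasure_support \<mu> \<subseteq> A" and A: "locally_finite_set A"
    and B: "B \<in> sets borel" "bounded B"
  shows "\<mu> B = (\<Sum>a\<in>A \<inter> B. \<mu> {a})"
proof -
  have fin: "finite (A \<inter> B)" by (rule locally_finite_bounded[OF A B(2)])
  have finB: "F \<in> sets borel" if "finite F" for F :: "'a set" using that by (simp add: finite_imp_closed)
  have *: "\<mu> F = (\<Sum>a\<in>F. \<mu> {a})" if "finite F" for F
    using that
  proof induction
    case empty then show ?case using complex_radon_measure_empty[OF mu] by simp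
  next
    case (insert a F)
    then show ?case
      using complex_radon_measure_Un[OF mu, of "{a}" F] finB[of F] by (simp add: finite_imp_bounded)
  qed
  have "\<mu> B = \<mu> ((A \<inter> B) \<union> (B - (A \<inter> B)))" by (rule arg_cong[where f=\<mu>]) auto
  also have "\<dots> = \<mu> (A \<inter> B) + \<mu> (B - (A \<inter> B))"
    using B fin finB[OF fin] by (intro complex_radon_measure_Un[OF mu]) (auto intro: bounded_subset)
  also have "\<mu> (B - (A \<inter> B)) = 0"
    using B finB[OF fin] supp by (intro complex_radon_measure_null[OF mu]) (auto intro: bounded_subset)
  finally show ?thesis using *[OF fin] by simp
qed

text \<open>The approximating simple functions vanish outside one bounded set, so their integrals
  are sums over one finite set of atoms and converge termwise. \<open>F\<close> stems from the
  approximation, which is why it may exceed the atoms where \<open>\<phi>\<close> is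
  nonzero.\<close>

lemma cmeasure_has_integral_atoms:
  assumes mu: "complex_radon_measure \<mu>" and supp: "cmeasure_support \<mu> \<subseteq> A" and A: "locally_finite_set A"
    and I: "cmeasure_has_integral \<mu> \<phi> I"
  obtains F where "finite F" "F \<subseteq> A" "A \<inter> {x. \<phi> x \<noteq> 0} \<subseteq> F" "I = (\<Sum>a\<in>F. \<mu> {a} * \<phi> a)"
proof -
  obtain s where s: "\<And>n. simple_function borel (s n)" "bounded (\<Union>n. {x. s n x \<noteq> 0})"
      "uniform_limit UNIV s \<phi> sequentially"
      "(\<lambda>n. \<Sum>z\<in>range (s n) - {0}. z * \<mu> (s n -` {z})) \<longlonglongrightarrow> I"
    using I unfolding cmeasure_has_integral_def by blast
  define F where "F = A \<inter> (\<Union>n. {x. s n x \<noteq> 0})"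
  have fin: "finite F" unfolding F_def by (rule locally_finite_bounded[OF A s(2)])
  have lim: "(\<lambda>n. s n x) \<longlonglongrightarrow> \<phi> x" for x using tendsto_uniform_limitI[OF s(3)] by simp
  have "(\<Sum>z\<in>range (s n) - {0}. z * \<mu> (s n -` {z})) = (\<Sum>a\<in>F. \<mu> {a} * s n a)" for n
  proof -
    let ?G = "{a \<in> F. s n a \<noteq> 0}"
    have finr: "finite (range (s n))" using simple_functionD(1)[OF s(1), of n] by simp
    have "z * \<mu> (s n -` {z}) = (\<Sum>a\<in>{a \<in> ?G. s n a = z}. \<mu> {a} * s n a)" if z: "z \<in> range (s n) - {0}" for z
    proof -
      have "\<mu> (s n -` {z}) = (\<Sum>a\<in>A \<inter> (s n -` {z}). \<mu> {a})"
      proof (rule complex_radon_measure_atoms[OF mu supp A])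
        show "s n -` {z} \<in> sets borel" using simple_functionD(2)[OF s(1), of n "{z}"] by simp
        show "bounded (s n -` {z})" using s(2) by (rule bounded_subset) (use z in \<open>auto intro!: exI[of _ n]\<close>)
      qed
      moreover have "A \<inter> (s n -` {z}) = {a \<in> ?G. s n a = z}" using z unfolding F_def by (auto intro!: exI[of _ n])
      ultimately show ?thesis by (simp add: sum_distrib_left mult.commute)
    qed
    then have "(\<Sum>z\<in>range (s n) - {0}. z * \<mu> (s n -` {z})) =
      (\<Sum>z\<in>range (s n) - {0}. \<Sum>a\<in>{a \<in> ?G. s n a = z}. \<mu> {a} * s n a)" by simp
    also have "\<dots> = (\<Sum>a\<in>?G. \<mu> {a} * s n a)"
      by (rule sum.group) (use fin finr in auto)
    also have "\<dots> = (\<Sum>a\<in>F. \<mu> {a} * s n a)"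
      by (rule sum.mono_neutral_left) (use fin in auto)
    finally show ?thesis .
  qed
  then have "(\<lambda>n. \<Sum>a\<in>F. \<mu> {a} * s n a) \<longlonglongrightarrow> I" using s(4) by simp
  moreover have "(\<lambda>n. \<Sum>a\<in>F. \<mu> {a} * s n a) \<longlonglongrightarrow> (\<Sum>a\<in>F. \<mu> {a} * \<phi> a)"
    by (intro tendsto_sum tendsto_mult_left lim)
  ultimately have "I = (\<Sum>a\<in>F. \<mu> {a} * \<phi> a)" by (rule LIMSEQ_unique)
  moreover have "A \<inter> {x. \<phi> x \<noteq> 0} \<subseteq> F"
  proof
    fix x assume x: "x \<in> A \<inter> {x. \<phi> x \<noteq> 0}"
    have "\<exists>n. s n x \<noteq> 0"
    proof (rule ccontr)
      assume "\<nexists>n. s n x \<noteq> 0"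
      then have "(\<lambda>n. s n x) \<longlonglongrightarrow> 0" by simp
      then show False using lim[of x] LIMSEQ_unique x by blast
    qed
    then show "x \<in> F" unfolding F_def using x by blast
  qed
  ultimately show thesis using that[of F] fin unfolding F_def by blast
qed

section \<open>Disjoint bumps and summability of the masses\<close>

lemma iter_deriv_sum:
  assumes "finite F" "\<And>a. a \<in> F \<Longrightarrow> \<phi> a \<in> schwartz_space" "set vs \<subseteq> Basis"
  shows "(\<lambda>x. \<Sum>a\<in>F. c a * \<phi> a x) \<in> schwartz_space \<and>
    iter_deriv vs (\<lambda>x. \<Sum>a\<in>F. c a * \<phi> a x) x = (\<Sum>a\<in>F. c a * iter_deriv vs (\<phi> a) x)"
  using assms(1,2)
proof (induction F rule: finite_induct)
  case empty
  show ?case using iter_deriv_eq_0[of UNIV "\<lambda>_. 0"] by auto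
next
  case (insert a F)
  then show ?case
    using schwartz_lincomb[of "\<phi> a" "\<lambda>x. \<Sum>a\<in>F. c a * \<phi> a x" "c a" 1]
      iter_deriv_lincomb[OF schwartz_smooth schwartz_smooth assms(3), of "\<phi> a" "\<lambda>x. \<Sum>a\<in>F. c a * \<phi> a x" "c a" 1] by simp
qed

text \<open>Turns the condition on pairs into one radius per point. Points whose balls meet have
  comparable norms, hence comparable radii, and the sum of these radii falls below the guaranteed
  distance.\<close>

lemma p_discrete_separated_balls:
  fixes A :: "'a::euclidean_space set"
  assumes "p_discrete A"
  obtains D :: real and H :: nat where "D \<ge> 1"
    "\<And>a a'. a \<in> A \<Longrightarrow> a' \<in> A \<Longrightarrow> a \<noteq> a' \<Longrightarrow>
      cball a (1 / (D * (1 + norm a) ^ H)) \<inter> cball a' (1 / (D * (1 + norm a') ^ H)) = {}"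
proof -
  obtain c h where c: "c > 0" and h: "h > 0" and sep: "\<And>a a'. a \<in> A \<Longrightarrow> a' \<in> A \<Longrightarrow> a \<noteq> a' \<Longrightarrow>
      norm (a - a') \<ge> c / Max {1, norm a powr h, norm a' powr h}"
    using assms unfolding p_discrete_def by blast
  define H where "H = nat \<lceil>h\<rceil>"
  have powr: "t powr h \<le> (1 + t) ^ H" if "t \<ge> 0" for t :: real
  proof -
    have "t powr h \<le> (1 + t) powr h" using that h by (intro powr_mono2) auto
    also have "\<dots> \<le> (1 + t) powr real H" using that h unfolding H_def by (intro powr_mono) (auto simp: of_nat_ceiling)
    finally show ?thesis using that by (simp add: powr_realpow)
  qed
  \<comment> \<open>If two balls meet and \<open>norm a' \<le> norm a\<close>, then
    \<open>1 + norm a \<le> 3 * (1 + norm a')\<close>, and both radii are at most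
    \<open>3 ^ H / (D * (1 + norm a) ^ H)\<close>. The leading 3 exceeds the 2 from adding two
    radii, which gives the contradiction; the maximum with 1 keeps the radii at most 1.\<close>
  define D where "D = max 1 (3 * 3 ^ H / c)"
  have D: "D \<ge> 1" "3 * 3 ^ H / c \<le> D" unfolding D_def by auto
  have main: "cball a (1 / (D * (1 + norm a) ^ H)) \<inter> cball a' (1 / (D * (1 + norm a') ^ H)) = {}"
    if a: "a \<in> A" "a' \<in> A" "a \<noteq> a'" and le: "norm a' \<le> norm a" for a a'
  proof (rule ccontr)
    let ?r = "1 / (D * (1 + norm a) ^ H)" and ?r' = "1 / (D * (1 + norm a') ^ H)"
    assume "cball a ?r \<inter> cball a' ?r' \<noteq> {}"
    then obtain z where "dist a z \<le> ?r" "dist a' z \<le> ?r'" by auto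
    then have d: "norm (a - a') \<le> ?r + ?r'"
      using dist_triangle2[of a a' z] by (simp add: dist_norm)
    have p1: "(1 + norm a) ^ H \<ge> 1" "(1 + norm a') ^ H \<ge> 1" by (auto intro: one_le_power)
    have r': "?r' \<le> 1" using D(1) p1 mult_mono[of 1 D 1 "(1 + norm a') ^ H"] by (simp add: divide_le_eq)
    have rr': "?r \<le> ?r'"
      using D(1) le by (intro divide_left_mono mult_left_mono power_mono mult_pos_pos zero_less_power) (auto intro: add_pos_nonneg)
    have "norm a \<le> norm a' + norm (a - a')" by (metis add.commute norm_triangle_sub)
    also have "\<dots> \<le> norm a' + (1 + 1)" using d rr' r' by linarith
    also have "\<dots> \<le> 2 + 3 * norm a'" by simp
    finally have *: "1 + norm a \<le> 3 * (1 + norm a')" by simp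
    have aux: "1 / Q \<le> T / P" if "P \<ge> 1" "Q \<ge> 1" "P \<le> T * Q" for P Q T :: real
      using that by (simp add: field_simps)
    have **: "(1 + norm a) ^ H \<le> 3 ^ H * (1 + norm a') ^ H"
      unfolding power_mult_distrib[symmetric] using *  by (rule power_mono) simp
    have "1 / (1 + norm a') ^ H \<le> 3 ^ H / (1 + norm a) ^ H"
      using p1 by (intro aux **)
    then have "?r' \<le> 3 ^ H / (1 + norm a) ^ H / D"
      using D(1) divide_right_mono[of "1 / (1 + norm a') ^ H" "3 ^ H / (1 + norm a) ^ H" D] by (simp add: mult.commute)
    then have up: "norm (a - a') \<le> 2 * (3 ^ H / (1 + norm a) ^ H / D)" using d rr' by linarith
    have "Max {1, norm a powr h, norm a' powr h} \<le> (1 + norm a) ^ H"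
      using p1 powr[of "norm a"] powr_mono2[of h "norm a'" "norm a"] h le by simp
    then have "c / (1 + norm a) ^ H \<le> c / Max {1, norm a powr h, norm a' powr h}"
      using c less_le_trans[OF zero_less_one p1(1)] by (intro divide_left_mono mult_pos_pos) (auto simp: less_max_iff_disj)
    also have "\<dots> \<le> norm (a - a')" by (rule sep[OF a])
    finally have "c / (1 + norm a) ^ H \<le> 2 * (3 ^ H / (1 + norm a) ^ H / D)" using up by linarith
    moreover have "1 + norm a \<noteq> 0" using norm_ge_zero[of a] by linarith
    ultimately have "c * D \<le> 2 * 3 ^ H" using p1 D(1) by (simp add: divide_simps split: if_splits)
    moreover have "3 * 3 ^ H \<le> c * D" using D(2) c by (simp add: divide_le_eq mult.commute)
    moreover have "(3::real) ^ H > 0" by simp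
    ultimately show False by linarith
  qed
  show thesis
  proof (rule that[of D H])
    fix a a' assume "a \<in> A" "a' \<in> A" "a \<noteq> a'"
    then show "cball a (1 / (D * (1 + norm a) ^ H)) \<inter> cball a' (1 / (D * (1 + norm a') ^ H)) = {}"
      using main[of a a'] main[of a' a] by (cases "norm a' \<le> norm a") auto
  qed (rule D(1))
qed

text \<open>The supports of the bumps are disjoint, so the Schwartz norm of a finite signed sum of bumps is the
  maximum of their norms. This replaces a count of the points of \<open>A\<close> in a ball.\<close>

lemma temperate_measure_atoms_summable:
  fixes A :: "'a::euclidean_space set"
  assumes mu: "temperate_measure \<mu> f" and supp: "cmeasure_support \<mu> \<subseteq> A" and A: "locally_finite_set A"
    and p: "p_discrete A"
  obtains q where "(\<lambda>a. norm (\<mu> {a}) / (1 + norm a) ^ q) summable_on A"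
proof -
  have rad: "complex_radon_measure \<mu>" and f: "temperate_distribution f"
    and int: "\<And>\<phi>. smooth \<phi> \<Longrightarrow> compact (closure {x. \<phi> x \<noteq> 0}) \<Longrightarrow> cmeasure_has_integral \<mu> \<phi> (f \<phi>)"
    using mu unfolding temperate_measure_def by auto
  obtain D H where D: "D \<ge> 1" and disj: "\<And>a a'. a \<in> A \<Longrightarrow> a' \<in> A \<Longrightarrow> a \<noteq> a' \<Longrightarrow>
      cball a (1 / (D * (1 + norm a) ^ H)) \<inter> cball a' (1 / (D * (1 + norm a') ^ H)) = {}"
    using p_discrete_separated_balls[OF p] by metis
  obtain n m C where C: "C > 0" "\<And>\<phi>. \<phi> \<in> schwartz_space \<Longrightarrow> norm (f \<phi>) \<le> C * (1 + schwartz_norm n m \<phi>)"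
    using temperate_distribution_bound[OF f] by metis
  obtain b :: "'a \<Rightarrow> complex" where b: "smooth b" "b 0 = 1" "\<And>x. norm x \<ge> 1 \<Longrightarrow> b x = 0"
    using smooth_bump_exists by blast
  have bS: "b \<in> schwartz_space" by (rule smooth_compact_support_schwartz[OF b(1,3)])
  define Kb where "Kb = schwartz_norm 0 m b"
  have Kb0: "Kb \<ge> 0" unfolding Kb_def by (rule schwartz_norm_nonneg[OF bS])
  define r where "r a = D * (1 + norm a) ^ H" for a :: 'a
  have r1: "r a \<ge> 1" for a unfolding r_def using D mult_mono[of 1 D 1 "(1 + norm a) ^ H"] by simp
  define \<phi> where "\<phi> a = (\<lambda>x. b (r a *\<^sub>R x + (- (r a *\<^sub>R a))))" for a
  let ?t = "\<lambda>a x. r a *\<^sub>R x + (- (r a *\<^sub>R a))" and ?B = "\<lambda>a. cball a (1 / r a)"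
  have arg: "norm (?t a x) = r a * dist a x" for a x
    using r1[of a] by (simp add: scaleR_diff_right[symmetric] dist_norm norm_minus_commute)
  have out: "norm (?t a x) > 1" if "x \<notin> ?B a" for a x
    unfolding arg using that r1[of a] by (simp add: divide_less_eq not_le mult.commute)
  have phi_out: "iter_deriv vs (\<phi> a) x = 0" if "x \<notin> ?B a" for a x vs
  proof (rule iter_deriv_eq_0[of "- ?B a"])
    show "\<phi> a x = 0" if "x \<in> - ?B a" for x
      unfolding \<phi>_def using out[of x a] that by (intro b(3)) simp
  qed (use that in \<open>auto simp: open_Compl\<close>)
  have phiS: "\<phi> a \<in> schwartz_space" for a
    unfolding \<phi>_def using r1[of a] by (intro schwartz_affine bS) auto
  \<comment> \<open>The bump is 1 at its centre, and its ball contains no other point of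
    \<open>A\<close>, so the test sees a single atom.\<close>
  have phi_f: "f (\<phi> a) = \<mu> {a}" if a: "a \<in> A" for a
  proof -
    have "{x. \<phi> a x \<noteq> 0} \<subseteq> ?B a"
      using phi_out[of _ a "[]"] by (metis (mono_tags) iter_deriv.simps(1) mem_Collect_eq subsetI)
    then have "compact (closure {x. \<phi> a x \<noteq> 0})"
      using bounded_cball bounded_subset compact_closure by blast
    then have "cmeasure_has_integral \<mu> (\<phi> a) (f (\<phi> a))"
      by (intro int schwartz_smooth phiS)
    then obtain F where F: "finite F" "F \<subseteq> A" "A \<inter> {x. \<phi> a x \<noteq> 0} \<subseteq> F" "f (\<phi> a) = (\<Sum>a'\<in>F. \<mu> {a'} * \<phi> a a')"
      using cmeasure_has_integral_atoms[OF rad supp A] by metis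
    have aa: "\<phi> a a = 1" unfolding \<phi>_def using b(2) by simp
    have "\<phi> a a' = 0" if "a' \<in> F" "a' \<noteq> a" for a'
    proof -
      have "a' \<in> ?B a'" using r1[of a'] by simp
      then have "a' \<notin> ?B a" using disj[of a a'] a that F(2) unfolding r_def by blast
      then show ?thesis using phi_out[of a' a "[]"] by simp
    qed
    then have "f (\<phi> a) = (\<Sum>a'\<in>F. if a' = a then \<mu> {a} else 0)"
      unfolding F(4) by (intro sum.cong) (auto simp: aa)
    also have "\<dots> = \<mu> {a}" using F(1,3) aa a by (auto simp: sum.delta)
    finally show ?thesis .
  qed
  \<comment> \<open>The weight of order \<open>n\<close> costs \<open>(1 + norm a) ^ n\<close>; each
    of the at most \<open>m\<close> derivatives of a bump costs a factor \<open>r a\<close>, of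
    degree \<open>H\<close>.\<close>
  define q where "q = n + H * m"
  \<comment> \<open>The conjugate signs rotate all masses to their absolute values, so that
    \<open>f\<close> of the combination is a sum without cancellation.\<close>
  define c where "c a = cnj (sgn (\<mu> {a})) / of_real ((1 + norm a) ^ q)" for a
  have c1: "c a * \<mu> {a} = of_real (norm (\<mu> {a}) / (1 + norm a) ^ q)" for a
  proof -
    have "cnj (sgn (\<mu> {a})) * \<mu> {a} = of_real (norm (\<mu> {a}))"
      unfolding sgn_eq by (simp add: complex_norm_square[symmetric] mult.commute power2_eq_square)
    then show ?thesis unfolding c_def by simp
  qed
  have c2: "norm (c a) \<le> 1 / (1 + norm a) ^ q" for a
    unfolding c_def by (simp add: norm_divide norm_sgn norm_power del: of_real_power)
  define K where "K = 2 ^ n * D ^ m * Kb"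
  have "sum (\<lambda>a. norm (\<mu> {a}) / (1 + norm a) ^ q) F \<le> C * (1 + K)" if F: "finite F" "F \<subseteq> A" for F
  proof -
    let ?\<Psi> = "\<lambda>x. \<Sum>a\<in>F. c a * \<phi> a x"
    have S: "?\<Psi> \<in> schwartz_space" using temperate_distribution_sum[OF f F(1), of \<phi> c] phiS by blast
    have "schwartz_norm n m ?\<Psi> \<le> K"
    proof (rule schwartz_norm_least)
      fix x and vs :: "'a list" assume vs: "set vs \<subseteq> Basis" "length vs \<le> m"
      have eq: "iter_deriv vs ?\<Psi> x = (\<Sum>a\<in>F. c a * iter_deriv vs (\<phi> a) x)"
        using iter_deriv_sum[OF F(1) _ vs(1), of \<phi> c] phiS by blast
      show "max 1 (norm x ^ n) * norm (iter_deriv vs ?\<Psi> x) \<le> K"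
      proof (cases "\<exists>a\<in>F. x \<in> ?B a")
        case False
        then have "iter_deriv vs ?\<Psi> x = 0" unfolding eq using phi_out by (intro sum.neutral) auto
        then show ?thesis unfolding K_def using Kb0 D by simp
      next
        case True
        then obtain a where a: "a \<in> F" "x \<in> ?B a" by blast
        have "iter_deriv vs (\<phi> a') x = 0" if "a' \<in> F" "a' \<noteq> a" for a'
        proof (rule phi_out)
          have "?B a \<inter> ?B a' = {}"
            using disj[of a a'] a(1) that F(2) unfolding r_def by blast
          then show "x \<notin> ?B a'" using a(2) by blast
        qed
        then have "iter_deriv vs ?\<Psi> x = c a * iter_deriv vs (\<phi> a) x"
          unfolding eq using a(1) F(1) by (subst sum.remove[of _ a]) (auto intro!: sum.neutral)
        moreover have "norm (iter_deriv vs (\<phi> a) x) \<le> D ^ m * ((1 + norm a) ^ H) ^ m * Kb"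
        proof -
          have "norm (iter_deriv vs (\<phi> a) x) = r a ^ length vs * norm (iter_deriv vs b (?t a x))"
            unfolding \<phi>_def iter_deriv_affine(1)[OF b(1) vs(1)] using r1[of a] by simp
          also have "\<dots> \<le> r a ^ m * Kb"
          proof (rule mult_mono)
            show "r a ^ length vs \<le> r a ^ m" using vs(2) r1[of a] by (intro power_increasing) auto
            show "norm (iter_deriv vs b (?t a x)) \<le> Kb"
              unfolding Kb_def using schwartz_norm_ge[OF bS vs, of _ 0] by simp
          qed (use r1[of a] in auto)
          finally show ?thesis unfolding r_def power_mult_distrib .
        qed
        moreover have "max 1 (norm x ^ n) \<le> 2 ^ n * (1 + norm a) ^ n"
        proof -
          have "1 / r a \<le> 1" using r1[of a] by simp
          then have "norm x \<le> norm a + 1"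
            using a(2) norm_triangle_ineq2[of x a] by (simp add: dist_norm norm_minus_commute[of a])
          moreover have "norm a \<ge> 0" by simp
          ultimately have "1 + norm x \<le> 2 * (1 + norm a)" by argo
          then have "(1 + norm x) ^ n \<le> (2 * (1 + norm a)) ^ n" by (rule power_mono) simp
          then show ?thesis
            unfolding power_mult_distrib by (rule order_trans[OF weight_bounds(1)[OF norm_ge_zero]])
        qed
        ultimately have "max 1 (norm x ^ n) * norm (iter_deriv vs ?\<Psi> x) \<le>
            (2 ^ n * (1 + norm a) ^ n) * ((1 / (1 + norm a) ^ q) * (D ^ m * ((1 + norm a) ^ H) ^ m * Kb))"
          by (simp only: norm_mult) (intro mult_mono c2, auto)
        also have "\<dots> = K"
        proof -
          have "1 + norm a \<noteq> 0" using norm_ge_zero[of a] by linarith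
          then show ?thesis unfolding K_def q_def by (simp add: power_add power_mult)
        qed
        finally show ?thesis .
      qed
    qed
    then have "C * (1 + schwartz_norm n m ?\<Psi>) \<le> C * (1 + K)" using C(1) by simp
    then have "norm (f ?\<Psi>) \<le> C * (1 + K)" using C(2)[OF S] by linarith
    moreover have "f ?\<Psi> = (\<Sum>a\<in>F. c a * \<mu> {a})"
      using temperate_distribution_sum[OF f F(1), of \<phi> c] phiS phi_f F(2) by (simp add: subset_iff)
    then have "f ?\<Psi> = of_real (\<Sum>a\<in>F. norm (\<mu> {a}) / (1 + norm a) ^ q)"
      by (simp only: c1 of_real_sum)
    moreover have "(\<Sum>a\<in>F. norm (\<mu> {a}) / (1 + norm a) ^ q) \<ge> 0" by (intro sum_nonneg) auto
    ultimately show ?thesis by (simp only: norm_of_real abs_of_nonneg)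
  qed
  then have "(\<lambda>a. norm (\<mu> {a}) / (1 + norm a) ^ q) summable_on A"
    by (intro nonneg_bdd_above_summable_on bdd_aboveI2[where M="C * (1 + K)"]) auto
  then show thesis by (rule that)
qed

section \<open>Expansion of the distribution over its atoms\<close>

lemma smooth_family_dilate:
  fixes \<phi> :: "'a::euclidean_space \<Rightarrow> complex"
  assumes "\<phi> \<in> schwartz_space"
  shows "smooth_family poly_bounded (\<lambda>k::nat. \<lambda>x. \<phi> (x /\<^sub>R real (Suc k)))"
  unfolding smooth_family_iter
proof (intro allI impI conjI)
  fix vs :: "'a list" and k x assume vs: "set vs \<subseteq> Basis"
  note aff = iter_deriv_affine[OF schwartz_smooth[OF assms] vs, of _ 0, simplified]
  show "iter_deriv vs (\<lambda>x. \<phi> (x /\<^sub>R real (Suc k))) differentiable (at x)" by (rule aff(2))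
  obtain C where C: "\<And>x. norm (iter_deriv vs \<phi> x) \<le> C"
    using rapid_bounded[of "\<lambda>_::unit. iter_deriv vs \<phi>"] assms vs unfolding schwartz_iff smooth_family_iter by blast
  show "poly_bounded (\<lambda>k::nat. iter_deriv vs (\<lambda>x. \<phi> (x /\<^sub>R real (Suc k))))"
  proof (rule poly_boundedI[where C=C and N=0])
    fix k :: nat and x :: 'a
    \<comment> \<open>Every derivative brings a factor \<open>1 / (k + 1)\<close>, at most 1, so the
      bound of \<open>\<phi>\<close> serves all dilates.\<close>
    have "norm (iter_deriv vs (\<lambda>x. \<phi> (x /\<^sub>R real (Suc k))) x) = inverse (real (Suc k)) ^ length vs * norm (iter_deriv vs \<phi> (x /\<^sub>R real (Suc k)))"
      unfolding aff(1) norm_scaleR by simp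
    also have "\<dots> \<le> 1 * C"
      by (intro mult_mono C power_le_one) (auto simp: field_simps)
    finally show "norm (iter_deriv vs (\<lambda>x. \<phi> (x /\<^sub>R real (Suc k))) x) \<le> C * (1 + norm x) ^ 0" by simp
  qed
qed

lemma smooth_family_partialI:
  assumes "\<And>j x. \<Phi> j differentiable (at x)" "B \<Phi>" "\<And>i. i \<in> Basis \<Longrightarrow> smooth_family B (\<lambda>j. partial i (\<Phi> j))"
  shows "smooth_family B \<Phi>"
  unfolding smooth_family_def
proof
  show "smooth_upto B n \<Phi>" for n
    using assms by (cases n) (auto simp: smooth_upto_0 smooth_upto_Suc smooth_family_def)
qed

text \<open>The family \<open>(k + 1) * (b (x / (k + 1)) - 1)\<close> of rescaled cut-off errors is polynomially bounded uniformly in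
  \<open>k\<close>, so cutting off a Schwartz function at radius \<open>k + 1\<close> costs only \<open>O(1/k)\<close>.\<close>

lemma temperate_measure_expansion:
  fixes A :: "'a::euclidean_space set"
  assumes mu: "temperate_measure \<mu> f" and supp: "cmeasure_support \<mu> \<subseteq> A" and A: "locally_finite_set A"
    and sum: "(\<lambda>a. norm (\<mu> {a}) / (1 + norm a) ^ q) summable_on A"
    and S: "\<phi> \<in> schwartz_space"
  shows "(\<lambda>a. norm (\<mu> {a} * \<phi> a)) summable_on A" and "f \<phi> = (\<Sum>\<^sub>\<infinity>a\<in>A. \<mu> {a} * \<phi> a)"
proof -
  let ?m = "\<lambda>a. \<mu> {a} * \<phi> a"
  let ?I = "\<Sum>\<^sub>\<infinity>a\<in>A. ?m a"
  have rad: "complex_radon_measure \<mu>" and f: "temperate_distribution f"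
    and int: "\<And>\<phi>. smooth \<phi> \<Longrightarrow> compact (closure {x. \<phi> x \<noteq> 0}) \<Longrightarrow> cmeasure_has_integral \<mu> \<phi> (f \<phi>)"
    using mu unfolding temperate_measure_def by auto
  \<comment> \<open>One power more than \<open>q\<close>: the surplus factor
    \<open>1 + norm a\<close> later pays for the linear growth of the cut-off error.\<close>
  obtain C where C: "C > 0" "\<And>x. (1 + norm x) ^ (Suc q) * norm (\<phi> x) \<le> C"
    using schwartz_decay[OF S] by metis
  have p: "(1 + norm a) > 0" for a :: 'a by (simp add: add_pos_nonneg)
  have w: "(1 + norm a) * norm (?m a) \<le> C * (norm (\<mu> {a}) / (1 + norm a) ^ q)" for a
  proof -
    have "(1 + norm a) * norm (?m a) = ((1 + norm a) ^ (Suc q) * norm (\<phi> a)) * (norm (\<mu> {a}) / (1 + norm a) ^ q)"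
      using p[of a] by (simp add: norm_mult field_simps)
    also have "\<dots> \<le> C * (norm (\<mu> {a}) / (1 + norm a) ^ q)"
      by (intro mult_right_mono C) auto
    finally show ?thesis .
  qed
  have sw: "(\<lambda>a. (1 + norm a) * norm (?m a)) summable_on A"
    by (rule summable_on_comparison_test[OF summable_on_cmult_right[OF sum, of C]]) (use w in auto)
  show abs: "(\<lambda>a. norm (?m a)) summable_on A"
  proof (rule summable_on_comparison_test[OF sw])
    show "norm (?m a) \<le> (1 + norm a) * norm (?m a)" for a
      by (simp add: algebra_simps)
  qed auto
  obtain b :: "'a \<Rightarrow> complex" where b: "smooth b" "b 0 = 1" "\<And>x. norm x \<ge> 1 \<Longrightarrow> b x = 0"
    using smooth_bump_exists by blast
  have bS: "b \<in> schwartz_space" by (rule smooth_compact_support_schwartz[OF b(1,3)])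
  define L where "L = real DIM('a) * schwartz_norm 0 1 b"
  have lip: "norm (b x - 1) \<le> L * norm x" for x
    using schwartz_lipschitz[OF bS, of x 0] b(2) unfolding L_def by simp
  have L0: "L \<ge> 0" unfolding L_def using schwartz_norm_nonneg[OF bS] by simp
  let ?b = "\<lambda>k::nat. \<lambda>x. b (x /\<^sub>R real (Suc k))"
  define \<Phi> where "\<Phi> k x = of_nat (Suc k) * (?b k x - 1)" for k x
  have bk: "?b k differentiable (at x)" for k x
    using smooth_family_D(1)[OF smooth_family_dilate[OF bS]] by blast
  have Phi_bound: "norm (\<Phi> k x) \<le> L * norm x" for k x
  proof -
    have "norm (\<Phi> k x) \<le> real (Suc k) * (L * norm (x /\<^sub>R real (Suc k)))"
      unfolding \<Phi>_def norm_mult norm_of_nat by (intro mult_left_mono lip) auto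
    also have "\<dots> = (real (Suc k) * inverse (real (Suc k))) * (L * norm x)" by simp
    also have "\<dots> = L * norm x" by (subst right_inverse) auto
    finally show ?thesis .
  qed
  have partial_b: "partial i (?b k) x = of_real (inverse (real (Suc k))) * partial i b (x /\<^sub>R real (Suc k))" if "i \<in> Basis" for i k x
    using iter_deriv_affine(1)[OF b(1), of "[i]" "inverse (real (Suc k))" 0 x] that
    by (simp add: partial_def scaleR_conv_of_real)
  have "smooth_family poly_bounded \<Phi>"
  proof (rule smooth_family_partialI)
    show "\<Phi> k differentiable (at x)" for k x
      unfolding \<Phi>_def[abs_def] using bk by (auto intro!: derivative_intros)
    show "poly_bounded \<Phi>"
    proof (rule poly_boundedI[where C=L and N=1])
      show "norm (\<Phi> k x) \<le> L * (1 + norm x) ^ 1" for k x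
        using Phi_bound[of k x] L0 by (simp add: algebra_simps)
    qed
    fix i :: 'a assume i: "i \<in> Basis"
    \<comment> \<open>The factor \<open>k + 1\<close> cancels against the inner derivative, so from
      first order on the family consists of dilates of a Schwartz function.\<close>
    have "partial i (\<Phi> k) x = partial i b (x /\<^sub>R real (Suc k))" for k x
    proof -
      have "partial i (\<lambda>x. of_nat (Suc k) * ?b k x + (- of_nat (Suc k)) * 1) x =
          of_nat (Suc k) * partial i (?b k) x + (- of_nat (Suc k)) * partial i (\<lambda>_. 1) x"
        by (intro partial_lincomb bk) auto
      then show ?thesis unfolding \<Phi>_def[abs_def] partial_b[OF i]
        by (simp add: algebra_simps del: of_nat_Suc)
    qed
    then have "(\<lambda>k. partial i (\<Phi> k)) = (\<lambda>k x. partial i b (x /\<^sub>R real (Suc k)))" by (simp add: fun_eq_iff)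
    then show "smooth_family poly_bounded (\<lambda>k. partial i (\<Phi> k))"
      using smooth_family_dilate[OF schwartz_partial[OF bS i]] by simp
  qed
  then have fam: "smooth_family rapid (\<lambda>k x. \<Phi> k x * \<phi> x)"
    by (rule smooth_family_poly_mult_rapid) (rule schwartz_smooth_family[OF S])
  obtain K where K: "\<And>k. norm (f (\<lambda>x. \<Phi> k x * \<phi> x)) \<le> K"
    using temperate_distribution_bounded_family[OF f fam] by metis
  define M where "M = (\<Sum>\<^sub>\<infinity>a\<in>A. (1 + norm a) * norm (?m a))"
  \<comment> \<open>Two errors of order \<open>1 / (k + 1)\<close>: \<open>K\<close> measures the
    cut-off inside \<open>f\<close>, and \<open>L * M\<close> the cut-off inside the series. On the
    cut-off function itself both sides agree, since its integral is a finite sum.\<close>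
  have main: "norm (f \<phi> - ?I) \<le> (K + L * M) / real (Suc k)" for k
  proof -
    have bkS: "?b k \<in> schwartz_space" using schwartz_affine[OF bS, of "inverse (real (Suc k))" 0] by simp
    have prodS: "(\<lambda>x. ?b k x * \<phi> x) \<in> schwartz_space"
      using schwartz_poly_mult[OF _ S, of "?b k"] smooth_family_dilate[OF bS]
      unfolding smooth_family_iter poly_bounded_def by blast
    let ?\<phi> = "\<lambda>x. ?b k x * \<phi> x"
    let ?n = "\<lambda>a. \<mu> {a} * ?\<phi> a"
    have "(\<lambda>x. \<Phi> k x * \<phi> x) = (\<lambda>x. of_nat (Suc k) * ?\<phi> x + (- of_nat (Suc k)) * \<phi> x)"
      unfolding \<Phi>_def by (simp add: fun_eq_iff algebra_simps)
    then have "f (\<lambda>x. \<Phi> k x * \<phi> x) = of_nat (Suc k) * (f ?\<phi> - f \<phi>)"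
      using temperate_distribution_lincomb[OF f prodS S, of "of_nat (Suc k)" "- of_nat (Suc k)"] by (simp add: algebra_simps)
    then have "real (Suc k) * norm (f ?\<phi> - f \<phi>) \<le> K"
      using K[of k] by (simp only: norm_mult norm_of_nat)
    then have 1: "norm (f \<phi> - f ?\<phi>) \<le> K / real (Suc k)"
      by (subst pos_le_divide_eq) (auto simp: mult.commute norm_minus_commute)
    have "?\<phi> x = 0" if "norm x \<ge> real (Suc k)" for x
    proof -
      have "norm (x /\<^sub>R real (Suc k)) \<ge> 1" using that by (simp add: field_simps)
      then show ?thesis using b(3) by simp
    qed
    then have "{x. ?\<phi> x \<noteq> 0} \<subseteq> cball 0 (real (Suc k))" by (force simp: not_le)
    then have "compact (closure {x. ?\<phi> x \<noteq> 0})" using bounded_cball bounded_subset compact_closure by blast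
    then have "cmeasure_has_integral \<mu> ?\<phi> (f ?\<phi>)" by (intro int schwartz_smooth prodS)
    then obtain F where F: "finite F" "F \<subseteq> A" "A \<inter> {x. ?\<phi> x \<noteq> 0} \<subseteq> F" "f ?\<phi> = (\<Sum>a\<in>F. ?n a)"
      by (rule cmeasure_has_integral_atoms[OF rad supp A])
    have f2: "f ?\<phi> = (\<Sum>\<^sub>\<infinity>a\<in>A. ?n a)"
      unfolding F(4) infsum_finite[OF F(1), symmetric] by (rule infsum_cong_neutral) (use F(2,3) in auto)
    have dif: "norm (?n a - ?m a) \<le> (L / real (Suc k)) * ((1 + norm a) * norm (?m a))" for a
    proof -
      have "norm (?n a - ?m a) = norm (?b k a - 1) * norm (?m a)"
        unfolding norm_mult[symmetric] by (simp add: algebra_simps)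
      also have "\<dots> \<le> (L * norm (a /\<^sub>R real (Suc k))) * norm (?m a)"
        by (intro mult_right_mono lip) auto
      also have "\<dots> = (L / real (Suc k)) * (norm a * norm (?m a))"
        by (simp add: divide_inverse)
      also have "\<dots> \<le> (L / real (Suc k)) * ((1 + norm a) * norm (?m a))"
        using L0 by (intro mult_left_mono mult_right_mono) auto
      finally show ?thesis .
    qed
    have dabs: "(\<lambda>a. norm (?n a - ?m a)) summable_on A"
      by (rule summable_on_comparison_test[OF summable_on_cmult_right[OF sw] dif]) auto
    have s1: "(\<lambda>a. ?m a) summable_on A" using abs by (rule abs_summable_summable)
    have sd: "(\<lambda>a. ?n a - ?m a) summable_on A" using dabs by (rule abs_summable_summable)
    have "f ?\<phi> = (\<Sum>\<^sub>\<infinity>a\<in>A. (?n a - ?m a) + ?m a)" unfolding f2 by simp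
    also have "\<dots> = (\<Sum>\<^sub>\<infinity>a\<in>A. ?n a - ?m a) + ?I"
      by (rule infsum_add[OF sd s1])
    finally have "f ?\<phi> - ?I = (\<Sum>\<^sub>\<infinity>a\<in>A. ?n a - ?m a)" by simp
    also have "norm \<dots> \<le> (\<Sum>\<^sub>\<infinity>a\<in>A. norm (?n a - ?m a))"
      by (rule norm_infsum_bound[OF dabs])
    also have "\<dots> \<le> (\<Sum>\<^sub>\<infinity>a\<in>A. (L / real (Suc k)) * ((1 + norm a) * norm (?m a)))"
      by (rule infsum_mono[OF dabs summable_on_cmult_right[OF sw] dif])
    also have "\<dots> = L * M / real (Suc k)" unfolding M_def infsum_cmult_right' by simp
    finally have 2: "norm (f ?\<phi> - ?I) \<le> L * M / real (Suc k)" .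
    have "norm (f \<phi> - ?I) \<le> norm (f \<phi> - f ?\<phi>) + norm (f ?\<phi> - ?I)"
      unfolding dist_norm[symmetric] by (rule dist_triangle)
    then show ?thesis using 1 2 by (simp add: add_divide_distrib)
  qed
  have "(\<lambda>k. (K + L * M) / real (Suc k)) \<longlonglongrightarrow> 0"
    using tendsto_mult_left[OF LIMSEQ_inverse_real_of_nat, of "K + L * M"] by (simp add: divide_inverse)
  then have "norm (f \<phi> - ?I) \<le> 0"
    by (rule LIMSEQ_le_const) (use main in blast)
  then show "f \<phi> = ?I" by simp
qed

section \<open>Almost periodic series of characters\<close>

lemma relatively_dense_mono: "relatively_dense S \<Longrightarrow> S \<subseteq> T \<Longrightarrow> relatively_dense T"
  unfolding relatively_dense_def by blast

text \<open>The values of finitely many characters fall into finitely many grid cells, and the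
  difference of two points with the same cells is a common approximate period. Subtracting from
  \<open>x\<close> a fixed representative of its cells gives a period within \<open>R\<close> of
  \<open>x\<close>.\<close>

lemma relatively_dense_character_periods:
  fixes F :: "'a::euclidean_space set"
  assumes F: "finite F" and d: "\<delta> > 0"
  shows "relatively_dense {\<tau>. \<forall>a\<in>F. norm (character \<tau> a - 1) < \<delta>}"
proof -
  obtain N :: nat where N: "2 / real (Suc N) < \<delta>"
    using reals_Archimedean[of "\<delta> / 2"] d by (auto simp: field_simps inverse_eq_divide)
  define M where "M = real (Suc N)"
  have M: "M > 0" "2 / M < \<delta>" unfolding M_def using N by auto
  \<comment> \<open>The grid cells of the character values at \<open>x\<close>, with mesh
    \<open>1 / M\<close> in real and imaginary part; values in one cell differ by less than
    \<open>2 / M < \<delta>\<close>.\<close>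
  define Q where "Q x = (\<lambda>a\<in>F. (\<lfloor>M * Re (character x a)\<rfloor>, \<lfloor>M * Im (character x a)\<rfloor>))" for x :: 'a
  let ?I = "{- int (Suc N)..int (Suc N)}"
  have fl: "\<lfloor>M * t\<rfloor> \<in> ?I" if "\<bar>t\<bar> \<le> 1" for t :: real
  proof -
    have "\<bar>M * t\<bar> \<le> M * 1" unfolding abs_mult using M(1) that by (simp add: mult_left_le)
    then have "- M \<le> M * t" "M * t \<le> M" by linarith+
    moreover have "\<lfloor>M\<rfloor> = int (Suc N)" "\<lfloor>- M\<rfloor> = - int (Suc N)" unfolding M_def by linarith+
    ultimately show ?thesis using floor_mono[of "- M" "M * t"] floor_mono[of "M * t" M] by simp
  qed
  have "Q x \<in> F \<rightarrow>\<^sub>E ?I \<times> ?I" for x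
  proof -
    have "\<bar>Re (character x a)\<bar> \<le> 1" "\<bar>Im (character x a)\<bar> \<le> 1" for a
      using abs_Re_le_cmod[of "character x a"] abs_Im_le_cmod[of "character x a"] by auto
    then show ?thesis unfolding Q_def using fl by auto
  qed
  then have "finite (range Q)"
    by (intro finite_subset[OF _ finite_PiE[OF F, of "\<lambda>_. ?I \<times> ?I"]]) auto
  define T where "T = (\<lambda>z. SOME x. Q x = z) ` range Q"
  have "finite T" unfolding T_def using \<open>finite (range Q)\<close> by simp
  then obtain R where R: "\<And>t. t \<in> T \<Longrightarrow> norm t < R"
    using finite_imp_bounded[of T] unfolding bounded_pos_less by blast
  have fdiff: "\<bar>s - t\<bar> < 1 / M" if "\<lfloor>M * s\<rfloor> = \<lfloor>M * t\<rfloor>" for s t :: real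
  proof -
    have "\<bar>M * s - M * t\<bar> < 1" using that floor_correct[of "M * s"] floor_correct[of "M * t"] by linarith
    then have "M * \<bar>s - t\<bar> < 1" using M(1) abs_mult[of M "s - t"] by (simp add: right_diff_distrib)
    then show ?thesis using M(1) by (simp add: pos_less_divide_eq mult.commute)
  qed
  show ?thesis unfolding relatively_dense_def
  proof (intro exI[of _ R] allI)
    fix x :: 'a
    define t where "t = (SOME y. Q y = Q x)"
    have t: "Q t = Q x" unfolding t_def by (rule someI) (rule refl)
    have "t \<in> T" unfolding T_def t_def by blast
    then have "x - t \<in> ball x R" using R by (simp add: dist_norm)
    moreover have "norm (character (x - t) a - 1) < \<delta>" if a: "a \<in> F" for a
    proof -
      have "Q t a = Q x a" using t by simp
      then have e: "\<lfloor>M * Re (character x a)\<rfloor> = \<lfloor>M * Re (character t a)\<rfloor>" "\<lfloor>M * Im (character x a)\<rfloor> = \<lfloor>M * Im (character t a)\<rfloor>"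
        unfolding Q_def using a by auto
      have "character x a - character t a = (character (x - t) a - 1) * character t a"
        using character_add[of "x - t" t a] by (simp add: algebra_simps)
      then have "norm (character (x - t) a - 1) = norm (character x a - character t a)" by (simp add: norm_mult)
      also have "\<dots> \<le> \<bar>Re (character x a) - Re (character t a)\<bar> + \<bar>Im (character x a) - Im (character t a)\<bar>"
        using cmod_le[of "character x a - character t a"] by simp
      also have "\<dots> < \<delta>" using fdiff[OF e(1)] fdiff[OF e(2)] M(2) by simp
      finally show ?thesis .
    qed
    ultimately show "{\<tau>. \<forall>a\<in>F. norm (character \<tau> a - 1) < \<delta>} \<inter> ball x R \<noteq> {}" by blast
  qed
qed

text \<open>\<open>\<N> \<tau>\<close> bounds the change under translation by \<open>\<tau>\<close>
  uniformly in the base point. Up to a small tail it is governed by finitely many differences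
  \<open>character \<tau> a - 1\<close>, which are small for small \<open>\<tau>\<close>, giving
  continuity, and on a relatively dense set, giving the periods.\<close>

lemma almost_periodic_character_series:
  fixes v :: "'a::euclidean_space \<Rightarrow> complex"
  assumes v: "(\<lambda>a. norm (v a)) summable_on A"
  shows "almost_periodic (\<lambda>t. \<Sum>\<^sub>\<infinity>a\<in>A. v a * character t a)"
proof -
  let ?g = "\<lambda>t. \<Sum>\<^sub>\<infinity>a\<in>A. v a * character t a"
  define \<N> where "\<N> \<tau> = (\<Sum>\<^sub>\<infinity>a\<in>A. norm (v a) * norm (character \<tau> a - 1))" for \<tau>
  have c2: "norm (character \<tau> a - 1) \<le> 2" for \<tau> a :: 'a
    using norm_triangle_ineq4[of "character \<tau> a" 1] by simp
  have sN: "(\<lambda>a. norm (v a) * norm (character \<tau> a - 1)) summable_on B" if "B \<subseteq> A" for \<tau> B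
    by (rule summable_on_comparison_test[OF summable_on_cmult_right[OF summable_on_subset[OF v that], of 2]])
       (use mult_left_mono[OF c2, of "norm (v _)"] in \<open>auto simp: mult.commute\<close>)
  have sg: "(\<lambda>a. v a * character t a) summable_on A" for t
    by (rule abs_summable_summable) (use v in \<open>simp add: norm_mult\<close>)
  have est: "norm (?g (x + \<tau>) - ?g x) \<le> \<N> \<tau>" for x \<tau>
  proof -
    have sd: "(\<lambda>a. v a * character x a * (character \<tau> a - 1)) summable_on A"
      by (rule abs_summable_summable) (use sN[of A] in \<open>simp add: norm_mult\<close>)
    have "?g (x + \<tau>) = (\<Sum>\<^sub>\<infinity>a\<in>A. v a * character x a * (character \<tau> a - 1) + v a * character x a)"
      by (intro infsum_cong) (simp add: character_add algebra_simps)
    also have "\<dots> = (\<Sum>\<^sub>\<infinity>a\<in>A. v a * character x a * (character \<tau> a - 1)) + ?g x"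
      by (rule infsum_add[OF sd sg])
    finally have "norm (?g (x + \<tau>) - ?g x) = norm (\<Sum>\<^sub>\<infinity>a\<in>A. v a * character x a * (character \<tau> a - 1))" by simp
    also have "\<dots> \<le> (\<Sum>\<^sub>\<infinity>a\<in>A. norm (v a * character x a * (character \<tau> a - 1)))"
      by (intro norm_infsum_bound) (use sN[of A] in \<open>simp add: norm_mult\<close>)
    also have "\<dots> = \<N> \<tau>" unfolding \<N>_def by (simp add: norm_mult)
    finally show ?thesis .
  qed
  have small: "\<exists>F \<delta>. finite F \<and> \<delta> > 0 \<and> (\<forall>\<tau>. (\<forall>a\<in>F. norm (character \<tau> a - 1) < \<delta>) \<longrightarrow> \<N> \<tau> < \<epsilon>)" if e: "\<epsilon> > 0" for \<epsilon> :: real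
  proof -
    define V where "V = (\<Sum>\<^sub>\<infinity>a\<in>A. norm (v a))"
    have V0: "V \<ge> 0" unfolding V_def by (intro infsum_nonneg) auto
    have "((\<lambda>a. norm (v a)) has_sum V) A" unfolding V_def using v by (rule has_sum_infsum)
    then obtain F where F: "finite F" "F \<subseteq> A" "dist (\<Sum>a\<in>F. norm (v a)) V \<le> \<epsilon> / 8"
      using has_sum_finite_approximation[of "\<lambda>a. norm (v a)" A V "\<epsilon> / 8"] e by auto
    \<comment> \<open>The head contributes at most \<open>V * \<delta> \<le> \<epsilon> / 2\<close>,
      the tail twice a remainder below \<open>\<epsilon> / 4\<close>; the summand 1 covers
      \<open>V = 0\<close>.\<close>
    define \<delta> where "\<delta> = \<epsilon> / (2 * (1 + V))"
    have del: "\<delta> > 0" unfolding \<delta>_def using e V0 by simp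
    have "\<N> \<tau> < \<epsilon>" if tau: "\<forall>a\<in>F. norm (character \<tau> a - 1) < \<delta>" for \<tau>
    proof -
      have split: "infsum h A = infsum h F + infsum h (A - F)"
        if "\<And>B. B \<subseteq> A \<Longrightarrow> h summable_on B" for h :: "'a \<Rightarrow> real"
        using infsum_Un_disjoint[of h F "A - F"] that F(2) by (simp add: Un_absorb1)
      have VF: "V = (\<Sum>a\<in>F. norm (v a)) + (\<Sum>\<^sub>\<infinity>a\<in>A - F. norm (v a))"
        unfolding V_def using split[of "\<lambda>a. norm (v a)"] summable_on_subset[OF v] F(1) by simp
      have "\<N> \<tau> = (\<Sum>a\<in>F. norm (v a) * norm (character \<tau> a - 1)) + (\<Sum>\<^sub>\<infinity>a\<in>A - F. norm (v a) * norm (character \<tau> a - 1))"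
        unfolding \<N>_def using split[OF sN] F(1) by simp
      also have "\<dots> \<le> (\<Sum>a\<in>F. norm (v a) * \<delta>) + (\<Sum>\<^sub>\<infinity>a\<in>A - F. norm (v a) * 2)"
        using tau summable_on_subset[OF v, of "A - F"]
        by (intro add_mono sum_mono infsum_mono mult_left_mono c2 sN summable_on_cmult_left) (auto intro: less_imp_le)
      also have "\<dots> = (\<Sum>a\<in>F. norm (v a)) * \<delta> + 2 * (\<Sum>\<^sub>\<infinity>a\<in>A - F. norm (v a))"
        unfolding sum_distrib_right infsum_cmult_left' by simp
      also have "\<dots> < \<epsilon>"
      proof -
        have "(\<Sum>a\<in>F. norm (v a)) \<le> V" unfolding VF by (simp add: infsum_nonneg)
        then have "(\<Sum>a\<in>F. norm (v a)) * \<delta> \<le> V * \<delta>" using del by (intro mult_right_mono) auto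
        also have "\<dots> \<le> \<epsilon> / 2" unfolding \<delta>_def using e V0 by (simp add: field_simps)
        finally have "(\<Sum>a\<in>F. norm (v a)) * \<delta> \<le> \<epsilon> / 2" .
        moreover have "(\<Sum>\<^sub>\<infinity>a\<in>A - F. norm (v a)) < \<epsilon> / 4" using F(3) VF e unfolding dist_real_def by linarith
        ultimately show ?thesis by linarith
      qed
      finally show ?thesis .
    qed
    then show ?thesis using F(1) del by blast
  qed
  have "continuous (at x) ?g" for x
    unfolding continuous_at_eps_delta
  proof (intro allI impI)
    fix e :: real assume "e > 0"
    then obtain F \<delta> where F: "finite F" "\<delta> > 0" "\<And>\<tau>. (\<forall>a\<in>F. norm (character \<tau> a - 1) < \<delta>) \<Longrightarrow> \<N> \<tau> < e"
      using small by blast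
    obtain R where R: "R > 0" "\<And>a. a \<in> F \<Longrightarrow> norm a \<le> R" using finite_imp_bounded[OF F(1)] unfolding bounded_pos by blast
    define d where "d = \<delta> / (2 * pi * R)"
    have "dist (?g y) (?g x) < e" if y: "dist y x < d" for y
    proof -
      have "norm (character (y - x) a - 1) < \<delta>" if a: "a \<in> F" for a
      proof -
        have "norm (character (y - x) a - 1) \<le> 2 * pi * \<bar>a \<bullet> (y - x)\<bar>" by (rule norm_character_minus_1)
        also have "\<dots> \<le> 2 * pi * (R * norm (y - x))"
          by (intro mult_left_mono order_trans[OF Cauchy_Schwarz_ineq2] mult_right_mono R(2) a) auto
        also have "\<dots> < \<delta>" using y R(1) unfolding d_def dist_norm by (simp add: pos_less_divide_eq mult.commute mult.left_commute)
        finally show ?thesis .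
      qed
      then have "\<N> (y - x) < e" by (intro F(3)) auto
      then show ?thesis using est[of x "y - x"] by (simp add: dist_norm)
    qed
    moreover have "d > 0" unfolding d_def using F(2) R(1) by simp
    ultimately show "\<exists>d>0. \<forall>y. dist y x < d \<longrightarrow> dist (?g y) (?g x) < e" by blast
  qed
  then have "continuous_on UNIV ?g" by (simp add: continuous_at_imp_continuous_on)
  moreover have "relatively_dense {\<tau>. (SUP x. ereal (norm (?g (x + \<tau>) - ?g x))) < ereal \<epsilon>}" if "\<epsilon> > 0" for \<epsilon>
  proof -
    obtain F \<delta> where F: "finite F" "\<delta> > 0" "\<And>\<tau>. (\<forall>a\<in>F. norm (character \<tau> a - 1) < \<delta>) \<Longrightarrow> \<N> \<tau> < \<epsilon>"
      using small \<open>\<epsilon> > 0\<close> by blast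
    have "{\<tau>. \<forall>a\<in>F. norm (character \<tau> a - 1) < \<delta>} \<subseteq> {\<tau>. (SUP x. ereal (norm (?g (x + \<tau>) - ?g x))) < ereal \<epsilon>}"
    proof clarify
      fix \<tau> assume "\<forall>a\<in>F. norm (character \<tau> a - 1) < \<delta>"
      then have "\<N> \<tau> < \<epsilon>" by (rule F(3))
      moreover have "(SUP x. ereal (norm (?g (x + \<tau>) - ?g x))) \<le> ereal (\<N> \<tau>)"
        by (rule SUP_least) (use est in simp)
      ultimately show "(SUP x. ereal (norm (?g (x + \<tau>) - ?g x))) < ereal \<epsilon>"
        by (meson ereal_less(2) le_less_trans less_ereal.simps(1))
    qed
    then show ?thesis
      using relatively_dense_mono relatively_dense_character_periods[OF F(1,2)] by blast
  qed
  ultimately show ?thesis unfolding almost_periodic_def by blast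
qed

text \<open>By \<open>fourier_reflect\<close> the convolution is a series of characters with
  frequencies in \<open>A\<close> and coefficients \<open>\<mu> {a} * fourier \<psi> (- a)\<close>;
  the decay of the transform outweighs the polynomial growth of the masses.\<close>

lemma p_discrete_imp_s_almost_periodic:
  assumes "temperate_measure \<mu> f" "cmeasure_support \<mu> \<subseteq> A" "locally_finite_set A" "p_discrete A"
  shows "s_almost_periodic (fourier_distribution f)"
  unfolding s_almost_periodic_def
proof
  fix \<psi> :: "'a \<Rightarrow> complex" assume S: "\<psi> \<in> schwartz_space"
  obtain q where q: "(\<lambda>a. norm (\<mu> {a}) / (1 + norm a) ^ q) summable_on A"
    using temperate_measure_atoms_summable[OF assms] .
  note ex = temperate_measure_expansion[OF assms(1,2,3) q]
  have S': "(\<lambda>x. \<psi> (t - x)) \<in> schwartz_space" for t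
    using schwartz_affine[OF S, of "- 1" t] by simp
  have "dist_convolution (fourier_distribution f) \<psi> t = (\<Sum>\<^sub>\<infinity>a\<in>A. (\<mu> {a} * fourier \<psi> (- a)) * character t a)" for t
    unfolding dist_convolution_def fourier_distribution_def ex(2)[OF fourier_schwartz[OF S']] fourier_reflect[OF S]
    by (simp add: mult.commute mult.left_commute)
  moreover have "(\<lambda>a. norm (\<mu> {a} * fourier \<psi> (- a))) summable_on A"
    using ex(1)[OF schwartz_affine[OF fourier_schwartz[OF S], of "- 1" 0]] by simp
  ultimately show "almost_periodic (dist_convolution (fourier_distribution f) \<psi>)"
    using almost_periodic_character_series[of "\<lambda>a. \<mu> {a} * fourier \<psi> (- a)" A] by presburger
qed

section \<open>Sums of dipoles\<close>

text \<open>A period for tolerance 1 near \<open>y\<close> moves \<open>y\<close> into a fixed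
  compact ball, where \<open>g\<close> is bounded by continuity.\<close>

lemma almost_periodic_imp_bounded:
  fixes g :: "'a::euclidean_space \<Rightarrow> complex"
  assumes "almost_periodic g"
  shows "bounded (range g)"
proof -
  obtain R where R: "\<And>y. {\<tau>. (SUP x. ereal (norm (g (x + \<tau>) - g x))) < ereal 1} \<inter> ball y R \<noteq> {}"
    using assms zero_less_one unfolding almost_periodic_def relatively_dense_def by blast
  have "continuous_on (cball 0 R) g" using assms continuous_on_subset unfolding almost_periodic_def by blast
  then have "compact (g ` cball 0 R)" by (rule compact_continuous_image) simp
  then obtain M where M: "\<And>x. x \<in> cball 0 R \<Longrightarrow> norm (g x) \<le> M"
    using compact_imp_bounded bounded_iff by (metis (no_types, lifting) image_eqI)
  have "norm (g y) \<le> M + 1" for y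
  proof -
    obtain \<tau> where tau: "(SUP x. ereal (norm (g (x + \<tau>) - g x))) < ereal 1" "\<tau> \<in> ball y R"
      using R[of y] by blast
    have "ereal (norm (g ((y - \<tau>) + \<tau>) - g (y - \<tau>))) \<le> (SUP x. ereal (norm (g (x + \<tau>) - g x)))"
      by (rule SUP_upper) simp
    from le_less_trans[OF this tau(1)] have "norm (g y - g (y - \<tau>)) < 1" by simp
    moreover have "norm (g (y - \<tau>)) \<le> M" using tau(2) by (intro M) (simp add: dist_norm norm_minus_commute)
    ultimately show ?thesis using norm_triangle_sub[of "g y" "g (y - \<tau>)"] by linarith
  qed
  then show ?thesis unfolding bounded_iff by blast
qed

text \<open>For a given constant and exponent, the failure of \<open>p_discrete\<close> yields a
  pair, but that pair might lie anywhere. A constant not above the least separation among the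
  finitely many points of a ball excludes pairs inside it, and a pair at distance below 1 that is
  not inside has both members far out.\<close>

lemma not_p_discrete_close_pair:
  fixes A :: "'a::euclidean_space set"
  assumes A: "locally_finite_set A" and np: "\<not> p_discrete A" and e: "\<epsilon> > 0"
  obtains x x' where "x \<in> A" "x' \<in> A" "x \<noteq> x'" "real N \<le> norm x" "real N \<le> norm x'"
    "norm (x - x') * (1 + norm x) ^ N \<le> \<epsilon>"
proof -
  define F where "F = A \<inter> ball 0 (real N + 1)"
  have fin: "finite F" using A unfolding F_def locally_finite_set_def by blast
  \<comment> \<open>The inserted 1 makes the set nonempty and forces
    \<open>\<delta> \<le> 1\<close>: two points this close, not both of norm below
    \<open>N + 1\<close>, both have norm at least \<open>N\<close>.\<close>
  define D where "D = insert 1 ((\<lambda>(x, x'). norm (x - x')) ` {p \<in> F \<times> F. fst p \<noteq> snd p})"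
  have finD: "finite D" unfolding D_def using fin by auto
  define \<delta> where "\<delta> = Min D"
  have "\<delta> \<in> D" unfolding \<delta>_def using finD by (intro Min_in) (auto simp: D_def)
  then have d0: "\<delta> > 0" unfolding D_def by auto
  have d1: "\<delta> \<le> 1" unfolding \<delta>_def using finD by (intro Min_le) (auto simp: D_def)
  have dF: "\<delta> \<le> norm (x - x')" if "x \<in> F" "x' \<in> F" "x \<noteq> x'" for x x'
    unfolding \<delta>_def using finD that by (intro Min_le) (force simp: D_def)+
  \<comment> \<open>The part \<open>\<epsilon> / 2 ^ N\<close> absorbs the factor lost in passing
    from \<open>M\<close> to \<open>(1 + norm x) ^ N\<close>.\<close>
  define c where "c = min \<delta> (\<epsilon> / 2 ^ N)"
  have c: "c > 0" unfolding c_def using d0 e by simp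
  \<comment> \<open>The exponent is \<open>N + 1\<close> in order to be positive also for
    \<open>N = 0\<close>.\<close>
  obtain x x' where x: "x \<in> A" "x' \<in> A" "x \<noteq> x'"
    "norm (x - x') < c / Max {1, norm x powr (real N + 1), norm x' powr (real N + 1)}"
    using np c unfolding p_discrete_def by (metis add_nonneg_pos linorder_not_le of_nat_0_le_iff zero_less_one)
  define M where "M = Max {1, norm x powr (real N + 1), norm x' powr (real N + 1)}"
  have M: "M \<ge> 1" "norm x powr (real N + 1) \<le> M" unfolding M_def by auto
  have lt: "norm (x - x') < c / M" using x(4) unfolding M_def .
  also have "\<dots> \<le> c" using M(1) c by (simp add: divide_le_eq)
  finally have lt': "norm (x - x') < c" .
  then have ld: "norm (x - x') < \<delta>" unfolding c_def by simp
  have tri: "norm x' \<le> norm x + norm (x - x')" "norm x \<le> norm x' + norm (x - x')"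
    using norm_triangle_sub[of x' x] norm_triangle_sub[of x x'] by (simp_all add: norm_minus_commute)
  have notF: "\<not> (norm x < real N + 1 \<and> norm x' < real N + 1)"
    using dF[of x x'] x(1-3) ld unfolding F_def by auto
  have "real N \<le> norm x" "real N \<le> norm x'" using notF tri ld d1 by linarith+
  moreover have "norm (x - x') * (1 + norm x) ^ N \<le> \<epsilon>"
  proof -
    have "norm x ^ N \<le> M"
    proof (cases "norm x \<le> 1")
      case True then show ?thesis using M(1) power_le_one[of "norm x" N] by simp
    next
      case False
      then have "norm x ^ N = norm x powr real N" by (subst powr_realpow) auto
      also have "\<dots> \<le> norm x powr (real N + 1)" using False by (intro powr_mono) auto
      finally show ?thesis using M(2) by simp
    qed
    then have "(1 + norm x) ^ N \<le> 2 ^ N * M"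
      using weight_bounds(2)[of "norm x" N] M(1) by (meson max.boundedI mult_left_mono norm_ge_zero order_trans zero_le_numeral zero_le_power)
    then have "norm (x - x') * (1 + norm x) ^ N \<le> (c / M) * (2 ^ N * M)"
      using lt M(1) c by (intro mult_mono) auto
    also have "\<dots> = c * 2 ^ N" using M(1) by simp
    also have "\<dots> \<le> \<epsilon>" unfolding c_def using e by (simp add: min_def field_simps)
    finally show ?thesis .
  qed
  ultimately show thesis using that x(1-3) by blast
qed

text \<open>\<open>u k\<close> is the fourth root of the distance, so that all later quantities are
  integral powers of it. \<open>u_small\<close> lets \<open>u k\<close> beat each fixed power of
  \<open>norm (X k)\<close>, \<open>X_large\<close> leaves finitely many pairs in each ball, and
  \<open>u_Suc\<close> separates the scales of successive dipoles.\<close>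

locale close_pairs =
  fixes A :: "'a::euclidean_space set" and X X' :: "nat \<Rightarrow> 'a" and u :: "nat \<Rightarrow> real"
  assumes locally_finite: "locally_finite_set A"
    and X_in: "X k \<in> A" "X' k \<in> A"
    and u_pos: "u k > 0"
    and dist_X: "norm (X' k - X k) = u k ^ 4"
    and X_large: "real k \<le> norm (X k)" "real k \<le> norm (X' k)"
    and u_small: "u k * 2 ^ k * (1 + norm (X k)) ^ k \<le> 1"
    and u_Suc: "u (Suc k) * 2 ^ Suc k \<le> u k ^ 2"

lemma close_pairs_exist:
  assumes A: "locally_finite_set A" and np: "\<not> p_discrete A"
  obtains X X' u where "close_pairs A X X' u"
proof -
  let ?u = "\<lambda>p. root 4 (norm (snd p - fst p))"
  define P where "P = (\<lambda>k p. fst p \<in> A \<and> snd p \<in> A \<and> snd p \<noteq> fst p \<and> real k \<le> norm (fst p) \<and> real k \<le> norm (snd p) \<and>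
    ?u p * 2 ^ k * (1 + norm (fst p)) ^ k \<le> 1)"
  have ex: "\<exists>p. P k p \<and> ?u p * 2 ^ k \<le> \<eta>" if eta: "\<eta> > 0" for k \<eta>
  proof -
    \<comment> \<open>The pair is sought with exponent \<open>4 * k\<close> and tolerance
      \<open>\<epsilon> ^ 4\<close>, since \<open>?u\<close> takes a fourth root; the divisor
      \<open>2 ^ k\<close> cancels the \<open>2 ^ k\<close> in both requirements.\<close>
    define \<epsilon> where "\<epsilon> = min 1 \<eta> / 2 ^ k"
    have eps: "\<epsilon> > 0" unfolding \<epsilon>_def using eta by simp
    then have eps4: "\<epsilon> ^ 4 > 0" by simp
    obtain x x' where x: "x \<in> A" "x' \<in> A" "x \<noteq> x'" "real (4 * k) \<le> norm x" "real (4 * k) \<le> norm x'"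
        "norm (x - x') * (1 + norm x) ^ (4 * k) \<le> \<epsilon> ^ 4"
      using not_p_discrete_close_pair[OF A np eps4, where N="4 * k"] by metis
    let ?v = "?u (x, x')"
    have v0: "?v \<ge> 0" by simp
    have "(?v * (1 + norm x) ^ k) ^ 4 \<le> \<epsilon> ^ 4"
      using x(6) by (simp add: power_mult_distrib norm_minus_commute power_mult[symmetric] mult.commute)
    then have le: "?v * (1 + norm x) ^ k \<le> \<epsilon>" using eps by (subst (asm) power_mono_iff) auto
    have "?v * 1 \<le> ?v * (1 + norm x) ^ k" by (rule mult_left_mono) auto
    then have "?v \<le> \<epsilon>" using le by simp
    then have "?v * 2 ^ k \<le> \<epsilon> * 2 ^ k" by (rule mult_right_mono) simp
    then have 1: "?v * 2 ^ k \<le> \<eta>" unfolding \<epsilon>_def by simp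
    have "?v * (1 + norm x) ^ k * 2 ^ k \<le> \<epsilon> * 2 ^ k" using le by (rule mult_right_mono) simp
    then have "?v * 2 ^ k * (1 + norm x) ^ k \<le> 1" unfolding \<epsilon>_def by (simp add: ac_simps)
    then have "P k (x, x')" unfolding P_def using x by auto
    then show ?thesis using 1 by blast
  qed
  \<comment> \<open>Dependent choice: the tolerance at stage \<open>k + 1\<close> is the square of
    the preceding \<open>u\<close>, known only after stage \<open>k\<close>.\<close>
  have "\<exists>p. \<forall>k. P k (p k) \<and> ?u (p (Suc k)) * 2 ^ Suc k \<le> ?u (p k) ^ 2"
  proof (rule dependent_nat_choice)
    show "\<exists>p. P 0 p" using ex[of 1 0] by auto
    fix p k assume p: "P k p"
    have "?u p ^ 2 > 0" using p unfolding P_def by (intro zero_less_power) auto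
    from ex[OF this] show "\<exists>q. P (Suc k) q \<and> ?u q * 2 ^ Suc k \<le> ?u p ^ 2" .
  qed
  then obtain p where p: "\<And>k. P k (p k)" "\<And>k. ?u (p (Suc k)) * 2 ^ Suc k \<le> ?u (p k) ^ 2" by blast
  have "close_pairs A (\<lambda>k. fst (p k)) (\<lambda>k. snd (p k)) (\<lambda>k. ?u (p k))"
    by unfold_locales (use A p in \<open>auto simp: P_def\<close>)
  then show thesis by (rule that)
qed

context close_pairs begin

lemma u_le: "u k \<le> 1 / 2 ^ k"
proof -
  have "u k * 2 ^ k * 1 \<le> u k * 2 ^ k * (1 + norm (X k)) ^ k"
    using u_pos[of k] by (intro mult_left_mono) auto
  then have "u k * 2 ^ k \<le> 1" using u_small[of k] by simp
  then show ?thesis by (simp add: pos_le_divide_eq)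
qed

lemma u_le_1: "u k \<le> 1"
  by (rule order_trans[OF u_le]) simp

lemma u_square_le: "u k ^ 2 \<le> (1/4) ^ k"
proof -
  have "u k ^ 2 \<le> (1 / 2 ^ k) ^ 2" using u_le u_pos[of k] by (intro power_mono) (auto intro: less_imp_le)
  also have "\<dots> = (1/4) ^ k" by (simp add: power_divide power2_eq_square flip: power_mult_distrib)
  finally show ?thesis .
qed

text \<open>Chains \<open>u_Suc\<close> through \<open>u i ^ 2 \<le> u i \<le> u i * 2 ^ i\<close>,
  valid since no \<open>u i\<close> exceeds 1.\<close>

lemma u_less: "k < j \<Longrightarrow> u j * 2 ^ j \<le> u k ^ 2"
proof (induction j rule: less_induct)
  case (less j)
  then obtain i where j: "j = Suc i" by (cases j) auto
  show ?case
  proof (cases "i = k")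
    case True then show ?thesis using u_Suc[of k] j by simp
  next
    case False
    then have "u i * 2 ^ i \<le> u k ^ 2" using less j by simp
    moreover have "u i * 1 \<le> u i * 2 ^ i" using u_pos[of i] by (intro mult_left_mono) auto
    moreover have "u i ^ 2 \<le> u i * 1" unfolding power2_eq_square using u_le_1[of i] u_pos[of i] by (intro mult_left_mono) auto
    ultimately show ?thesis using u_Suc[of i] unfolding j by linarith
  qed
qed

abbreviation dipole_term :: "('a \<Rightarrow> complex) \<Rightarrow> nat \<Rightarrow> complex" where
  "dipole_term \<phi> k \<equiv> of_real (1 / u k ^ 2) * (\<phi> (X' k) - \<phi> (X k))"

definition dipole :: "('a \<Rightarrow> complex) \<Rightarrow> complex" where
  "dipole \<phi> = (\<Sum>k. dipole_term \<phi> k)"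

lemma dipole_term_bound:
  fixes \<phi> :: "'a \<Rightarrow> complex"
  assumes "\<And>x y. norm (\<phi> x - \<phi> y) \<le> L * norm (x - y)"
  shows "norm (dipole_term \<phi> k) \<le> L * u k ^ 2"
proof -
  have "norm (dipole_term \<phi> k) \<le> 1 / u k ^ 2 * (L * u k ^ 4)"
    unfolding norm_mult norm_of_real using assms[of "X' k" "X k"] u_pos[of k] unfolding dist_X
    by (intro mult_mono) auto
  also have "\<dots> = L * u k ^ 2" using u_pos[of k] by (simp add: power4_eq_xxxx power2_eq_square)
  finally show ?thesis .
qed

text \<open>Stated for a bare Lipschitz bound so that it covers Schwartz functions and their
  modulations alike.\<close>

lemma dipole_summable:
  assumes L: "\<And>x y. norm (\<phi> x - \<phi> y) \<le> L * norm (x - y)"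
  shows "summable (\<lambda>k. dipole_term \<phi> k)"
    and "norm (dipole \<phi>) \<le> 2 * \<bar>L\<bar>"
proof -
  have b: "norm (dipole_term \<phi> k) \<le> \<bar>L\<bar> * (1/4) ^ k" for k
  proof -
    have "L * u k ^ 2 \<le> \<bar>L\<bar> * (1/4) ^ k" using u_square_le[of k] by (intro mult_mono) auto
    then show ?thesis using dipole_term_bound[OF L, of k] by linarith
  qed
  have s: "summable (\<lambda>k. \<bar>L\<bar> * (1/4::real) ^ k)" by (intro summable_mult summable_geometric) auto
  show "summable (\<lambda>k. dipole_term \<phi> k)"
    using b by (rule summable_comparison_test'[OF s])
  have "norm (dipole \<phi>) \<le> (\<Sum>k. \<bar>L\<bar> * (1/4::real) ^ k)" unfolding dipole_def by (rule norm_suminf_le[OF b s])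
  also have "\<dots> = \<bar>L\<bar> * (4 / 3)"
    using suminf_mult[OF summable_geometric[of "1/4::real"], of "\<bar>L\<bar>"] suminf_geometric[of "1/4::real"] by simp
  also have "\<dots> \<le> 2 * \<bar>L\<bar>" by simp
  finally show "norm (dipole \<phi>) \<le> 2 * \<bar>L\<bar>" .
qed

lemma temperate_dipole: "temperate_distribution dipole"
proof (rule temperate_distributionI)
  fix \<phi> \<psi> :: "'a \<Rightarrow> complex" and a b assume S: "\<phi> \<in> schwartz_space" "\<psi> \<in> schwartz_space"
  note s = dipole_summable(1)[OF schwartz_lipschitz[OF S(1)]] dipole_summable(1)[OF schwartz_lipschitz[OF S(2)]]
  have "dipole (\<lambda>x. a * \<phi> x + b * \<psi> x) = (\<Sum>k. a * (dipole_term \<phi> k) +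
      b * (dipole_term \<psi> k))"
  proof -
    have "c * ((a * x + b * y) - (a * x' + b * y')) = a * (c * (x - x')) + b * (c * (y - y'))" for c x x' y y' :: complex
      by (simp add: algebra_simps)
    then show ?thesis unfolding dipole_def by (simp only:)
  qed
  also have "\<dots> = a * dipole \<phi> + b * dipole \<psi>"
    unfolding dipole_def by (simp only: suminf_add[symmetric] suminf_mult s summable_mult)
  finally show "dipole (\<lambda>x. a * \<phi> x + b * \<psi> x) = a * dipole \<phi> + b * dipole \<psi>" .
next
  fix \<phi> :: "'a \<Rightarrow> complex" assume S: "\<phi> \<in> schwartz_space"
  show "norm (dipole \<phi>) \<le> (2 * real DIM('a)) * schwartz_norm 0 1 \<phi>"
    using dipole_summable(2)[OF schwartz_lipschitz[OF S]] schwartz_norm_nonneg[OF S, of 0 1] by (simp add: abs_mult)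
qed

text \<open>By \<open>X_large\<close> the dipoles from index \<open>N\<close> on lie outside the
  open ball of radius \<open>N\<close>.\<close>

lemma dipole_finite:
  assumes "\<And>x. norm x \<ge> real N \<Longrightarrow> \<phi> x = 0"
  shows "dipole \<phi> = (\<Sum>k<N. dipole_term \<phi> k)"
  unfolding dipole_def
proof (rule suminf_finite)
  fix k assume "k \<notin> {..<N}"
  then have "\<phi> (X k) = 0" "\<phi> (X' k) = 0" using X_large[of k] by (auto intro!: assms)
  then show "dipole_term \<phi> k = 0" by simp
qed simp

section \<open>The dipoles as a complex measure\<close>

definition dipole_measure :: "'a set \<Rightarrow> complex" where
  "dipole_measure B = dipole (indicator B)"

lemma dipole_measure_finite:
  assumes "B \<subseteq> ball 0 (real N)"
  shows "dipole_measure B = (\<Sum>k<N. dipole_term (indicator B) k)"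
  unfolding dipole_measure_def by (rule dipole_finite) (use assms in \<open>auto simp: indicator_def\<close>)

text \<open>On subsets of one ball the measure is a fixed finite combination of values of the
  indicator, and countable additivity is inherited from indicators of disjoint unions.\<close>

lemma complex_radon_dipole_measure: "complex_radon_measure dipole_measure"
  unfolding complex_radon_measure_def
proof (intro allI impI)
  fix B :: "nat \<Rightarrow> 'a set" assume d: "disjoint_family B" and b: "bounded (\<Union>i. B i)"
  obtain r where "(\<Union>i. B i) \<subseteq> ball 0 r" using bounded_subset_ballD[OF b, of 0] by blast
  moreover obtain N :: nat where "r \<le> real N" using real_arch_simple by blast
  ultimately have N: "(\<Union>i. B i) \<subseteq> ball 0 (real N)" by (auto dest!: subsetD)
  have ind: "(\<lambda>i. indicator (B i) x :: complex) sums indicator (\<Union>i. B i) x" for x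
  proof -
    have "(\<lambda>i. complex_of_real (indicator (B i) x)) sums complex_of_real (indicator (\<Union>i. B i) x)"
      using d by (intro sums_of_real indicator_sums) (auto simp: disjoint_family_on_def)
    moreover have "complex_of_real (indicator S x) = indicator S x" for S by (simp add: indicator_def)
    ultimately show ?thesis by (simp only:)
  qed
  have "(\<lambda>i. \<Sum>k<N. dipole_term (indicator (B i)) k)
      sums (\<Sum>k<N. dipole_term (indicator (\<Union>i. B i)) k)"
    by (intro sums_sum sums_mult sums_diff ind)
  moreover have "dipole_measure (B i) = (\<Sum>k<N. dipole_term (indicator (B i)) k)" for i
    using N by (intro dipole_measure_finite) blast
  ultimately show "(\<lambda>i. dipole_measure (B i)) sums dipole_measure (\<Union>i. B i)"
    unfolding dipole_measure_finite[OF N] by (simp only:)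
qed

lemma support_dipole_measure: "cmeasure_support dipole_measure \<subseteq> A"
proof
  fix x assume x: "x \<in> cmeasure_support dipole_measure"
  show "x \<in> A"
  proof (rule ccontr)
    assume "x \<notin> A"
    define U where "U = ball x 1 - (A \<inter> ball x 1)"
    have "finite (A \<inter> ball x 1)" using locally_finite unfolding locally_finite_set_def by blast
    then have "open U" unfolding U_def by (intro open_Diff finite_imp_closed) auto
    moreover have "x \<in> U" unfolding U_def using \<open>x \<notin> A\<close> by simp
    ultimately obtain B where B: "B \<subseteq> U" "dipole_measure B \<noteq> 0"
      using x unfolding cmeasure_support_def by blast
    then have "X k \<notin> B" "X' k \<notin> B" for k using X_in[of k] unfolding U_def by auto
    then have "dipole_measure B = 0" unfolding dipole_measure_def dipole_def by simp
    then show False using B(2) by blast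
  qed
qed

text \<open>Rounding real and imaginary part to a grid gives the simple functions. Against each of
  them the measure is a sum over the same finitely many dipoles, so pointwise convergence suffices
  for the limit.\<close>

lemma dipole_measure_has_integral:
  assumes cont: "continuous_on UNIV \<phi>" and K: "compact (closure {x. \<phi> x \<noteq> 0})"
  shows "cmeasure_has_integral dipole_measure \<phi> (dipole \<phi>)"
proof -
  obtain r where "closure {x. \<phi> x \<noteq> 0} \<subseteq> ball 0 r" using bounded_subset_ballD[OF compact_imp_bounded[OF K], of 0] by blast
  moreover obtain N :: nat where "r \<le> real N" using real_arch_simple by blast
  ultimately have "{x. \<phi> x \<noteq> 0} \<subseteq> ball 0 (real N)" using closure_subset[of "{x. \<phi> x \<noteq> 0}"] subset_ball[of r "real N" 0] by (meson order_trans)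
  then have N: "\<phi> x = 0" if "norm x \<ge> real N" for x using that by (auto dest!: subsetD[where c=x])
  have dipole_eq: "dipole \<phi> = (\<Sum>k<N. dipole_term \<phi> k)"
    using N by (rule dipole_finite)
  have "compact (\<phi> ` cball 0 (real N))"
    by (rule compact_continuous_image) (use cont continuous_on_subset in auto)
  then obtain M where M: "\<And>x. x \<in> cball 0 (real N) \<Longrightarrow> norm (\<phi> x) \<le> M"
    using compact_imp_bounded bounded_iff by (metis (no_types, lifting) image_eqI)
  have M': "norm (\<phi> x) \<le> max M 0" for x using M[of x] N[of x] by (cases "norm x \<le> real N") auto
  \<comment> \<open>Rounding down fixes 0, so the approximants vanish wherever \<open>\<phi>\<close>
    does and share a bounded support.\<close>
  define q where "q n t = of_int \<lfloor>real (Suc n) * t\<rfloor> / real (Suc n)" for n t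
  define s where "s n x = complex_of_real (q n (Re (\<phi> x))) + \<i> * complex_of_real (q n (Im (\<phi> x)))" for n x
  have q0: "q n 0 = 0" for n unfolding q_def by simp
  have q1: "\<bar>q n t - t\<bar> \<le> 1 / real (Suc n)" for n t
  proof -
    have "\<bar>of_int \<lfloor>real (Suc n) * t\<rfloor> - real (Suc n) * t\<bar> \<le> 1" by linarith
    then have "\<bar>of_int \<lfloor>real (Suc n) * t\<rfloor> - real (Suc n) * t\<bar> / real (Suc n) \<le> 1 / real (Suc n)" by (rule divide_right_mono) simp
    moreover have "q n t - t = (of_int \<lfloor>real (Suc n) * t\<rfloor> - real (Suc n) * t) / real (Suc n)"
      unfolding q_def by (simp add: diff_divide_distrib)
    ultimately show ?thesis by (simp add: abs_divide)
  qed
  have s0: "s n x = 0" if "norm x \<ge> real N" for n x unfolding s_def using N[OF that] q0 by simp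
  have s_out: "x \<in> ball 0 (real N)" if "s n x \<noteq> 0" for n x
    using s0[of x n] that by (cases "real N \<le> norm x") auto
  have meas: "s n \<in> borel_measurable borel" for n
  proof -
    have [measurable]: "\<phi> \<in> borel_measurable borel" using cont by (rule borel_measurable_continuous_onI)
    show ?thesis unfolding s_def[abs_def] q_def by measurable
  qed
  have fin: "finite (range (s n))" for n
  proof -
    let ?I = "{- \<lceil>real (Suc n) * max M 0\<rceil> .. \<lceil>real (Suc n) * max M 0\<rceil>}"
    let ?h = "\<lambda>(a, b). complex_of_real (of_int a / real (Suc n)) + \<i> * complex_of_real (of_int b / real (Suc n))"
    have I: "\<lfloor>real (Suc n) * t\<rfloor> \<in> ?I" if "\<bar>t\<bar> \<le> max M 0" for t
    proof -
      have "\<bar>real (Suc n) * t\<bar> \<le> real (Suc n) * max M 0"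
        unfolding abs_mult using that by (intro mult_mono) auto
      then show ?thesis by simp linarith
    qed
    have "s n x \<in> ?h ` (?I \<times> ?I)" for x
    proof -
      have "\<bar>Re (\<phi> x)\<bar> \<le> max M 0" "\<bar>Im (\<phi> x)\<bar> \<le> max M 0"
        using abs_Re_le_cmod[of "\<phi> x"] abs_Im_le_cmod[of "\<phi> x"] M'[of x] by linarith+
      then show ?thesis unfolding s_def q_def by (intro image_eqI[of _ _ "(\<lfloor>real (Suc n) * Re (\<phi> x)\<rfloor>, \<lfloor>real (Suc n) * Im (\<phi> x)\<rfloor>)"]) (use I in auto)
    qed
    then have "range (s n) \<subseteq> ?h ` (?I \<times> ?I)" by (rule image_subsetI)
    moreover have "finite (?h ` (?I \<times> ?I))"
      by (intro finite_imageI finite_cartesian_product finite_atLeastAtMost_int)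
    ultimately show ?thesis by (rule finite_subset)
  qed
  have sd: "norm (s n x - \<phi> x) \<le> 2 / real (Suc n)" for n x
  proof -
    have "norm (s n x - \<phi> x) \<le> \<bar>Re (s n x - \<phi> x)\<bar> + \<bar>Im (s n x - \<phi> x)\<bar>" by (rule cmod_le)
    also have "\<dots> \<le> 1 / real (Suc n) + 1 / real (Suc n)"
      using q1[of n "Re (\<phi> x)"] q1[of n "Im (\<phi> x)"] unfolding s_def by simp
    finally show ?thesis by simp
  qed
  \<comment> \<open>After exchanging the sums, adding \<open>z\<close> times the indicator of the
    level set of \<open>z\<close> over the nonzero values rebuilds \<open>s n\<close>.\<close>
  have integral: "(\<Sum>z\<in>range (s n) - {0}. z * dipole_measure (s n -` {z})) = (\<Sum>k<N. dipole_term (s n) k)" for n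
  proof -
    have ind: "(\<Sum>z\<in>range (s n) - {0}. z * indicator (s n -` {z}) x) = s n x" for x
    proof -
      have "(\<Sum>z\<in>range (s n) - {0}. z * indicator (s n -` {z}) x) = (\<Sum>z\<in>range (s n) - {0}. if z = s n x then s n x else 0)"
        by (rule sum.cong) (auto simp: indicator_def)
      also have "\<dots> = s n x" using fin by (subst sum.delta) auto
      finally show ?thesis .
    qed
    have "z * dipole_measure (s n -` {z}) = (\<Sum>k<N. of_real (1 / u k ^ 2) * (z * indicator (s n -` {z}) (X' k) - z * indicator (s n -` {z}) (X k)))"
      if "z \<noteq> 0" for z
    proof -
      have "s n -` {z} \<subseteq> ball 0 (real N)" using s_out[of n] that by auto
      from dipole_measure_finite[OF this] show ?thesis by (simp add: sum_distrib_left algebra_simps)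
    qed
    then have "(\<Sum>z\<in>range (s n) - {0}. z * dipole_measure (s n -` {z})) =
      (\<Sum>z\<in>range (s n) - {0}. \<Sum>k<N. of_real (1 / u k ^ 2) * (z * indicator (s n -` {z}) (X' k) - z * indicator (s n -` {z}) (X k)))"
      by (intro sum.cong) auto
    also have "\<dots> = (\<Sum>k<N. dipole_term (s n) k)"
      by (subst sum.swap) (simp only: sum_distrib_left[symmetric] sum_subtractf ind)
    finally show ?thesis .
  qed
  have small: "(\<lambda>n. 2 / real (Suc n)) \<longlonglongrightarrow> 0"
    using tendsto_mult_left[OF LIMSEQ_inverse_real_of_nat, of 2] by (simp add: divide_inverse)
  show ?thesis unfolding cmeasure_has_integral_def
  proof (intro exI[of _ s] conjI allI)
    show "simple_function borel (s n)" for n using meas fin by (intro simple_function_borel_measurable) auto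
    have "(\<Union>n. {x. s n x \<noteq> 0}) \<subseteq> ball 0 (real N)" using s_out by auto
    then show "bounded (\<Union>n. {x. s n x \<noteq> 0})" using bounded_ball bounded_subset by blast
    show "uniform_limit UNIV s \<phi> sequentially"
    proof (rule uniform_limitI)
      fix e :: real assume "e > 0"
      then have "\<forall>\<^sub>F n in sequentially. 2 / real (Suc n) < e" by (rule order_tendstoD(2)[OF small])
      then show "\<forall>\<^sub>F n in sequentially. \<forall>x\<in>UNIV. dist (s n x) (\<phi> x) < e"
        by eventually_elim (use sd in \<open>auto simp: dist_norm intro: le_less_trans\<close>)
    qed
    have "(\<lambda>n. s n x) \<longlonglongrightarrow> \<phi> x" for x
      by (rule LIM_zero_cancel) (rule Lim_null_comparison[OF _ small], use sd in auto)
    then show "(\<lambda>n. \<Sum>z\<in>range (s n) - {0}. z * dipole_measure (s n -` {z})) \<longlonglongrightarrow> dipole \<phi>"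
      unfolding integral dipole_eq by (intro tendsto_sum tendsto_mult_left tendsto_diff)
  qed
qed

lemma temperate_dipole_measure: "temperate_measure dipole_measure dipole"
  unfolding temperate_measure_def
  using complex_radon_dipole_measure temperate_dipole dipole_measure_has_integral smooth_imp_continuous_on by blast

end

section \<open>A test function that detects every dipole\<close>

context close_pairs begin

text \<open>A derivative multiplies the character at \<open>X k\<close> by a coordinate of
  \<open>X k\<close>, so the coefficients grow by powers of \<open>norm (X k)\<close>;
  \<open>adm\<close> allows any fixed power \<open>N\<close>. By \<open>u_small\<close> the
  coefficients with \<open>k \<ge> N\<close> stay bounded, and only finitely many others
  remain.\<close>

lemma smooth_family_characters:
  "smooth_family poly_bounded (\<lambda>k x. of_real (u k * 2 ^ k) * character (X k) x)"
proof -
  define adm where "adm c \<longleftrightarrow> (\<exists>C N. C \<ge> 0 \<and> (\<forall>k. norm (c k) \<le> C * (u k * 2 ^ k * (1 + norm (X k)) ^ N)))"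
    for c :: "nat \<Rightarrow> complex"
  have bd: "\<exists>M. \<forall>k. norm (c k) \<le> M" if c: "adm c" for c
  proof -
    obtain C N where C0: "C \<ge> 0" and "\<forall>k. norm (c k) \<le> C * (u k * 2 ^ k * (1 + norm (X k)) ^ N)"
      using c unfolding adm_def by blast
    then have C: "norm (c k) \<le> C * (u k * 2 ^ k * (1 + norm (X k)) ^ N)" for k by blast
    have nonneg: "0 \<le> u k * 2 ^ k * (1 + norm (X k)) ^ N" for k using u_pos[of k] by simp
    have "u k * 2 ^ k * (1 + norm (X k)) ^ N \<le> 1 + (\<Sum>k<N. u k * 2 ^ k * (1 + norm (X k)) ^ N)" for k
    proof (cases "k < N")
      case True
      then have "u k * 2 ^ k * (1 + norm (X k)) ^ N \<le> (\<Sum>k<N. u k * 2 ^ k * (1 + norm (X k)) ^ N)"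
        using nonneg by (intro member_le_sum[of k]) auto
      then show ?thesis by simp
    next
      case False
      have "u k * 2 ^ k * (1 + norm (X k)) ^ N \<le> u k * 2 ^ k * (1 + norm (X k)) ^ k"
        using u_pos[of k] False by (intro mult_left_mono power_increasing) auto
      also have "\<dots> \<le> 1" by (rule u_small)
      also have "1 \<le> 1 + (\<Sum>k<N. u k * 2 ^ k * (1 + norm (X k)) ^ N)"
        using nonneg by (simp add: sum_nonneg)
      finally show ?thesis .
    qed
    then show ?thesis
      by (intro exI allI) (rule order_trans[OF C mult_left_mono[OF _ C0]])
  qed
  show ?thesis
  proof (rule smooth_family_coinduct[where P="\<lambda>\<Phi>. \<exists>c. adm c \<and> \<Phi> = (\<lambda>k x. c k * character (X k) x)"])
    show "\<exists>c. adm c \<and> (\<lambda>k x. of_real (u k * 2 ^ k) * character (X k) x) = (\<lambda>k x. c k * character (X k) x)"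
    proof (intro exI conjI)
      have "norm (complex_of_real (u k * 2 ^ k)) \<le> 1 * (u k * 2 ^ k * (1 + norm (X k)) ^ 0)" for k
        unfolding norm_of_real using u_pos[of k] by simp
      then show "adm (\<lambda>k. of_real (u k * 2 ^ k))" unfolding adm_def by (metis zero_le_one)
    qed simp
    fix \<Phi> :: "nat \<Rightarrow> 'a \<Rightarrow> complex"
    assume "\<exists>c. adm c \<and> \<Phi> = (\<lambda>k x. c k * character (X k) x)"
    then obtain c where c: "adm c" "\<Phi> = (\<lambda>k x. c k * character (X k) x)" by blast
    show "\<Phi> k differentiable (at x)" for k x unfolding c(2) by (rule partial_character(2))
    obtain M where "\<And>k. norm (c k) \<le> M" using bd[OF c(1)] by blast
    then show "poly_bounded \<Phi>" unfolding c(2) by (intro poly_boundedI[where C=M and N=0]) (simp add: norm_mult)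
    fix i :: 'a assume i: "i \<in> Basis"
    let ?c = "\<lambda>k. c k * (- 2 * complex_of_real pi * \<i> * complex_of_real (i \<bullet> X k))"
    have "adm ?c"
    proof -
      obtain C N where C: "C \<ge> 0" "\<forall>k. norm (c k) \<le> C * (u k * 2 ^ k * (1 + norm (X k)) ^ N)"
        using c(1) unfolding adm_def by blast
      have "norm (?c k) \<le> (2 * pi * C) * (u k * 2 ^ k * (1 + norm (X k)) ^ Suc N)" for k
      proof -
        have "\<bar>i \<bullet> X k\<bar> \<le> 1 + norm (X k)"
          using Basis_le_norm[OF i, of "X k"] by (simp add: inner_commute)
        moreover have "norm (?c k) = norm (c k) * (2 * pi * \<bar>i \<bullet> X k\<bar>)" by (simp add: norm_mult)
        ultimately have "norm (?c k) \<le> C * (u k * 2 ^ k * (1 + norm (X k)) ^ N) * (2 * pi * (1 + norm (X k)))"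
          using C(1) C(2)[rule_format, of k] u_pos[of k] by (simp only:) (intro mult_mono mult_left_mono, auto)
        then show ?thesis by (simp add: algebra_simps)
      qed
      then show ?thesis unfolding adm_def using C(1) by (intro exI[of _ "2 * pi * C"] exI[of _ "Suc N"]) simp
    qed
    moreover have "(\<lambda>k. partial i (\<Phi> k)) = (\<lambda>k x. ?c k * character (X k) x)"
      unfolding c(2) by (simp only: fun_eq_iff partial_character) simp
    ultimately show "\<exists>c. adm c \<and> (\<lambda>k. partial i (\<Phi> k)) = (\<lambda>k x. c k * character (X k) x)"
      by blast
  qed
qed

text \<open>A superposition of modulated Gaussians: all its terms have positive Fourier transform, so that no
  cancellation can occur at the points \<open>X k\<close>.\<close>

lemma test_function:
  obtains \<psi> :: "'a \<Rightarrow> complex" and h :: "'a \<Rightarrow> real" and c :: real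
  where "\<psi> \<in> schwartz_space" "\<And>y. fourier \<psi> (- y) = of_real (h y)" "\<And>y. h y \<ge> 0" "c > 0" "\<And>k. h (X k) \<ge> c * u k"
proof -
  obtain c where c: "c > 0" "\<And>y::'a. fourier gauss y = of_real (c * exp (- pi * (y \<bullet> y)))"
    using fourier_gauss by blast
  \<comment> \<open>The factor \<open>2 ^ k\<close> is cancelled by the weights in
    \<open>schwartz_series\<close>, which leaves the coefficients \<open>u k\<close>.\<close>
  define \<Psi> where "\<Psi> k x = of_real (u k * 2 ^ k) * character (X k) x * gauss x" for k and x :: 'a
  have "smooth_family rapid \<Psi>"
    unfolding \<Psi>_def[abs_def] by (intro smooth_family_poly_mult_rapid smooth_family_characters schwartz_smooth_family gauss_schwartz)
  then have S: "(\<lambda>x. \<Sum>k. \<Psi> k x / 2 ^ k) \<in> schwartz_space" by (rule schwartz_series)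
  \<comment> \<open>Modulation becomes translation: the reflected transform is a sum of Gaussians of
    height \<open>c * u k\<close> centred at \<open>X k\<close>.\<close>
  define h where "h y = (\<Sum>k. u k * (c * exp (- pi * ((X k - y) \<bullet> (X k - y)))))" for y
  have u_sum: "summable u"
  proof (rule summable_comparison_test')
    show "summable (\<lambda>k. (1/2::real) ^ k)" by (rule summable_geometric) simp
    show "norm (u k) \<le> (1/2) ^ k" for k using u_le[of k] u_pos[of k] by (simp add: power_one_over)
  qed
  have hsum: "summable (\<lambda>k. u k * (c * exp (- pi * ((X k - y) \<bullet> (X k - y)))))" for y
  proof (rule summable_comparison_test'[OF summable_mult[OF u_sum, of c]])
    fix k
    have "exp (- pi * ((X k - y) \<bullet> (X k - y))) \<le> 1" by simp
    then show "norm (u k * (c * exp (- pi * ((X k - y) \<bullet> (X k - y))))) \<le> c * u k"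
      using u_pos[of k] c(1) by (simp add: abs_mult mult.commute mult_left_le)
  qed
  have h0: "h y \<ge> 0" for y unfolding h_def using u_pos c(1) by (intro suminf_nonneg hsum) (simp add: less_imp_le)
  have hX: "h (X k) \<ge> c * u k" for k
  proof -
    \<comment> \<open>All terms are nonnegative, and the term centred at \<open>X k\<close> alone
      has the value \<open>c * u k\<close> there.\<close>
    have "(\<Sum>j\<in>{k}. u j * (c * exp (- pi * ((X j - X k) \<bullet> (X j - X k))))) \<le> h (X k)"
      unfolding h_def using u_pos c(1) by (intro sum_le_suminf hsum) (auto intro: less_imp_le)
    then show ?thesis by (simp add: mult.commute)
  qed
  have "fourier (\<lambda>x. \<Sum>k. \<Psi> k x / 2 ^ k) (- y) = of_real (h y)" for y
  proof -
    have eq: "\<Psi> k x / 2 ^ k * character (- y) x = of_real (u k) * (gauss x * character (X k - y) x)" for k x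
      unfolding \<Psi>_def using character_add[of "X k" "- y" x] by (simp add: ac_simps)
    have term_eq: "(LINT x|lborel. \<Psi> k x / 2 ^ k * character (- y) x) = of_real (u k * (c * exp (- pi * ((X k - y) \<bullet> (X k - y)))))" for k
      unfolding eq using c(2)[of "X k - y"] unfolding fourier_character by simp
    have gi: "integrable lborel (gauss :: 'a \<Rightarrow> complex)" by (rule schwartz_integrable[OF gauss_schwartz])
    have int: "integrable lborel (\<lambda>x. \<Psi> k x / 2 ^ k * character (- y) x)" for k
      unfolding eq by (intro integrable_mult_right integrable_character gi)
    have nrm: "norm (\<Psi> k x / 2 ^ k * character (- y) x) = u k * norm (gauss x)" for k x
      unfolding eq using u_pos[of k] by (simp add: norm_mult)
    have s1: "summable (\<lambda>k. norm (\<Psi> k x / 2 ^ k * character (- y) x))" for x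
      unfolding nrm by (intro summable_mult2 u_sum)
    have s2: "summable (\<lambda>k. LINT x|lborel. norm (\<Psi> k x / 2 ^ k * character (- y) x))"
      unfolding nrm by (simp add: summable_mult2 u_sum)
    have "fourier (\<lambda>x. \<Sum>k. \<Psi> k x / 2 ^ k) (- y) = (LINT x|lborel. (\<Sum>k. \<Psi> k x / 2 ^ k * character (- y) x))"
      unfolding fourier_character
    proof (rule Bochner_Integration.integral_cong[OF refl])
      fix x
      have "summable (\<lambda>k. \<Psi> k x / 2 ^ k)"
        by (rule summable_norm_cancel) (use s1[of x] in \<open>simp add: norm_mult norm_divide\<close>)
      then show "(\<Sum>k. \<Psi> k x / 2 ^ k) * character (- y) x = (\<Sum>k. \<Psi> k x / 2 ^ k * character (- y) x)"
        by (rule suminf_mult2)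
    qed
    also have "\<dots> = (\<Sum>k. LINT x|lborel. \<Psi> k x / 2 ^ k * character (- y) x)"
      by (rule integral_suminf[OF int _ s2]) (use s1 in auto)
    also have "\<dots> = of_real (h y)" unfolding term_eq h_def by (rule suminf_of_real[OF hsum, symmetric])
    finally show ?thesis .
  qed
  then show thesis by (rule that[OF S _ h0 c(1) hX])
qed

lemma unbounded_convolution:
  obtains \<psi> where "\<psi> \<in> schwartz_space" "\<not> bounded (range (dist_convolution (fourier_distribution dipole) \<psi>))"
proof -
  obtain \<psi> :: "'a \<Rightarrow> complex" and h c where S: "\<psi> \<in> schwartz_space"
    and h: "\<And>y. fourier \<psi> (- y) = of_real (h y)" "\<And>y. h y \<ge> 0" and c: "c > 0" "\<And>k. h (X k) \<ge> c * u k"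
    using test_function by metis
  let ?\<chi> = "\<lambda>y. complex_of_real (h y)"
  have chiS: "?\<chi> \<in> schwartz_space"
    using schwartz_affine[OF fourier_schwartz[OF S], of "- 1" 0] by (simp add: h(1))
  define L where "L = real DIM('a) * schwartz_norm 0 1 ?\<chi>"
  have L: "norm (?\<chi> x - ?\<chi> y) \<le> L * norm (x - y)" for x y
    unfolding L_def by (rule schwartz_lipschitz[OF chiS])
  have L0: "L \<ge> 0" unfolding L_def using schwartz_norm_nonneg[OF chiS, of 0 1] by simp
  obtain C where C: "C > 0" "\<And>x. norm (?\<chi> x) \<le> C" using schwartz_decay[OF chiS, of 0] by auto
  define T where "T t k = of_real (1 / u k ^ 2) * (character t (X' k) * ?\<chi> (X' k) - character t (X k) * ?\<chi> (X k))" for t k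
  let ?g = "dist_convolution (fourier_distribution dipole) \<psi>"
  have g: "?g t = (\<Sum>k. T t k)" for t
    unfolding dist_convolution_def fourier_distribution_def fourier_reflect[OF S] h(1) dipole_def T_def ..
  have lip: "norm (character t x * ?\<chi> x - character t y * ?\<chi> y) \<le> (L + 2 * pi * norm t * C) * norm (x - y)" for t x y
  proof -
    have "character t x * ?\<chi> x - character t y * ?\<chi> y = character t x * (?\<chi> x - ?\<chi> y) + (character t x - character t y) * ?\<chi> y"
      by (simp add: algebra_simps)
    also have "norm \<dots> \<le> norm (?\<chi> x - ?\<chi> y) + norm (character t x - character t y) * norm (?\<chi> y)"
      by (rule order_trans[OF norm_triangle_ineq]) (simp add: norm_mult)
    also have "\<dots> \<le> L * norm (x - y) + (2 * pi * norm t * norm (x - y)) * C"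
      by (intro add_mono L mult_mono norm_character_diff C) auto
    finally show ?thesis by (simp add: algebra_simps)
  qed
  have summable: "summable (T t)" for t unfolding T_def by (rule dipole_summable(1)[OF lip])
  \<comment> \<open>Dipole \<open>k\<close> gives at least \<open>c / u k\<close>, the earlier ones
    take away at most the multiple \<open>2 * C * k / 2 ^ k\<close> of \<open>1 / u k\<close>, and
    the later ones at most a constant independent of \<open>k\<close>.\<close>
  have big: "norm (?g ((1 / (2 * u k ^ 8)) *\<^sub>R (X' k - X k))) \<ge> (c - 2 * C * (real k / 2 ^ k)) * (1 / u k) - 2 * (L + pi * C)" for k
  proof -
    \<comment> \<open>Half the displacement divided by its squared length \<open>u k ^ 8\<close>:
      the inner product with the displacement is \<open>1 / 2\<close>, which is half a turn of
      phase.\<close>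
    define t where "t = (1 / (2 * u k ^ 8)) *\<^sub>R (X' k - X k)"
    have uk: "u k > 0" by (rule u_pos)
    have nt: "norm t = 1 / (2 * u k ^ 4)"
    proof -
      have "\<bar>1 / (2 * v ^ 2)\<bar> * v = 1 / (2 * v)" if "v > 0" for v :: real
        using that by (simp add: power2_eq_square)
      from this[of "u k ^ 4"] show ?thesis unfolding t_def norm_scaleR dist_X using uk by (simp flip: power_mult)
    qed
    have "character t (X' k - X k) = - 1"
    proof -
      have "(X' k - X k) \<bullet> (X' k - X k) = u k ^ 8"
        unfolding power2_norm_eq_inner[symmetric] dist_X by (simp add: power_mult[symmetric])
      then have "(X' k - X k) \<bullet> t = 1 / 2" unfolding t_def using uk by simp
      then have "character t (X' k - X k) = cis (- pi)" unfolding character_iexp cis_conv_exp by (simp only:) simp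
      then show ?thesis by (simp add: complex_eq_iff)
    qed
    then have "character t (X' k) = - character t (X k)"
      using character_add_right[of t "X k" "X' k - X k"] by simp
    \<comment> \<open>With the sign flipped, the values of \<open>h\<close> at the two ends add up,
      and both are nonnegative.\<close>
    then have Tk: "T t k = - (character t (X k) * of_real (1 / u k ^ 2 * (h (X' k) + h (X k))))"
      unfolding T_def by (simp add: algebra_simps add_divide_distrib)
    have main: "norm (T t k) \<ge> c * (1 / u k)"
    proof -
      have "c * (1 / u k) = 1 / u k ^ 2 * (c * u k)" using uk by (simp add: power2_eq_square)
      also have "\<dots> \<le> 1 / u k ^ 2 * (h (X' k) + h (X k))"
        using c(2)[of k] h(2)[of "X' k"] uk by (intro mult_left_mono) auto
      also have "\<dots> \<le> norm (T t k)" unfolding Tk norm_minus_cancel norm_mult norm_character norm_of_real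
        by (simp only: mult_1 abs_ge_self)
      finally show ?thesis .
    qed
    \<comment> \<open>For earlier dipoles the size of the test function suffices;
      \<open>u_less\<close> bounds the weight \<open>1 / u j ^ 2\<close> by
      \<open>1 / (u k * 2 ^ k)\<close>.\<close>
    have early: "norm (T t j) \<le> 2 * C * (1 / 2 ^ k * (1 / u k))" if "j < k" for j
    proof -
      have uj: "u j > 0" by (rule u_pos)
      have "norm (character t (X' j) * ?\<chi> (X' j) - character t (X j) * ?\<chi> (X j)) \<le> C + C"
        using C(2)[of "X' j"] C(2)[of "X j"] by (intro norm_triangle_le_diff add_mono) (auto simp: norm_mult)
      then have "norm (T t j) \<le> 1 / u j ^ 2 * (C + C)"
        unfolding T_def norm_mult norm_of_real by (intro mult_mono) auto
      also have "\<dots> \<le> 1 / (u k * 2 ^ k) * (C + C)"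
        using u_less[OF that] uk uj C(1) by (intro mult_right_mono divide_left_mono) auto
      finally show ?thesis by (simp add: field_simps)
    qed
    \<comment> \<open>For later dipoles the Lipschitz constant of the modulated function contains
      \<open>pi * C / u k ^ 4\<close>; by \<open>u_less\<close>, \<open>u ?j ^ 2\<close> is at most
      \<open>u k ^ 4\<close> times a geometric factor, which cancels this.\<close>
    have late: "norm (T t (j + Suc k)) \<le> (L + pi * C) * (1/4) ^ j" for j
    proof -
      let ?j = "j + Suc k"
      have "norm (T t ?j) \<le> (L + 2 * pi * norm t * C) * u ?j ^ 2"
        unfolding T_def by (rule dipole_term_bound[OF lip])
      also have "\<dots> = L * u ?j ^ 2 + pi * C * (u ?j ^ 2 / u k ^ 4)"
        unfolding nt by (simp add: field_simps)
      also have "\<dots> \<le> L * (1/4) ^ j + pi * C * (1/4) ^ j"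
      proof (intro add_mono mult_left_mono)
        have q: "(1/4::real) ^ ?j \<le> (1/4) ^ j" by (intro power_decreasing) auto
        show "u ?j ^ 2 \<le> (1/4) ^ j" using u_square_le[of ?j] q by linarith
        have "u ?j \<le> u k ^ 2 / 2 ^ ?j" using u_less[of k ?j] by (simp add: pos_le_divide_eq)
        then have "u ?j ^ 2 \<le> (u k ^ 2 / 2 ^ ?j) ^ 2" using u_pos[of ?j] by (intro power_mono) auto
        also have "\<dots> = u k ^ 4 * (1/4) ^ ?j"
          by (simp add: power_divide power2_eq_square power4_eq_xxxx flip: power_mult_distrib)
        finally have "u ?j ^ 2 / u k ^ 4 \<le> (1/4) ^ ?j" using uk by (simp add: pos_divide_le_eq mult.commute)
        then show "u ?j ^ 2 / u k ^ 4 \<le> (1/4) ^ j" using q by linarith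
      qed (use L0 C(1) in auto)
      finally show ?thesis by (simp add: algebra_simps)
    qed
    have gs: "summable (\<lambda>j. (L + pi * C) * (1/4::real) ^ j)" by (intro summable_mult summable_geometric) auto
    have tail: "norm (\<Sum>j. T t (j + Suc k)) \<le> 2 * (L + pi * C)"
    proof -
      have "norm (\<Sum>j. T t (j + Suc k)) \<le> (\<Sum>j. (L + pi * C) * (1/4::real) ^ j)" by (rule norm_suminf_le[OF late gs])
      also have "\<dots> = (L + pi * C) * (4 / 3)"
        using suminf_mult[OF summable_geometric[of "1/4::real"], of "L + pi * C"] suminf_geometric[of "1/4::real"] by simp
      also have "\<dots> \<le> (L + pi * C) * 2" using L0 C(1) by (intro mult_left_mono) auto
      finally show ?thesis by simp
    qed
    have head: "norm (\<Sum>j<k. T t j) \<le> real k * (2 * C * (1 / 2 ^ k * (1 / u k)))"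
      using sum_norm_le[of "{..<k}" "T t" "\<lambda>_. 2 * C * (1 / 2 ^ k * (1 / u k))"] early by simp
    have "?g t = (\<Sum>j. T t (j + Suc k)) + ((\<Sum>j<k. T t j) + T t k)"
      unfolding g using suminf_split_initial_segment[OF summable[of t], of "Suc k"] by simp
    then have "T t k = ?g t - (\<Sum>j. T t (j + Suc k)) - (\<Sum>j<k. T t j)" by (simp add: algebra_simps)
    then have "norm (T t k) \<le> norm (?g t) + norm (\<Sum>j. T t (j + Suc k)) + norm (\<Sum>j<k. T t j)"
      by (simp only:) (intro order_trans[OF norm_triangle_ineq4] add_mono norm_triangle_ineq4 order_refl)
    then have "c * (1 / u k) \<le> norm (?g t) + 2 * (L + pi * C) + real k * (2 * C * (1 / 2 ^ k * (1 / u k)))"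
      using main tail head by linarith
    then show ?thesis unfolding t_def[symmetric] by (simp add: algebra_simps)
  qed
  have "\<not> bounded (range ?g)"
  proof
    assume "bounded (range ?g)"
    then obtain M where M: "\<And>t. norm (?g t) \<le> M" unfolding bounded_iff by auto
    \<comment> \<open>The relative loss to the earlier dipoles tends to 0, so eventually half of
      \<open>c / u k\<close> survives, and it exceeds every bound because
      \<open>1 / u k \<ge> 2 ^ k\<close>.\<close>
    have "(\<lambda>k. 2 * C * (real k / 2 ^ k)) \<longlonglongrightarrow> 2 * C * 0"
      by (intro tendsto_mult_left) real_asymp
    then have "\<forall>\<^sub>F k in sequentially. 2 * C * (real k / 2 ^ k) < c / 2" using c(1) by (intro order_tendstoD(2)) auto
    moreover have "filterlim (\<lambda>k. c / 2 * 2 ^ k) at_top sequentially" using c(1) by real_asymp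
    then have "\<forall>\<^sub>F k in sequentially. c / 2 * 2 ^ k > M + 2 * (L + pi * C)" unfolding filterlim_at_top_dense by blast
    ultimately have "\<forall>\<^sub>F k in sequentially. False"
    proof eventually_elim
      case (elim k)
      have "2 ^ k \<le> 1 / u k" using u_le[of k] u_pos[of k] by (simp add: field_simps)
      then have "c / 2 * 2 ^ k \<le> c / 2 * (1 / u k)" using c(1) by (intro mult_left_mono) auto
      also have "\<dots> \<le> (c - 2 * C * (real k / 2 ^ k)) * (1 / u k)" using elim(1) u_pos[of k] by (intro mult_right_mono) auto
      finally show False using big[of k] M[of "(1 / (2 * u k ^ 8)) *\<^sub>R (X' k - X k)"] elim(2) by linarith
    qed
    then show False by simp
  qed
  then show thesis using that S by blast
qed

end

text \<open>Serves both the necessity and the supplement, since s-almost periodicity implies this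
  boundedness.\<close>

lemma bounded_imp_p_discrete:
  fixes A :: "'a::euclidean_space set"
  assumes A: "locally_finite_set A"
    and bounded: "\<And>\<mu> f \<psi>. temperate_measure \<mu> f \<Longrightarrow> cmeasure_support \<mu> \<subseteq> A \<Longrightarrow> \<psi> \<in> schwartz_space \<Longrightarrow>
      bounded (range (dist_convolution (fourier_distribution f) \<psi>))"
  shows "p_discrete A"
proof (rule ccontr)
  assume "\<not> p_discrete A"
  then obtain X X' u where "close_pairs A X X' u" using close_pairs_exist[OF A] by blast
  then interpret close_pairs A X X' u .
  obtain \<psi> where "\<psi> \<in> schwartz_space" "\<not> bounded (range (dist_convolution (fourier_distribution dipole) \<psi>))"
    by (rule unbounded_convolution)
  then show False using bounded[OF temperate_dipole_measure support_dipole_measure] by blast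
qed

theorem theorem5:
  fixes A :: "'a::euclidean_space set"
  assumes "locally_finite_set A"
  shows "((\<forall>\<mu> f. temperate_measure \<mu> f \<and> cmeasure_support \<mu> \<subseteq> A \<longrightarrow>
              s_almost_periodic (fourier_distribution f))
            \<longleftrightarrow> p_discrete A) \<and>
         ((\<forall>\<mu> f. temperate_measure \<mu> f \<and> cmeasure_support \<mu> \<subseteq> A \<longrightarrow>
              (\<forall>\<psi>\<in>schwartz_space.
                 bounded (range (dist_convolution (fourier_distribution f) \<psi>))))
            \<longrightarrow> p_discrete A)"
proof (intro conjI iffI impI)
  assume ap: "\<forall>\<mu> f. temperate_measure \<mu> f \<and> cmeasure_support \<mu> \<subseteq> A \<longrightarrow> s_almost_periodic (fourier_distribution f)"
  show "p_discrete A"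
  proof (rule bounded_imp_p_discrete[OF assms])
    fix \<mu> f and \<psi> :: "'a \<Rightarrow> complex"
    assume "temperate_measure \<mu> f" "cmeasure_support \<mu> \<subseteq> A" and S: "\<psi> \<in> schwartz_space"
    then have "s_almost_periodic (fourier_distribution f)" using ap by blast
    then show "bounded (range (dist_convolution (fourier_distribution f) \<psi>))"
      unfolding s_almost_periodic_def using S by (intro almost_periodic_imp_bounded) blast
  qed
next
  assume p: "p_discrete A"
  show "\<forall>\<mu> f. temperate_measure \<mu> f \<and> cmeasure_support \<mu> \<subseteq> A \<longrightarrow> s_almost_periodic (fourier_distribution f)"
    using p_discrete_imp_s_almost_periodic[OF _ _ assms p] by blast
next
  assume b: "\<forall>\<mu> f. temperate_measure \<mu> f \<and> cmeasure_support \<mu> \<subseteq> A \<longrightarrow>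
      (\<forall>\<psi>\<in>schwartz_space. bounded (range (dist_convolution (fourier_distribution f) \<psi>)))"
  show "p_discrete A" by (rule bounded_imp_p_discrete[OF assms]) (use b in blast)
qed

end
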